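(* For each $k\geq 1$ let $\xi^{(k)}=(\xi^{(k)}_1,\xi^{(k)}_2,\dots)\in\mathcal{SP}_{n_k}$, where $(n_k)$ is a sequence of positive integers tending to infinity. Assume that the rescaled profiles converge pointwise on $\mathbb{R}_+=[0,\infty)$ to some limit \[\Omega_1:=\lim_{k\to\infty}\omega_{\frac{1}{\sqrt{2n_k}}\xi^{(k)}},\] and put $\Lambda=\{(x,y): 0\leq y\leq x \text{ and } x+y<\Omega_1(x-y)\}$. Assume moreover that the sequence $(\xi^{(k)})$ is $C$-balanced for some constant $C>0$, i.e. $\xi^{(k)}_1<C\sqrt{n_k}$ for all $k\geq 1$. Then there exists a function $F\colon\Lambda\to[0,1]$ with the following property. For $0<\alpha<1$ define the level curve $\Omega_\alpha\colon\mathbb{R}_+\to\mathbb{R}_+$ by \[\Omega_\alpha(z)=\sup\{x+y : (x,y)\in\Lambda,\ x-y=z,\ F(x,y)\leq\alpha\}\] for $z\geq 0$, with the convention that $\Omega_\alpha(z)=|z|$ if the supremum is over the empty set. Let $T^{(k)}$ be a uniformly random element of $\mathcal{T}_{\xi^{(k)}}$. Then for each $0<\alpha<1$ and each $\epsilon>0$, \[\lim_{k\to\infty}\mathbb{P}\Big\{\sup_{x\geq 0}\Big|\omega_{\frac{1}{\sqrt{2n_k}}T^{(k)}_{\leq\alpha n_k}}(x)-\Omega_\alpha(x)\Big|>\epsilon\Big\}=0.\]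
   Context: A strict partition of $n$ is a sequence of integers $\xi_1>\xi_2>\dots>\xi_\ell>0$ with $\xi_1+\dots+\xi_\ell=n$ (padded by zeros); $\mathcal{SP}_n$ denotes the set of strict partitions of $n$. The shifted Young diagram of $\xi$ is the set of boxes $\{(x,y)\in\mathbb{N}^2: 1\leq y<x\leq y+\xi_y\}$, the box $(x,y)$ being the unit square $[x-1,x]\times[y-1,y]$ in the plane. Introduce coordinates $z=x-y-\tfrac12$, $t=x+y-\tfrac12$. The profile $\omega_\xi\colon\mathbb{R}\to\mathbb{R}_+$ is defined for $z\geq0$ by $\omega_\xi(z)=\max\big(|z|,\sup\{t:(z,t)\text{ lies in the union of the boxes of }\xi\}\big)$ (the supremum of the empty set being $-\infty$), and extended by $\omega_\xi(-z)=\omega_\xi(z)$. For $r>0$ the profile of the dilated diagram is defined by $\omega_{r\xi}(z)=r\,\omega_\xi(z/r)$. A shifted standard tableau of shape $\xi\in\mathcal{SP}_n$ is a filling of the boxes of the shifted Young diagram of $\xi$ by $1,\dots,n$, each used once, increasing along rows and columns; $\mathcal{T}_\xi$ is the set of such tableaux. For a tableau $T$ and a real $s$, $T_{\leq s}$ denotes the strict partition whose shifted Young diagram consists of the boxes of $T$ with entries $\leq s$. *)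

theory Defs
  imports "HOL-Probability.Probability"
begin

definition strict_partitions :: "nat \<Rightarrow> nat list set" where
  "strict_partitions n = {xs. sorted_wrt (>) xs \<and> (\<forall>p\<in>set xs. p > 0) \<and> sum_list xs = n}"

text \<open>Parts are numbered from 1, and the sequence of parts is padded by zeros.\<close>

definition nth_part :: "nat list \<Rightarrow> nat \<Rightarrow> nat" where
  "nth_part xs i = (if 1 \<le> i \<and> i \<le> length xs then xs ! (i - 1) else 0)"

definition shifted_diagram :: "nat list \<Rightarrow> (nat \<times> nat) set" where
  "shifted_diagram xs = {(x, y). 1 \<le> y \<and> y < x \<and> x \<le> y + nth_part xs y}"

definition shifted_region :: "nat list \<Rightarrow> (real \<times> real) set" where
  "shifted_region xs =
     (\<Union>(x, y)\<in>shifted_diagram xs. {real x - 1..real x} \<times> {real y - 1..real y})"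

text \<open>
  The heights \<open>t = x + y - 1/2\<close> of the points of the region that lie on the vertical line
  of abscissa \<open>z = x - y - 1/2\<close>.
\<close>

definition profile_heights :: "nat list \<Rightarrow> real \<Rightarrow> real set" where
  "profile_heights xs z =
     {x + y - 1/2 | x y. (x, y) \<in> shifted_region xs \<and> x - y - 1/2 = z}"

text \<open>
  The defining formula is only meant for nonnegative arguments; \<open>\<bar>z\<bar>\<close> gives the even extension.
  The first branch is the convention that the supremum of the empty set is \<open>-\<infinity>\<close>.
\<close>

definition profile :: "nat list \<Rightarrow> real \<Rightarrow> real" where
  "profile xs z =
     (if profile_heights xs \<bar>z\<bar> = {} then \<bar>z\<bar> else max \<bar>z\<bar> (Sup (profile_heights xs \<bar>z\<bar>)))"

definition dilated_profile :: "real \<Rightarrow> nat list \<Rightarrow> real \<Rightarrow> real" where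
  "dilated_profile r xs z = r * profile xs (z / r)"

text \<open>Box \<open>(x, y)\<close> lies in row \<open>y\<close> and column \<open>x\<close>. Fillings are extensional, so that
  distinct elements of the set are distinct tableaux.\<close>

definition shifted_tableaux :: "nat list \<Rightarrow> (nat \<times> nat \<Rightarrow> nat) set" where
  "shifted_tableaux xs =
     {T \<in> extensional (shifted_diagram xs).
        bij_betw T (shifted_diagram xs) {1..sum_list xs} \<and>
        (\<forall>x x' y. (x, y) \<in> shifted_diagram xs \<and> (x', y) \<in> shifted_diagram xs \<and> x < x'
           \<longrightarrow> T (x, y) < T (x', y)) \<and>
        (\<forall>x y y'. (x, y) \<in> shifted_diagram xs \<and> (x, y') \<in> shifted_diagram xs \<and> y < y'
           \<longrightarrow> T (x, y) < T (x, y'))}"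

definition tableau_le :: "nat list \<Rightarrow> (nat \<times> nat \<Rightarrow> nat) \<Rightarrow> real \<Rightarrow> nat list" where
  "tableau_le xs T s =
     (THE ys. (\<exists>m. ys \<in> strict_partitions m) \<and>
        shifted_diagram ys = {b \<in> shifted_diagram xs. real (T b) \<le> s})"

lemma shifted_diagram_inj:
  assumes "xs \<in> strict_partitions m" "ys \<in> strict_partitions m'"
    and eq: "shifted_diagram xs = shifted_diagram ys"
  shows "xs = ys"
proof -
  have row: "{x. (x, y) \<in> shifted_diagram zs} = {y<..y + nth_part zs y}" if "y \<ge> 1" for y zs
    using that by (auto simp: shifted_diagram_def)
  have p: "nth_part xs y = nth_part ys y" if "y \<ge> 1" for y
  proof -
    have "card {y<..y + nth_part xs y} = card {y<..y + nth_part ys y}"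
      using row[OF that] eq by metis
    then show ?thesis by simp
  qed
  have pos: "nth_part zs (Suc i) > 0 \<longleftrightarrow> i < length zs"
    if "zs \<in> strict_partitions q" for zs i q
    using that by (auto simp: strict_partitions_def nth_part_def)
  have len: "i < length xs \<longleftrightarrow> i < length ys" for i
    using pos[OF assms(1), of i] pos[OF assms(2), of i] p[of "Suc i"] by simp
  have l: "length xs = length ys"
    using len[of "length xs"] len[of "length ys"] by simp
  show ?thesis
  proof (rule nth_equalityI[OF l])
    fix i assume "i < length xs"
    then show "xs ! i = ys ! i" using p[of "Suc i"] l by (simp add: nth_part_def)
  qed
qed

text \<open>The description in the definition of \<open>tableau_le\<close> determines a unique strict partition.\<close>

lemma tableau_le_ex1:
  assumes xs: "xs \<in> strict_partitions n" and T: "T \<in> shifted_tableaux xs"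
  shows "\<exists>!ys. (\<exists>m. ys \<in> strict_partitions m) \<and>
           shifted_diagram ys = {b \<in> shifted_diagram xs. real (T b) \<le> s}"
proof -
  define S where "S = {b \<in> shifted_diagram xs. real (T b) \<le> s}"
  define r where "r y = card {x. (x, y) \<in> S}" for y
  have fin: "finite {x. (x, y) \<in> S}" for y
    by (rule finite_subset[of _ "{..y + nth_part xs y}"]) (auto simp: S_def shifted_diagram_def)
  have left: "(x', y) \<in> S" if "(x, y) \<in> S" "y < x'" "x' \<le> x" for x x' y
  proof (cases "x' = x")
    case False
    have d: "(x', y) \<in> shifted_diagram xs"
      using that by (auto simp: S_def shifted_diagram_def)
    then have "T (x', y) < T (x, y)"
      using T that False by (auto simp: shifted_tableaux_def S_def)
    then show ?thesis using that d by (auto simp: S_def)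
  qed (use that in simp)
  have row: "{x. (x, y) \<in> S} = {y<..y + r y}" for y
  proof (cases "{x. (x, y) \<in> S} = {}")
    case True
    then show ?thesis by (simp add: r_def)
  next
    case False
    define M where "M = Max {x. (x, y) \<in> S}"
    have M: "(M, y) \<in> S" "\<And>x. (x, y) \<in> S \<Longrightarrow> x \<le> M"
      using Max_in[OF fin False] Max_ge[OF fin] by (auto simp: M_def)
    have gt: "y < x" if "(x, y) \<in> S" for x
      using that by (auto simp: S_def shifted_diagram_def)
    have e: "{x. (x, y) \<in> S} = {y<..M}"
    proof (rule set_eqI)
      fix x
      show "x \<in> {x. (x, y) \<in> S} \<longleftrightarrow> x \<in> {y<..M}"
        using M(2)[of x] gt[of x] left[OF M(1), of x] by auto
    qed
    then have "r y = M - y" by (simp add: r_def)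
    with e gt[OF M(1)] show ?thesis by simp
  qed
  have mem: "(x, y) \<in> S \<longleftrightarrow> y < x \<and> x \<le> y + r y" for x y
    using row[of y] by (metis greaterThanAtMost_iff mem_Collect_eq)
  have r0: "r 0 = 0"
    using mem[of 1 0] by (auto simp: S_def shifted_diagram_def)
  have rx: "r y \<le> nth_part xs y" for y
    using mem[of "y + r y" y] by (cases "r y = 0") (auto simp: S_def shifted_diagram_def)
  have sx: "nth_part xs (Suc y) < nth_part xs y" if "nth_part xs (Suc y) > 0" "y \<ge> 1" for y
    using that xs sorted_wrt_nth_less[of "(>)" xs "y - 1" y]
    by (auto simp: strict_partitions_def nth_part_def split: if_splits)
  have dec: "r (Suc y) < r y" if "r (Suc y) > 0" "y \<ge> 1" for y
  proof -
    let ?x = "Suc y + r (Suc y)"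
    have a: "(?x, Suc y) \<in> S" using that mem by simp
    have "nth_part xs (Suc y) < nth_part xs y" using sx rx[of "Suc y"] that by simp
    then have d: "(?x, y) \<in> shifted_diagram xs"
      using rx[of "Suc y"] that by (auto simp: shifted_diagram_def)
    have "T (?x, y) < T (?x, Suc y)"
      using T a d by (auto simp: shifted_tableaux_def S_def)
    then have "(?x, y) \<in> S" using a d by (auto simp: S_def)
    then show ?thesis using mem by simp
  qed
  have ex: "r (Suc (length xs)) = 0"
    using rx[of "Suc (length xs)"] by (simp add: nth_part_def)
  define L where "L = (LEAST y. r (Suc y) = 0)"
  have L0: "r (Suc L) = 0" unfolding L_def using ex by (rule LeastI)
  have Lpos: "r (Suc y) > 0" if "y < L" for y
    using that not_less_Least[of y "\<lambda>y. r (Suc y) = 0"] by (auto simp: L_def)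
  have Lz: "r (Suc (L + j)) = 0" for j
  proof (induction j)
    case (Suc j)
    then show ?case using dec[of "Suc (L + j)"] by auto
  qed (use L0 in simp)
  define ys where "ys = map (\<lambda>i. r (Suc i)) [0..<L]"
  have ltL: "r (Suc j) < r (Suc i)" if "i < j" "j < L" for i j
    using that
  proof (induction j)
    case (Suc j)
    have "r (Suc (Suc j)) < r (Suc j)" using dec[of "Suc j"] Lpos[of "Suc j"] Suc by simp
    then show ?case using Suc by (cases "i = j") auto
  qed simp
  have ys: "ys \<in> strict_partitions (sum_list ys)"
    using Lpos ltL by (auto simp: strict_partitions_def ys_def sorted_wrt_iff_nth_less)
  have py: "nth_part ys y = r y" if "y \<ge> 1" for y
  proof (cases "y \<le> L")
    case False
    then have "r y = 0" using Lz[of "y - Suc L"] by simp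
    then show ?thesis using False by (simp add: nth_part_def ys_def)
  next
    case True
    then obtain j where "y = Suc j" "j < L" using \<open>y \<ge> 1\<close> by (cases y) auto
    then show ?thesis by (simp add: nth_part_def ys_def)
  qed
  have "shifted_diagram ys = S"
  proof (rule set_eqI)
    fix b :: "nat \<times> nat"
    obtain x y where b: "b = (x, y)" by (cases b)
    show "b \<in> shifted_diagram ys \<longleftrightarrow> b \<in> S"
      using py[of y] mem[of x y] r0 by (cases "y = 0") (auto simp: b shifted_diagram_def)
  qed
  with ys show ?thesis
    unfolding S_def by (intro ex1I[of _ ys]) (auto intro: shifted_diagram_inj)
qed

definition limit_region :: "(real \<Rightarrow> real) \<Rightarrow> (real \<times> real) set" where
  "limit_region \<Omega> = {(x, y). 0 \<le> y \<and> y \<le> x \<and> x + y < \<Omega> (x - y)}"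

definition level_heights ::
    "(real \<times> real) set \<Rightarrow> (real \<times> real \<Rightarrow> real) \<Rightarrow> real \<Rightarrow> real \<Rightarrow> real set" where
  "level_heights \<Lambda> F \<alpha> z = {x + y | x y. (x, y) \<in> \<Lambda> \<and> x - y = z \<and> F (x, y) \<le> \<alpha>}"

definition level_curve ::
    "(real \<times> real) set \<Rightarrow> (real \<times> real \<Rightarrow> real) \<Rightarrow> real \<Rightarrow> real \<Rightarrow> real" where
  "level_curve \<Lambda> F \<alpha> z =
     (if level_heights \<Lambda> F \<alpha> z = {} then \<bar>z\<bar> else Sup (level_heights \<Lambda> F \<alpha> z))"

end

theory Submission
  imports Defs
begin

text \<open>
  Attach to a strict partition with parts \<open>p\<close> the series
  \<open>\<Phi>(u) = \<Prod>p. (1 - u p(p+1)/\<nu>) / (1 - u p(p-1)/\<nu>)\<close>, where \<open>\<nu>\<close> is twice the size of the full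
  shape. By the product formula for the number of shifted tableaux, the
  residues of \<open>\<Phi>\<close> are, up to a factor, the probabilities with which the largest entry of a uniformly
  random tableau occupies the various corners. Hence the moments of the removed box are coefficients of
  \<open>\<Phi>\<close>, and by Lagrange inversion the coefficient of \<open>u^k\<close> in \<open>\<Phi>^(2k-1)\<close> is, up to an error of order
  \<open>1/n\<^sup>2\<close> per step, multiplied on average by \<open>1 - (2k-1)/m\<close> when a box is removed from a shape with
  \<open>m\<close> boxes. A second moment estimate then shows that after passing from \<open>n\<close> to \<open>\<alpha> n\<close> boxes this
  coefficient concentrates around \<open>\<alpha>^(2k-1)\<close> times its initial value. These coefficients determine the
  moments of the diagonal lengths, hence the profile.
\<close>

section \<open>Linear extensions\<close>

definition linear_extensions :: "('a \<Rightarrow> 'a \<Rightarrow> bool) \<Rightarrow> 'a set \<Rightarrow> ('a \<Rightarrow> nat) set" where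
  "linear_extensions R D =
     {T \<in> extensional D. bij_betw T D {1..card D} \<and> (\<forall>a\<in>D. \<forall>b\<in>D. R a b \<longrightarrow> T a < T b)}"

definition maximal_elements :: "('a \<Rightarrow> 'a \<Rightarrow> bool) \<Rightarrow> 'a set \<Rightarrow> 'a set" where
  "maximal_elements R D = {b \<in> D. \<forall>a\<in>D. \<not> R b a}"

lemma maximal_elements_subset: "maximal_elements R D \<subseteq> D"
  by (auto simp: maximal_elements_def)

lemma card_remove_maximal_element:
  assumes "finite D" "b \<in> maximal_elements R D"
  shows "card D = Suc (card (D - {b}))"
  using assms maximal_elements_subset by (metis card.remove subsetD)

lemma finite_linear_extensions:
  assumes "finite D" shows "finite (linear_extensions R D)"
proof (rule finite_subset)
  show "linear_extensions R D \<subseteq> D \<rightarrow>\<^sub>E {1..card D}"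
    by (auto simp: linear_extensions_def PiE_def dest: bij_betw_apply)
  show "finite (D \<rightarrow>\<^sub>E {1..card D})" using assms by (intro finite_PiE) auto
qed

lemma linear_extension_le:
  assumes "T \<in> linear_extensions R D" "b \<in> D" shows "T b \<le> card D"
  using assms by (auto simp: linear_extensions_def dest: bij_betw_apply)

lemma linear_extensions_empty: "linear_extensions R {} = {\<lambda>_. undefined}"
  by (auto simp: linear_extensions_def bij_betw_def)

lemma linear_extension_remove_maximal:
  assumes D: "finite D" "D \<noteq> {}" and T: "T \<in> linear_extensions R D"
  obtains b where "b \<in> maximal_elements R D"
    "restrict T (D - {b}) \<in> linear_extensions R (D - {b})"
    "T = (restrict T (D - {b}))(b := card D)"
proof -
  have bij: "bij_betw T D {1..card D}" and ext: "T \<in> extensional D"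
    and less: "\<And>a b. a \<in> D \<Longrightarrow> b \<in> D \<Longrightarrow> R a b \<Longrightarrow> T a < T b"
    using T by (auto simp: linear_extensions_def)
  have "card D \<in> T ` D" using bij D by (auto simp: bij_betw_def Suc_le_eq card_gt_0_iff)
  then obtain b where b: "b \<in> D" "T b = card D" by auto
  have max: "b \<in> maximal_elements R D"
    using less[OF b(1)] linear_extension_le[OF T] b by (fastforce simp: maximal_elements_def)
  have "T ` (D - {b}) = T ` D - T ` {b}"
    using bij b by (intro inj_on_image_set_diff[of _ D]) (auto simp: bij_betw_def)
  also have "\<dots> = {1..card D} - {card D}" using bij b by (simp add: bij_betw_def)
  also have "\<dots> = {1..card (D - {b})}"
    unfolding card_remove_maximal_element[OF D(1) max] by auto
  finally have "bij_betw T (D - {b}) {1..card (D - {b})}"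
    using bij by (auto simp: bij_betw_def intro: inj_on_subset)
  then have "bij_betw (restrict T (D - {b})) (D - {b}) {1..card (D - {b})}"
    by (subst bij_betw_cong[of _ _ T]) auto
  then have "restrict T (D - {b}) \<in> linear_extensions R (D - {b})"
    using less by (auto simp: linear_extensions_def)
  moreover have "T = (restrict T (D - {b}))(b := card D)"
    using b ext by (auto simp: fun_eq_iff restrict_def extensional_def)
  ultimately show ?thesis using that max by blast
qed

lemma linear_extension_add_maximal:
  assumes D: "finite D" and b: "b \<in> maximal_elements R D"
    and T: "T \<in> linear_extensions R (D - {b})"
  shows "T(b := card D) \<in> linear_extensions R D"
proof -
  note card = card_remove_maximal_element[OF D b]
  have bD: "b \<in> D" and max: "\<And>a. a \<in> D \<Longrightarrow> \<not> R b a" using b by (auto simp: maximal_elements_def)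
  have bij: "bij_betw T (D - {b}) {1..card (D - {b})}" and ext: "T \<in> extensional (D - {b})"
    and less: "\<And>a c. a \<in> D - {b} \<Longrightarrow> c \<in> D - {b} \<Longrightarrow> R a c \<Longrightarrow> T a < T c"
    using T by (auto simp: linear_extensions_def)
  have "bij_betw (T(b := card D)) (D - {b}) {1..card (D - {b})}"
    using bij by (subst bij_betw_cong[of _ _ T]) auto
  then have "bij_betw (T(b := card D)) (D - {b} \<union> {b}) ({1..card (D - {b})} \<union> {card D})"
    using card by (intro bij_betw_combine) auto
  moreover have "D - {b} \<union> {b} = D" "{1..card (D - {b})} \<union> {card D} = {1..card D}"
    using bD card by auto
  ultimately have "bij_betw (T(b := card D)) D {1..card D}" by simp
  moreover have "T(b := card D) \<in> extensional D"
    using ext bD by (auto simp: extensional_def)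
  moreover have "(T(b := card D)) a < (T(b := card D)) c" if "a \<in> D" "c \<in> D" "R a c" for a c
  proof -
    have "a \<noteq> b" using max that by auto
    moreover from this have "T a < card D"
      using linear_extension_le[OF T, of a] that card by auto
    ultimately show ?thesis using less that by auto
  qed
  ultimately show ?thesis by (simp add: linear_extensions_def)
qed

lemma bij_betw_linear_extensions:
  assumes D: "finite D" "D \<noteq> {}"
  shows "bij_betw (\<lambda>(b, T). T(b := card D))
    (SIGMA b:maximal_elements R D. linear_extensions R (D - {b})) (linear_extensions R D)"
proof (rule bij_betwI', goal_cases)
  case (1 u v)
  then obtain b T c U where uv: "u = (b, T)" "v = (c, U)" "b \<in> maximal_elements R D"
    "T \<in> linear_extensions R (D - {b})" "U \<in> linear_extensions R (D - {c})"
    by (cases u; cases v) auto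
  have "u = v" if eq: "T(b := card D) = U(c := card D)"
  proof -
    have "c \<in> maximal_elements R D" using 1(2) uv(2) by simp
    from card_remove_maximal_element[OF D(1) this] have "card (D - {c}) < card D" by linarith
    then have "U b < card D" if "b \<noteq> c"
      using linear_extension_le[OF uv(5), of b] that uv(3) maximal_elements_subset by fastforce
    then have "b = c" using fun_cong[OF eq, of b] by (auto split: if_splits)
    have "T b = undefined" "U b = undefined"
      using uv(4,5) \<open>b = c\<close> by (auto simp: linear_extensions_def intro: extensional_arb)
    then have "T a = U a" for a
      using fun_cong[OF eq, of a] \<open>b = c\<close> by (cases "a = b") auto
    then show ?thesis using uv(1,2) \<open>b = c\<close> by auto
  qed
  then show ?case using uv(1,2) by auto
next
  case (2 u)
  then show ?case by (auto intro: linear_extension_add_maximal[OF D(1)])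
next
  case (3 T)
  then obtain b where "b \<in> maximal_elements R D" "restrict T (D - {b}) \<in> linear_extensions R (D - {b})"
    "T = (restrict T (D - {b}))(b := card D)"
    by (rule linear_extension_remove_maximal[OF D])
  then show ?case by (intro bexI[of _ "(b, restrict T (D - {b}))"]) simp_all
qed

lemma sum_linear_extensions:
  fixes f :: "('a \<Rightarrow> nat) \<Rightarrow> 'b :: comm_monoid_add"
  assumes D: "finite D" "D \<noteq> {}"
  shows "(\<Sum>T\<in>linear_extensions R D. f T) =
    (\<Sum>b\<in>maximal_elements R D. \<Sum>T\<in>linear_extensions R (D - {b}). f (T(b := card D)))"
proof -
  have "finite (maximal_elements R D)" using D maximal_elements_subset finite_subset by metis
  then show ?thesis
    using D finite_linear_extensions[of "D - {_}" R]
    by (subst sum.reindex_bij_betw[OF bij_betw_linear_extensions[OF D], symmetric], subst sum.Sigma)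
       (auto simp: split_def)
qed

lemma card_linear_extensions:
  assumes "finite D" "D \<noteq> {}"
  shows "card (linear_extensions R D) =
    (\<Sum>b\<in>maximal_elements R D. card (linear_extensions R (D - {b})))"
  using sum_linear_extensions[OF assms, of "\<lambda>_. 1 :: nat"] by simp

lemma card_sublevel:
  assumes "T \<in> linear_extensions R D" "m \<le> card D"
  shows "card {b \<in> D. T b \<le> m} = m"
proof -
  have bij: "bij_betw T D {1..card D}" using assms by (auto simp: linear_extensions_def)
  have "T ` {b \<in> D. T b \<le> m} = {i \<in> T ` D. i \<le> m}" by auto
  also have "\<dots> = {1..m}" using bij assms(2) by (auto simp: bij_betw_def)
  finally have "T ` {b \<in> D. T b \<le> m} = {1..m}" .
  moreover have "inj_on T {b \<in> D. T b \<le> m}"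
    using bij by (auto simp: bij_betw_def intro: inj_on_subset)
  ultimately show ?thesis by (metis card_atLeastAtMost card_image diff_Suc_1)
qed

definition removal_prob :: "('a \<Rightarrow> 'a \<Rightarrow> bool) \<Rightarrow> 'a set \<Rightarrow> 'a \<Rightarrow> real" where
  "removal_prob R D b = card (linear_extensions R (D - {b})) / card (linear_extensions R D)"

lemma removal_prob_nonneg: "0 \<le> removal_prob R D b"
  by (simp add: removal_prob_def)

lemma sum_removal_prob:
  assumes "finite D" "D \<noteq> {}" "linear_extensions R D \<noteq> {}"
  shows "(\<Sum>b\<in>maximal_elements R D. removal_prob R D b) = 1"
  using assms finite_linear_extensions[OF assms(1), of R]
  by (simp add: removal_prob_def card_linear_extensions[symmetric]
      flip: sum_divide_distrib of_nat_sum)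

definition sublevel_mean ::
    "('a \<Rightarrow> 'a \<Rightarrow> bool) \<Rightarrow> 'a set \<Rightarrow> nat \<Rightarrow> ('a set \<Rightarrow> real) \<Rightarrow> real" where
  "sublevel_mean R D m f =
     measure_pmf.expectation (pmf_of_set (linear_extensions R D)) (\<lambda>T. f {b \<in> D. T b \<le> m})"

lemma sublevel_mean_eq_sum:
  assumes "finite D" "linear_extensions R D \<noteq> {}"
  shows "sublevel_mean R D m f =
    (\<Sum>T\<in>linear_extensions R D. f {b \<in> D. T b \<le> m}) / card (linear_extensions R D)"
  unfolding sublevel_mean_def
  by (rule integral_pmf_of_set[OF assms(2) finite_linear_extensions[OF assms(1)]])

lemma sublevel_mean_card:
  assumes D: "finite D" "linear_extensions R D \<noteq> {}"
  shows "sublevel_mean R D (card D) f = f D"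
proof -
  have "{b \<in> D. T b \<le> card D} = D" if "T \<in> linear_extensions R D" for T
    using linear_extension_le[OF that] by auto
  then show ?thesis
    using D finite_linear_extensions[OF D(1), of R] by (simp add: sublevel_mean_eq_sum)
qed

lemma sublevel_mean_remove:
  assumes D: "finite D" "linear_extensions R D \<noteq> {}" and m: "m < card D"
  shows "sublevel_mean R D m f =
    (\<Sum>b\<in>maximal_elements R D. removal_prob R D b * sublevel_mean R (D - {b}) m f)"
proof -
  have "D \<noteq> {}" using m by auto
  have "(\<Sum>T\<in>linear_extensions R D. f {a \<in> D. T a \<le> m}) =
    (\<Sum>b\<in>maximal_elements R D. \<Sum>T\<in>linear_extensions R (D - {b}). f {a \<in> D - {b}. T a \<le> m})"
    unfolding sum_linear_extensions[OF D(1) \<open>D \<noteq> {}\<close>]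
    by (intro sum.cong refl arg_cong[of _ _ f]) (use m in auto)
  also have "\<dots> = (\<Sum>b\<in>maximal_elements R D.
      card (linear_extensions R (D - {b})) * sublevel_mean R (D - {b}) m f)"
  proof (rule sum.cong[OF refl])
    fix b
    have "finite (D - {b})" using D by simp
    from finite_linear_extensions[OF this, of R] sublevel_mean_eq_sum[OF this, of R m f]
    show "(\<Sum>T\<in>linear_extensions R (D - {b}). f {a \<in> D - {b}. T a \<le> m}) =
        card (linear_extensions R (D - {b})) * sublevel_mean R (D - {b}) m f"
      by (cases "linear_extensions R (D - {b}) = {}") auto
  qed
  finally show ?thesis
    unfolding sublevel_mean_eq_sum[OF D] by (simp add: removal_prob_def sum_divide_distrib)
qed

lemma sublevel_mean_le_of_removal_drift:
  assumes hereditary: "\<And>E b. Q E \<Longrightarrow> b \<in> maximal_elements R E \<Longrightarrow> Q (E - {b})"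
    and extensible: "\<And>E. Q E \<Longrightarrow> finite E \<and> linear_extensions R E \<noteq> {}"
    and drift: "\<And>E. Q E \<Longrightarrow> E \<noteq> {} \<Longrightarrow>
      (\<Sum>b\<in>maximal_elements R E. removal_prob R E b * V (E - {b})) \<le> V E + \<epsilon>"
    and D: "Q D" "m \<le> card D"
  shows "sublevel_mean R D m V \<le> V D + real (card D - m) * \<epsilon>"
  using D
proof (induction "card D - m" arbitrary: D)
  case 0
  then have "m = card D" by simp
  then show ?case using extensible[OF 0(2)] by (simp add: sublevel_mean_card)
next
  case (Suc i)
  let ?w = "removal_prob R D" and ?A = "maximal_elements R D"
  have D: "finite D" "linear_extensions R D \<noteq> {}" "m < card D" "D \<noteq> {}"
    using extensible[OF Suc(3)] Suc(2) by auto
  have "sublevel_mean R D m V = (\<Sum>b\<in>?A. ?w b * sublevel_mean R (D - {b}) m V)"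
    by (rule sublevel_mean_remove[OF D(1-3)])
  also have "\<dots> \<le> (\<Sum>b\<in>?A. ?w b * (V (D - {b}) + real i * \<epsilon>))"
  proof (intro sum_mono mult_left_mono removal_prob_nonneg)
    fix b assume b: "b \<in> ?A"
    have "card (D - {b}) - m = i" "m \<le> card (D - {b})"
      using card_remove_maximal_element[OF D(1) b] Suc(2) D(3) by auto
    then show "sublevel_mean R (D - {b}) m V \<le> V (D - {b}) + real i * \<epsilon>"
      using Suc(1)[of "D - {b}"] hereditary[OF Suc(3) b] by simp
  qed
  also have "\<dots> = (\<Sum>b\<in>?A. ?w b * V (D - {b})) + real i * \<epsilon>"
    by (simp add: distrib_left sum.distrib sum_removal_prob[OF D(1,4,2)] flip: sum_distrib_right)
  also have "\<dots> \<le> V D + real (card D - m) * \<epsilon>"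
    using drift[OF Suc(3) D(4)] by (simp add: Suc(2)[symmetric] algebra_simps)
  finally show ?case .
qed

lemma sublevel_hereditary:
  assumes hereditary: "\<And>E b. Q E \<Longrightarrow> b \<in> maximal_elements R E \<Longrightarrow> Q (E - {b})"
    and "Q D" "finite D" "T \<in> linear_extensions R D"
  shows "Q {b \<in> D. T b \<le> m}"
  using assms(2-)
proof (induction "card D" arbitrary: D T)
  case 0
  then show ?case by simp
next
  case (Suc n)
  show ?case
  proof (cases "card D \<le> m")
    case True
    then have "{b \<in> D. T b \<le> m} = D" using linear_extension_le[OF Suc.prems(3)] by fastforce
    then show ?thesis using Suc.prems by simp
  next
    case False
    have "D \<noteq> {}" using Suc.hyps(2) by auto
    then obtain b where b: "b \<in> maximal_elements R D"
      "restrict T (D - {b}) \<in> linear_extensions R (D - {b})" "T = (restrict T (D - {b}))(b := card D)"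
      by (rule linear_extension_remove_maximal[OF Suc.prems(2) _ Suc.prems(3)])
    have "T b = card D" by (subst b(3)) simp
    then have "{a \<in> D. T a \<le> m} = {a \<in> D - {b}. restrict T (D - {b}) a \<le> m}" using False by auto
    moreover have "n = card (D - {b})"
      using card_remove_maximal_element[OF Suc.prems(2) b(1)] Suc.hyps(2) by simp
    then have "Q {a \<in> D - {b}. restrict T (D - {b}) a \<le> m}"
      by (rule Suc.hyps(1)[OF _ hereditary[OF Suc.prems(1) b(1)] _ b(2)]) (use Suc.prems(2) in simp)
    ultimately show ?thesis by simp
  qed
qed

section \<open>Shifted shapes\<close>

definition box_less :: "nat \<times> nat \<Rightarrow> nat \<times> nat \<Rightarrow> bool" where
  "box_less a b \<longleftrightarrow> snd a = snd b \<and> fst a < fst b \<or> fst a = fst b \<and> snd a < snd b"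

abbreviation standard_tableaux :: "(nat \<times> nat) set \<Rightarrow> (nat \<times> nat \<Rightarrow> nat) set" where
  "standard_tableaux \<equiv> linear_extensions box_less"

abbreviation corners :: "(nat \<times> nat) set \<Rightarrow> (nat \<times> nat) set" where
  "corners \<equiv> maximal_elements box_less"

definition box_content :: "nat \<times> nat \<Rightarrow> nat" where
  "box_content b = fst b - snd b - 1"

definition strict_seq :: "(nat \<Rightarrow> nat) \<Rightarrow> bool" where
  "strict_seq \<xi> \<longleftrightarrow> \<xi> 0 = 0 \<and> finite {y. \<xi> y > 0} \<and>
     (\<forall>y\<ge>1. \<xi> (Suc y) = 0 \<or> \<xi> (Suc y) < \<xi> y)"

definition seq_diagram :: "(nat \<Rightarrow> nat) \<Rightarrow> (nat \<times> nat) set" where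
  "seq_diagram \<xi> = {(x, y). y < x \<and> x \<le> y + \<xi> y}"

definition parts :: "(nat \<Rightarrow> nat) \<Rightarrow> nat set" where
  "parts \<xi> = \<xi> ` {y. \<xi> y > 0}"

definition shifted_shape :: "(nat \<times> nat) set \<Rightarrow> bool" where
  "shifted_shape D \<longleftrightarrow> (\<exists>\<xi>. strict_seq \<xi> \<and> D = seq_diagram \<xi>)"

lemma shifted_shapeE:
  assumes "shifted_shape D"
  obtains \<xi> where "strict_seq \<xi>" "D = seq_diagram \<xi>"
  using assms by (auto simp: shifted_shape_def)

lemma strict_seq_gap:
  assumes \<xi>: "strict_seq \<xi>" and "\<xi> y' > 0" "1 \<le> y" "y \<le> y'"
  shows "\<xi> y' + (y' - y) \<le> \<xi> y"
  using \<open>y \<le> y'\<close> \<open>\<xi> y' > 0\<close>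
proof (induction y' rule: dec_induct)
  case (step m)
  have "m \<ge> 1" using step assms(3) by simp
  then have "\<xi> (Suc m) < \<xi> m" using \<xi> step.prems by (auto simp: strict_seq_def)
  then show ?case using step by (auto simp: not_less)
qed simp

lemma strict_seq_less:
  assumes "strict_seq \<xi>" "\<xi> y' > 0" "1 \<le> y" "y < y'"
  shows "\<xi> y' < \<xi> y"
  using strict_seq_gap[OF assms(1-3)] assms(4) by fastforce

lemma strict_seq_row_pos: "strict_seq \<xi> \<Longrightarrow> \<xi> y > 0 \<Longrightarrow> y \<ge> 1"
  by (cases y) (auto simp: strict_seq_def)

lemma inj_on_strict_seq:
  assumes \<xi>: "strict_seq \<xi>" shows "inj_on \<xi> {y. \<xi> y > 0}"
proof (rule linorder_inj_onI)
  fix y y' assume "y < y'" "y \<in> {y. \<xi> y > 0}" "y' \<in> {y. \<xi> y > 0}"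
  then show "\<xi> y \<noteq> \<xi> y'"
    using strict_seq_less[OF \<xi>, of y' y] strict_seq_row_pos[OF \<xi>, of y] by simp
qed auto

lemma parts_memI: "\<xi> y > 0 \<Longrightarrow> \<xi> y \<in> parts \<xi>"
  by (simp add: parts_def)

lemma finite_parts: "strict_seq \<xi> \<Longrightarrow> finite (parts \<xi>)"
  by (simp add: strict_seq_def parts_def)

lemma zero_notin_parts: "0 \<notin> parts \<xi>"
  by (auto simp: parts_def)

lemma bij_betw_seq_diagram:
  "bij_betw (\<lambda>(y, c). (Suc (y + c), y)) (SIGMA y:{y. \<xi> y > 0}. {..<\<xi> y}) (seq_diagram \<xi>)"
  by (rule bij_betw_byWitness[where f' = "\<lambda>b. (snd b, box_content b)"])
     (auto simp: seq_diagram_def box_content_def)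

lemma finite_seq_diagram:
  assumes "strict_seq \<xi>" shows "finite (seq_diagram \<xi>)"
proof -
  have "finite (SIGMA y:{y. \<xi> y > 0}. {..<\<xi> y})"
    using assms by (auto simp: strict_seq_def)
  then show ?thesis using bij_betw_finite[OF bij_betw_seq_diagram[of \<xi>]] by simp
qed

lemma finite_shifted_shape: "shifted_shape D \<Longrightarrow> finite D"
  using finite_seq_diagram by (auto elim: shifted_shapeE)

lemma (in comm_monoid_set) seq_diagram_by_parts:
  assumes \<xi>: "strict_seq \<xi>"
  shows "F (\<lambda>b. g (box_content b)) (seq_diagram \<xi>) = F (\<lambda>p. F g {..<p}) (parts \<xi>)"
proof -
  have "F (\<lambda>b. g (box_content b)) (seq_diagram \<xi>) =
      F (\<lambda>u. g (snd u)) (SIGMA y:{y. \<xi> y > 0}. {..<\<xi> y})"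
    by (subst reindex_bij_betw[OF bij_betw_seq_diagram, symmetric])
       (auto intro!: cong simp: box_content_def)
  also have "\<dots> = F (\<lambda>y. F g {..<\<xi> y}) {y. \<xi> y > 0}"
    using \<xi> by (subst Sigma) (auto simp: strict_seq_def split_beta)
  also have "\<dots> = F (\<lambda>p. F g {..<p}) (parts \<xi>)"
    unfolding parts_def by (subst reindex[OF inj_on_strict_seq[OF \<xi>]]) (simp add: comp_def)
  finally show ?thesis .
qed

lemma card_seq_diagram:
  assumes "strict_seq \<xi>" shows "card (seq_diagram \<xi>) = \<Sum>(parts \<xi>)"
  using sum.seq_diagram_by_parts[OF assms, of "\<lambda>_. 1 :: nat"] by simp

definition removable_rows :: "(nat \<Rightarrow> nat) \<Rightarrow> nat set" where
  "removable_rows \<xi> = {y. \<xi> y > 0 \<and> \<xi> y - 1 \<notin> parts \<xi>}"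

lemma corner_is_removable_row_end:
  assumes \<xi>: "strict_seq \<xi>" and b: "b \<in> corners (seq_diagram \<xi>)"
  shows "snd b \<in> removable_rows \<xi> \<and> b = (snd b + \<xi> (snd b), snd b)"
proof -
  obtain x y where xy: "b = (x, y)" by (cases b)
  have mem: "y < x" "x \<le> y + \<xi> y"
    and max: "\<And>x' y'. box_less (x, y) (x', y') \<Longrightarrow> (x', y') \<notin> seq_diagram \<xi>"
    using b by (auto simp: maximal_elements_def xy seq_diagram_def)
  then have pos: "\<xi> y > 0" by simp
  have y1: "1 \<le> y" by (rule strict_seq_row_pos[OF \<xi> pos])
  have "(Suc x, y) \<notin> seq_diagram \<xi>" by (rule max) (simp add: box_less_def)
  then have x: "x = y + \<xi> y" using mem by (simp add: seq_diagram_def)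
  have "\<xi> y - 1 \<notin> parts \<xi>"
  proof
    assume "\<xi> y - 1 \<in> parts \<xi>"
    then obtain y' where y': "\<xi> y' > 0" "\<xi> y' = \<xi> y - 1" by (auto simp: parts_def)
    then have "y \<noteq> y'" by (metis diff_less pos zero_less_one less_irrefl)
    moreover have "\<not> y' < y"
      using strict_seq_less[OF \<xi> pos strict_seq_row_pos[OF \<xi> y'(1)]] y'(2) by fastforce
    ultimately have "y < y'" by simp
    then have "(x, y') \<in> seq_diagram \<xi>"
      using strict_seq_gap[OF \<xi> y'(1) y1] y' x by (auto simp: seq_diagram_def)
    then show False using max[of x y'] \<open>y < y'\<close> by (simp add: box_less_def)
  qed
  then show ?thesis using pos x by (simp add: xy removable_rows_def)
qed

lemma removable_row_end_is_corner:
  assumes \<xi>: "strict_seq \<xi>" and y: "y \<in> removable_rows \<xi>"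
  shows "(y + \<xi> y, y) \<in> corners (seq_diagram \<xi>)"
proof -
  have pos: "\<xi> y > 0" and notin: "\<xi> y - 1 \<notin> parts \<xi>" using y by (auto simp: removable_rows_def)
  have "1 \<le> y" by (rule strict_seq_row_pos[OF \<xi> pos])
  have "(y + \<xi> y, y') \<notin> seq_diagram \<xi>" if "y < y'" for y'
  proof
    assume "(y + \<xi> y, y') \<in> seq_diagram \<xi>"
    then have "\<xi> y' > 0" and le: "y + \<xi> y \<le> y' + \<xi> y'" by (auto simp: seq_diagram_def)
    then have gap: "\<xi> y' + (y' - Suc y) \<le> \<xi> (Suc y)"
      using strict_seq_gap[OF \<xi>, of y' "Suc y"] that by simp
    then have "\<xi> (Suc y) > 0" using \<open>\<xi> y' > 0\<close> by simp
    moreover from this have "\<xi> (Suc y) < \<xi> y" using strict_seq_less[OF \<xi> _ \<open>1 \<le> y\<close>] by simp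
    then have "\<xi> (Suc y) = \<xi> y - 1" using gap le that by simp
    ultimately show False using notin parts_memI[of \<xi> "Suc y"] by simp
  qed
  then show ?thesis using pos by (auto simp: maximal_elements_def seq_diagram_def box_less_def)
qed

lemma corners_seq_diagram:
  assumes "strict_seq \<xi>"
  shows "corners (seq_diagram \<xi>) = (\<lambda>y. (y + \<xi> y, y)) ` removable_rows \<xi>"
  using corner_is_removable_row_end[OF assms] removable_row_end_is_corner[OF assms] by fast

lemma remove_row_end:
  assumes \<xi>: "strict_seq \<xi>" and y: "y \<in> removable_rows \<xi>"
  defines "\<eta> \<equiv> \<xi>(y := \<xi> y - 1)"
  shows "seq_diagram \<xi> - {(y + \<xi> y, y)} = seq_diagram \<eta>"
    and "strict_seq \<eta>"
    and "parts \<eta> = insert (\<xi> y - 1) (parts \<xi> - {\<xi> y}) - {0}"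
proof -
  have pos: "\<xi> y > 0" and notin: "\<xi> y - 1 \<notin> parts \<xi>" using y by (auto simp: removable_rows_def)
  show "seq_diagram \<xi> - {(y + \<xi> y, y)} = seq_diagram \<eta>"
    using pos by (auto simp: \<eta>_def seq_diagram_def split: if_splits)
  show "parts \<eta> = insert (\<xi> y - 1) (parts \<xi> - {\<xi> y}) - {0}"
    using inj_on_strict_seq[OF \<xi>] pos
    by (auto simp: \<eta>_def parts_def inj_on_def image_iff split: if_splits)
  have "\<eta> (Suc z) = 0 \<or> \<eta> (Suc z) < \<eta> z" if "z \<ge> 1" for z
  proof -
    have "\<xi> (Suc y) \<noteq> \<xi> y - 1 \<or> \<xi> (Suc y) = 0" using notin parts_memI[of \<xi> "Suc y"] by (metis neq0_conv)
    moreover have "\<xi> (Suc z) = 0 \<or> \<xi> (Suc z) < \<xi> z" using \<xi> that by (auto simp: strict_seq_def)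
    ultimately show ?thesis unfolding \<eta>_def by (cases "z = y") auto
  qed
  moreover have "{z. \<eta> z > 0} \<subseteq> {z. \<xi> z > 0}" by (auto simp: \<eta>_def split: if_splits)
  then have "finite {z. \<eta> z > 0}" using \<xi> by (auto simp: strict_seq_def intro: finite_subset)
  moreover have "\<eta> 0 = 0" using \<xi> by (simp add: \<eta>_def strict_seq_def)
  ultimately show "strict_seq \<eta>" by (auto simp: strict_seq_def)
qed

section \<open>Partial fractions\<close>

abbreviation lin_fps :: "'a :: comm_ring_1 \<Rightarrow> 'a fps" where
  "lin_fps w \<equiv> 1 - fps_const w * fps_X"

definition resolvent_fps :: "'a :: comm_ring_1 \<Rightarrow> 'a fps" where
  "resolvent_fps w = Abs_fps (\<lambda>j. if j = 0 then 0 else w ^ (j - 1))"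

lemma fps_nth_mult_lin_fps:
  "fps_nth (f * lin_fps w) j = fps_nth f j - (if j = 0 then 0 else w * fps_nth f (j - 1))"
proof -
  have "f * lin_fps w = f - fps_const w * (f * fps_X)" by (simp add: algebra_simps)
  then show ?thesis by simp
qed

lemma lin_fps_nonzero: "lin_fps (w :: 'a :: idom) \<noteq> 0"
proof
  assume "lin_fps w = 0"
  then have "fps_nth (lin_fps w) 0 = 0" by (simp only: fps_zero_nth)
  then show False by simp
qed

lemma resolvent_fps_mult_lin_fps: "resolvent_fps w * lin_fps w = fps_X"
proof (rule fps_ext)
  fix j
  consider "j = 0" | "j = 1" | i where "j = Suc (Suc i)" by (metis One_nat_def not0_implies_Suc)
  then show "fps_nth (resolvent_fps w * lin_fps w) j = fps_nth fps_X j"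
    by cases (simp_all add: fps_nth_mult_lin_fps resolvent_fps_def)
qed

lemma resolvent_fps_identity:
  fixes a c :: "'a :: idom"
  shows "fps_const (a - c) * (resolvent_fps a * resolvent_fps c) = resolvent_fps a - resolvent_fps c"
proof -
  have "fps_const (a - c) * (resolvent_fps a * resolvent_fps c) * (lin_fps a * lin_fps c) =
      fps_const (a - c) * ((resolvent_fps a * lin_fps a) * (resolvent_fps c * lin_fps c))"
    by (simp only: mult_ac)
  also have "\<dots> = fps_X * lin_fps c - fps_X * lin_fps a"
    unfolding resolvent_fps_mult_lin_fps
    by (simp add: algebra_simps flip: fps_const_sub)
  also have "\<dots> = (resolvent_fps a * lin_fps a) * lin_fps c - (resolvent_fps c * lin_fps c) * lin_fps a"
    by (simp only: resolvent_fps_mult_lin_fps)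
  also have "\<dots> = (resolvent_fps a - resolvent_fps c) * (lin_fps a * lin_fps c)"
    by (simp only: left_diff_distrib mult_ac)
  finally show ?thesis
    using lin_fps_nonzero[of a] lin_fps_nonzero[of c] by simp
qed

definition pf_residue :: "('b \<Rightarrow> 'a) \<Rightarrow> ('b \<Rightarrow> 'a) \<Rightarrow> 'b set \<Rightarrow> 'b \<Rightarrow> 'a :: field" where
  "pf_residue a b P p = (a p - b p) * (\<Prod>q\<in>P - {p}. (a p - b q) / (a p - a q))"

lemma pf_residue_insert_same:
  assumes "finite P" "t \<notin> P" "\<And>p. p \<in> P \<Longrightarrow> a p \<noteq> a t"
  shows "pf_residue a b (insert t P) t = (a t - b t) * (\<Prod>p\<in>P. 1 + (a p - b p) * (1 / (a t - a p)))"
proof -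
  have "(a t - b p) / (a t - a p) = 1 + (a p - b p) * (1 / (a t - a p))" if "p \<in> P" for p
    using assms(3)[OF that] by (simp add: divide_simps)
  then show ?thesis using assms(1,2) by (simp add: pf_residue_def)
qed

lemma pf_residue_insert_other:
  assumes "finite P" "t \<notin> P" "p \<in> P" "a p \<noteq> a t"
  shows "pf_residue a b (insert t P) p =
    pf_residue a b P p - (a t - b t) * (pf_residue a b P p * (1 / (a t - a p)))"
proof -
  have "insert t P - {p} = insert t (P - {p})" using assms by auto
  then have "pf_residue a b (insert t P) p = pf_residue a b P p * ((a p - b t) / (a p - a t))"
    using assms by (simp add: pf_residue_def)
  also have "(a p - b t) / (a p - a t) = 1 - (a t - b t) * (1 / (a t - a p))"
    using assms(4) by (simp add: divide_simps) (simp add: algebra_simps)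
  finally show ?thesis by (simp only: right_diff_distrib mult_1_right mult.left_commute)
qed

lemma fps_const_prod: "fps_const (\<Prod>p\<in>P. f p) = (\<Prod>p\<in>P. fps_const (f p))"
  by (induction P rule: infinite_finite_induct) (simp_all flip: fps_const_mult)

lemma mult_resolvents:
  fixes c g h r u w :: "'a :: comm_ring_1"
  assumes "u * w = 1" "w * (h * g) = h - g"
  shows "r * g * (1 + c * h) = (r - c * (r * u)) * g + c * (r * u) * h"
proof -
  have "g * h = u * w * (h * g)" using assms(1) by (simp add: mult.commute)
  also have "\<dots> = u * (h - g)" using assms(2) by (simp add: mult.assoc)
  finally have product: "g * h = u * (h - g)" .
  have "r * g * (1 + c * h) = r * g + c * r * (g * h)" by (simp add: algebra_simps)
  then show ?thesis unfolding product by (simp add: algebra_simps)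
qed

text \<open>
  The resolvents \<open>G p\<close> may be constants \<open>1 / (v - a p)\<close> as well as \<open>X / (1 - a p X)\<close>: the
  induction step for the latter uses the induction hypothesis for the former, at \<open>v = a t\<close>.
\<close>

lemma partial_fractions_resolvents:
  fixes a b :: "'b \<Rightarrow> 'a :: field" and G :: "'b \<Rightarrow> 'a fps"
  assumes "finite P" "inj_on a P"
    and "\<And>p q. p \<in> P \<Longrightarrow> q \<in> P \<Longrightarrow> p \<noteq> q \<Longrightarrow> fps_const (a p - a q) * (G p * G q) = G p - G q"
  shows "(\<Prod>p\<in>P. 1 + fps_const (a p - b p) * G p) = 1 + (\<Sum>p\<in>P. fps_const (pf_residue a b P p) * G p)"
  using assms
proof (induction P arbitrary: G rule: finite_induct)
  case (insert t P)
  let ?r = "pf_residue a b P" and ?r' = "pf_residue a b (insert t P)"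
  let ?u = "\<lambda>p. 1 / (a t - a p)" and ?at = "fps_const (a t - b t)"
  have inj: "inj_on a P" and distinct: "\<And>p. p \<in> P \<Longrightarrow> a p \<noteq> a t"
    using insert.prems(1) insert.hyps(2) by (auto simp: inj_on_def)
  have resolvent: "(a p - a q) * (?u p * ?u q) = ?u p - ?u q" if "p \<in> P" "q \<in> P" for p q
    using distinct[OF that(1)] distinct[OF that(2)] by (simp add: divide_simps)
  have "fps_const (?r' t) = ?at * (\<Prod>p\<in>P. 1 + fps_const (a p - b p) * fps_const (?u p))"
    by (simp only: pf_residue_insert_same[where a = a, OF insert.hyps distinct] fps_const_prod fps_const_mult[symmetric] fps_const_add[symmetric] fps_const_1_eq_1)
  also have "\<dots> = ?at * (1 + (\<Sum>p\<in>P. fps_const (?r p) * fps_const (?u p)))"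
    by (subst insert.IH[OF inj]) (simp_all only: fps_const_mult fps_const_sub resolvent)
  finally have residue_t: "fps_const (?r' t) = ?at * (1 + (\<Sum>p\<in>P. fps_const (?r p) * fps_const (?u p)))" .
  have resolvents: "fps_const (?r p) * G p * (1 + ?at * G t) =
      fps_const (?r' p) * G p + ?at * (fps_const (?r p) * fps_const (?u p)) * G t" if p: "p \<in> P" for p
  proof -
    have "fps_const (?r' p) = fps_const (?r p) - ?at * (fps_const (?r p) * fps_const (?u p))"
      by (simp only: pf_residue_insert_other[OF insert.hyps p distinct[OF p]] fps_const_sub fps_const_mult)
    moreover have "fps_const (?u p) * fps_const (a t - a p) = 1" using distinct[OF p] by simp
    moreover have "fps_const (a t - a p) * (G t * G p) = G t - G p"
      using insert.prems(2)[of t p] insert.hyps(2) p by auto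
    ultimately show ?thesis by (simp only: mult_resolvents)
  qed
  have "(\<Prod>p\<in>insert t P. 1 + fps_const (a p - b p) * G p) =
      (1 + (\<Sum>p\<in>P. fps_const (?r p) * G p)) * (1 + ?at * G t)"
    using insert.hyps insert.prems insert.IH[OF inj, of G] by simp
  also have "\<dots> = 1 + ?at * G t + (\<Sum>p\<in>P. fps_const (?r p) * G p * (1 + ?at * G t))"
    by (simp add: distrib_right sum_distrib_right)
  also have "(\<Sum>p\<in>P. fps_const (?r p) * G p * (1 + ?at * G t)) = (\<Sum>p\<in>P. fps_const (?r' p) * G p) +
      ?at * (\<Sum>p\<in>P. fps_const (?r p) * fps_const (?u p)) * G t"
    by (simp only: sum.cong[OF refl resolvents] sum.distrib sum_distrib_left sum_distrib_right)
  also have "1 + ?at * G t + \<dots> = 1 + fps_const (?r' t) * G t + (\<Sum>p\<in>P. fps_const (?r' p) * G p)"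
    unfolding residue_t by (simp only: algebra_simps mult_1_left)
  also have "\<dots> = 1 + (\<Sum>p\<in>insert t P. fps_const (?r' p) * G p)"
    using insert.hyps by (simp add: add.assoc)
  finally show ?case .
qed simp

lemma partial_fractions_fps:
  fixes a b :: "'b \<Rightarrow> 'a :: field"
  assumes P: "finite P" "inj_on a P"
    and quotient: "f * (\<Prod>p\<in>P. lin_fps (a p)) = (\<Prod>p\<in>P. lin_fps (b p))"
  shows "fps_nth f (Suc j) = (\<Sum>p\<in>P. pf_residue a b P p * a p ^ j)"
proof -
  have factor: "(1 + fps_const (a p - b p) * resolvent_fps (a p)) * lin_fps (a p) = lin_fps (b p)" for p
    unfolding distrib_right mult.assoc resolvent_fps_mult_lin_fps
    by (simp add: algebra_simps flip: fps_const_sub)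
  have "f * (\<Prod>p\<in>P. lin_fps (a p)) =
      (\<Prod>p\<in>P. 1 + fps_const (a p - b p) * resolvent_fps (a p)) * (\<Prod>p\<in>P. lin_fps (a p))"
    unfolding quotient prod.distrib[symmetric] factor ..
  then have "f = (\<Prod>p\<in>P. 1 + fps_const (a p - b p) * resolvent_fps (a p))"
    using lin_fps_nonzero P(1) by simp
  also have "\<dots> = 1 + (\<Sum>p\<in>P. fps_const (pf_residue a b P p) * resolvent_fps (a p))"
    by (intro partial_fractions_resolvents P resolvent_fps_identity)
  finally show "fps_nth f (Suc j) = (\<Sum>p\<in>P. pf_residue a b P p * a p ^ j)"
    by (simp add: fps_sum_nth resolvent_fps_def)
qed

section \<open>The number of shifted tableaux and the transition measure\<close>

definition schur_product :: "nat set \<Rightarrow> real" where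
  "schur_product P = (\<Prod>p\<in>P. 1 / fact p) *
     (\<Prod>(p, q)\<in>{(p, q). p \<in> P \<and> q \<in> P \<and> p < q}. (real q - real p) / (real q + real p))"

lemma schur_product_empty: "schur_product {} = 1"
  by (simp add: schur_product_def)

lemma schur_product_insert:
  assumes P: "finite P" "p \<notin> P"
  shows "schur_product (insert p P) =
    schur_product P * (1 / fact p * (\<Prod>q\<in>P. \<bar>real p - real q\<bar> / (real p + real q)))"
proof -
  let ?f = "\<lambda>(p, q). (real q - real p) / (real q + real p)"
  let ?h = "\<lambda>q. \<bar>real p - real q\<bar> / (real p + real q)"
  let ?pairs = "\<lambda>P. {(p, q). p \<in> P \<and> q \<in> P \<and> p < q}"
  let ?L = "{q \<in> P. q < p}" and ?R = "{q \<in> P. p < q}"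
  have fin: "finite (?pairs P)"
    by (rule finite_subset[of _ "P \<times> P"]) (use P in auto)
  have split: "?pairs (insert p P) = ?pairs P \<union> ((\<lambda>q. (q, p)) ` ?L \<union> (\<lambda>q. (p, q)) ` ?R)" by auto
  have LR: "P = ?L \<union> ?R" using P(2) nat_neq_iff by blast
  have "prod ?f ((\<lambda>q. (q, p)) ` ?L) = prod ?h ?L" "prod ?f ((\<lambda>q. (p, q)) ` ?R) = prod ?h ?R"
    by (subst prod.reindex; auto simp: inj_on_def add.commute intro!: prod.cong)+
  moreover have "prod ?h P = prod ?h ?L * prod ?h ?R"
    by (subst LR, rule prod.union_disjoint) (use P in auto)
  moreover have "prod ?f ((\<lambda>q. (q, p)) ` ?L \<union> (\<lambda>q. (p, q)) ` ?R) =
      prod ?f ((\<lambda>q. (q, p)) ` ?L) * prod ?f ((\<lambda>q. (p, q)) ` ?R)"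
    using P by (intro prod.union_disjoint) auto
  moreover have "prod ?f (?pairs (insert p P)) =
      prod ?f (?pairs P) * prod ?f ((\<lambda>q. (q, p)) ` ?L \<union> (\<lambda>q. (p, q)) ` ?R)"
    unfolding split using fin P by (intro prod.union_disjoint) auto
  ultimately have "prod ?f (?pairs (insert p P)) = prod ?f (?pairs P) * prod ?h P" by (simp only:)
  then show ?thesis unfolding schur_product_def prod.insert[OF P] by (simp only: mult_ac)
qed

lemma schur_product_pos:
  assumes "finite P" shows "schur_product P > 0"
  using assms
proof (induction rule: finite_induct)
  case (insert p P)
  have "(\<Prod>q\<in>P. \<bar>real p - real q\<bar> / (real p + real q)) > 0"
  proof (rule prod_pos)
    fix q assume "q \<in> P"
    then have "p \<noteq> q" using insert by auto
    then have "real p + real q > 0" "\<bar>real p - real q\<bar> > 0" by (auto simp: nat_neq_iff)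
    then show "0 < \<bar>real p - real q\<bar> / (real p + real q)" by simp
  qed
  then show ?case using insert by (simp add: schur_product_insert)
qed (simp add: schur_product_empty)

definition removal_factor :: "nat \<Rightarrow> nat \<Rightarrow> real" where
  "removal_factor p q = (real p * (real p - 1) - real q * (real q + 1)) /
     (real p * (real p - 1) - real q * (real q - 1))"

text \<open>
  Up to the factor \<open>-2 / \<nu>\<close> the weight of \<open>p\<close> is the residue of the shape series at the pole
  coming from the part \<open>p\<close>. It vanishes when the last box of the row of \<open>p\<close> is not a corner.
\<close>

definition removal_weight :: "nat set \<Rightarrow> nat \<Rightarrow> real" where
  "removal_weight P p = real p * (\<Prod>q\<in>P - {p}. removal_factor p q)"

lemma removal_weight_eq_0:
  assumes "finite P" "p > 0" "p - 1 \<in> P" shows "removal_weight P p = 0"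
proof -
  have "p - 1 \<in> P - {p}" "removal_factor p (p - 1) = 0"
    using assms by (auto simp: removal_factor_def)
  then show ?thesis using assms(1) by (auto simp: removal_weight_def)
qed

lemma schur_factor_decrement:
  assumes "q \<noteq> p" "q \<noteq> p - 1" "p > 0" "q > 0"
  shows "\<bar>real (p - 1) - real q\<bar> / (real (p - 1) + real q) =
    \<bar>real p - real q\<bar> / (real p + real q) * removal_factor p q"
proof -
  have pred: "real (p - 1) = real p - 1" using assms by simp
  have numerator: "real p * (real p - 1) - real q * (real q + 1) = (real p + real q) * (real p - 1 - real q)"
    and denominator: "real p * (real p - 1) - real q * (real q - 1) = (real p - real q) * (real p - 1 + real q)"
    by (simp_all add: algebra_simps)
  have nonzero: "real p - real q \<noteq> 0" "real p + real q \<noteq> 0" "real p - 1 + real q \<noteq> 0"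
    using assms by auto
  have "\<bar>real p - 1 - real q\<bar> * (real p - real q) = \<bar>real p - real q\<bar> * (real p - 1 - real q)"
  proof (cases "q < p")
    case True
    then have "q + 1 < p" using assms by linarith
    then have "real q + 1 < real p" by linarith
    then show ?thesis by (simp add: abs_of_pos mult.commute)
  next
    case False
    then have "real p < real q" using assms by linarith
    then show ?thesis by (simp add: abs_of_neg algebra_simps)
  qed
  then have "\<bar>real p - 1 - real q\<bar> = \<bar>real p - real q\<bar> * (real p - 1 - real q) / (real p - real q)"
    using nonzero by (simp only: eq_divide_eq) simp
  then show ?thesis
    unfolding removal_factor_def pred numerator denominator using nonzero by simp
qed

lemma schur_product_remove_0:
  assumes "finite P" shows "schur_product (P - {0}) = schur_product P"
proof (cases "0 \<in> P")
  case True
  then have "schur_product P = schur_product (insert 0 (P - {0}))" by (simp add: insert_absorb)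
  also have "\<dots> = schur_product (P - {0})"
    using assms by (subst schur_product_insert) (auto intro!: prod.neutral)
  finally show ?thesis ..
qed simp

lemma schur_product_decrement:
  assumes P: "finite P" "0 \<notin> P" "p \<in> P" "p - 1 \<notin> P"
  shows "schur_product (insert (p - 1) (P - {p}) - {0}) = schur_product P * removal_weight P p"
proof -
  define Q where "Q = P - {p}"
  have Q: "finite Q" "0 \<notin> Q" "p \<notin> Q" "p - 1 \<notin> Q" "P = insert p Q" "p > 0"
    using P by (auto simp: Q_def intro: gr0I)
  have "(\<Prod>q\<in>Q. \<bar>real (p - 1) - real q\<bar> / (real (p - 1) + real q)) =
      (\<Prod>q\<in>Q. \<bar>real p - real q\<bar> / (real p + real q)) * (\<Prod>q\<in>Q. removal_factor p q)"
    unfolding prod.distrib[symmetric]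
    using Q by (intro prod.cong refl schur_factor_decrement) (auto intro: gr0I)
  moreover have "1 / fact (p - 1) = (1 / fact p * real p :: real)"
    using Q by (simp add: fact_reduce[of p])
  moreover have "schur_product (insert (p - 1) Q - {0}) = schur_product Q *
      (1 / fact (p - 1) * (\<Prod>q\<in>Q. \<bar>real (p - 1) - real q\<bar> / (real (p - 1) + real q)))"
    unfolding schur_product_remove_0[OF finite.insertI[OF Q(1)]] by (rule schur_product_insert[OF Q(1,4)])
  moreover have "schur_product P = schur_product Q *
      (1 / fact p * (\<Prod>q\<in>Q. \<bar>real p - real q\<bar> / (real p + real q)))"
    unfolding Q(5) by (rule schur_product_insert[OF Q(1,3)])
  ultimately show ?thesis by (simp add: Q_def removal_weight_def)
qed

lemma corner_removal:
  assumes \<xi>: "strict_seq \<xi>" and b: "b \<in> corners (seq_diagram \<xi>)"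
  obtains \<eta> where "strict_seq \<eta>" "seq_diagram \<xi> - {b} = seq_diagram \<eta>"
    "schur_product (parts \<eta>) = schur_product (parts \<xi>) * removal_weight (parts \<xi>) (box_content b + 1)"
proof -
  obtain y where y: "y \<in> removable_rows \<xi>" "b = (y + \<xi> y, y)"
    using b unfolding corners_seq_diagram[OF \<xi>] by auto
  note remove = remove_row_end[OF \<xi> y(1)]
  have row: "\<xi> y > 0" "\<xi> y - 1 \<notin> parts \<xi>" using y by (auto simp: removable_rows_def)
  have "schur_product (parts (\<xi>(y := \<xi> y - 1))) = schur_product (parts \<xi>) * removal_weight (parts \<xi>) (\<xi> y)"
    unfolding remove(3) using row
    by (intro schur_product_decrement finite_parts[OF \<xi>] zero_notin_parts parts_memI)
  moreover have "box_content b + 1 = \<xi> y" using row y by (simp add: box_content_def)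
  ultimately show ?thesis using that[OF remove(2)] remove(1) y(2) by simp
qed

lemma shifted_shape_remove_corner:
  "shifted_shape D \<Longrightarrow> b \<in> corners D \<Longrightarrow> shifted_shape (D - {b})"
  by (metis corner_removal shifted_shape_def)

lemma sum_corners_by_parts:
  fixes g :: "nat \<Rightarrow> real"
  assumes \<xi>: "strict_seq \<xi>"
  shows "(\<Sum>b\<in>corners (seq_diagram \<xi>). removal_weight (parts \<xi>) (box_content b + 1) * g (box_content b)) =
    (\<Sum>p\<in>parts \<xi>. removal_weight (parts \<xi>) p * g (p - 1))"
proof -
  have inj: "inj_on (\<lambda>y. (y + \<xi> y, y)) (removable_rows \<xi>)" by (auto simp: inj_on_def)
  have "(\<Sum>b\<in>corners (seq_diagram \<xi>). removal_weight (parts \<xi>) (box_content b + 1) * g (box_content b)) =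
      (\<Sum>y\<in>removable_rows \<xi>. removal_weight (parts \<xi>) (\<xi> y) * g (\<xi> y - 1))"
    unfolding corners_seq_diagram[OF \<xi>] sum.reindex[OF inj]
    by (rule sum.cong[OF refl]) (auto simp: box_content_def removable_rows_def)
  also have "\<dots> = (\<Sum>y\<in>{y. \<xi> y > 0}. removal_weight (parts \<xi>) (\<xi> y) * g (\<xi> y - 1))"
    using \<xi> removal_weight_eq_0[OF finite_parts[OF \<xi>]]
    by (intro sum.mono_neutral_left) (auto simp: strict_seq_def removable_rows_def)
  also have "\<dots> = (\<Sum>p\<in>parts \<xi>. removal_weight (parts \<xi>) p * g (p - 1))"
    unfolding parts_def by (subst sum.reindex[OF inj_on_strict_seq[OF \<xi>]]) simp
  finally show ?thesis .
qed

definition box_weight :: "real \<Rightarrow> nat \<Rightarrow> real" where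
  "box_weight \<nu> c = real c * (real c + 1) / \<nu>"

text \<open>
  With \<open>w = c (c + 1) / \<nu>\<close> the coefficients are chosen such that \<open>box_factor \<nu> c\<close> is the expansion of
  \<open>(1 - u (c + 1) (c + 2) / \<nu>) (1 - u c (c - 1) / \<nu>) / (1 - u w)\<^sup>2\<close>, which telescopes along a row.
\<close>

definition box_series :: "real \<Rightarrow> real fps" where
  "box_series w = Abs_fps (\<lambda>i. if i = 0 then 0 else (4 * real i - 2) * w ^ (i - 1))"

definition box_factor :: "real \<Rightarrow> nat \<Rightarrow> real fps" where
  "box_factor \<nu> c = 1 - fps_const (1 / \<nu>) * box_series (box_weight \<nu> c)"

definition shape_series :: "real \<Rightarrow> (nat \<times> nat) set \<Rightarrow> real fps" where
  "shape_series \<nu> D = (\<Prod>b\<in>D. box_factor \<nu> (box_content b))"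

lemma box_weight_nonneg: "\<nu> \<ge> 0 \<Longrightarrow> box_weight \<nu> c \<ge> 0"
  by (simp add: box_weight_def)

lemma box_factor_nth_0: "fps_nth (box_factor \<nu> c) 0 = 1"
  by (simp add: box_factor_def box_series_def)

lemma box_series_mult_lin_fps:
  "box_series w * lin_fps w * lin_fps w = fps_const 2 * fps_X + fps_const (2 * w) * fps_X ^ 2"
proof (rule fps_ext)
  fix j
  consider "j = 0" | "j = 1" | "j = 2" | i where "j = Suc (Suc (Suc i))"
    by (metis One_nat_def Suc_1 not0_implies_Suc)
  then show "fps_nth (box_series w * lin_fps w * lin_fps w) j =
      fps_nth (fps_const 2 * fps_X + fps_const (2 * w) * fps_X ^ 2) j"
    by cases (simp_all add: fps_nth_mult_lin_fps box_series_def fps_X_power_iff algebra_simps)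
qed

lemma lin_fps_mult_lin_fps:
  "lin_fps a * lin_fps b = 1 - fps_const (a + b) * fps_X + fps_const (a * b) * fps_X ^ 2"
  by (simp add: algebra_simps power2_eq_square fps_const_add[symmetric] fps_const_mult[symmetric]
      del: fps_const_add fps_const_mult)

lemma box_factor_mult_lin_fps:
  assumes "\<nu> \<noteq> 0"
  shows "box_factor \<nu> c * lin_fps (box_weight \<nu> c) * lin_fps (box_weight \<nu> c) =
    lin_fps (real (c + 1) * (real (c + 1) + 1) / \<nu>) * lin_fps (real c * (real c - 1) / \<nu>)"
    (is "_ = lin_fps ?a * lin_fps ?b")
proof -
  let ?w = "box_weight \<nu> c"
  have sum: "?a + ?b = 2 * ?w + 2 / \<nu>" and product: "?a * ?b = ?w * ?w - 2 * ?w / \<nu>"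
    using assms by (simp_all add: box_weight_def field_simps)
  have "box_factor \<nu> c * lin_fps ?w * lin_fps ?w =
      lin_fps ?w * lin_fps ?w - fps_const (1 / \<nu>) * (box_series ?w * lin_fps ?w * lin_fps ?w)"
    by (simp add: box_factor_def algebra_simps)
  also have "\<dots> = lin_fps ?a * lin_fps ?b"
    unfolding box_series_mult_lin_fps lin_fps_mult_lin_fps sum product
    by (rule fps_ext) (simp add: fps_X_power_iff algebra_simps)
  finally show ?thesis .
qed

lemma prod_box_factor_row:
  assumes "\<nu> \<noteq> 0"
  shows "(\<Prod>c<p. box_factor \<nu> c) * lin_fps (real p * (real p - 1) / \<nu>) = lin_fps (real p * (real p + 1) / \<nu>)"
proof (induction p)
  case (Suc p)
  let ?w = "box_weight \<nu> p" and ?next = "lin_fps (real (p + 1) * (real (p + 1) + 1) / \<nu>)"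
  have "lin_fps ?w * ((\<Prod>c<Suc p. box_factor \<nu> c) * lin_fps ?w) =
      (\<Prod>c<p. box_factor \<nu> c) * (box_factor \<nu> p * lin_fps ?w * lin_fps ?w)"
    by (simp add: mult_ac)
  also have "\<dots> = ((\<Prod>c<p. box_factor \<nu> c) * lin_fps (real p * (real p - 1) / \<nu>)) * ?next"
    unfolding box_factor_mult_lin_fps[OF assms] by (simp only: mult_ac)
  also have "\<dots> = lin_fps ?w * ?next"
    unfolding Suc.IH by (simp add: box_weight_def)
  finally have "(\<Prod>c<Suc p. box_factor \<nu> c) * lin_fps ?w = ?next"
    using lin_fps_nonzero[of ?w] by (simp only: mult_cancel_left simp_thms)
  moreover have "?w = real (Suc p) * (real (Suc p) - 1) / \<nu>" by (simp add: box_weight_def)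
  ultimately show ?case by simp
qed simp

lemma shape_series_nth:
  assumes \<xi>: "strict_seq \<xi>" and \<nu>: "\<nu> \<noteq> 0"
  shows "fps_nth (shape_series \<nu> (seq_diagram \<xi>)) (Suc j) =
    - (2 / \<nu>) * (\<Sum>p\<in>parts \<xi>. removal_weight (parts \<xi>) p * box_weight \<nu> (p - 1) ^ j)"
proof -
  let ?P = "parts \<xi>"
  let ?a = "\<lambda>p. real p * (real p - 1) / \<nu>" and ?b = "\<lambda>p. real p * (real p + 1) / \<nu>"
  have pos: "real p \<ge> 1" if "p \<in> ?P" for p
    using that zero_notin_parts[of \<xi>] by (cases p) auto
  have inj: "inj_on ?a ?P"
  proof (rule inj_onI)
    fix p q assume pq: "p \<in> ?P" "q \<in> ?P" "?a p = ?a q"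
    then have "(real p - real q) * (real p + real q - 1) = 0" using \<nu> by (simp add: field_simps)
    moreover have "real p + real q - 1 \<noteq> 0" using pos[OF pq(1)] pos[OF pq(2)] by linarith
    ultimately show "p = q" by simp
  qed
  have "shape_series \<nu> (seq_diagram \<xi>) * (\<Prod>p\<in>?P. lin_fps (?a p)) = (\<Prod>p\<in>?P. lin_fps (?b p))"
    unfolding shape_series_def prod.seq_diagram_by_parts[OF \<xi>] prod.distrib[symmetric]
    by (intro prod.cong refl prod_box_factor_row[OF \<nu>])
  from partial_fractions_fps[OF finite_parts[OF \<xi>] inj this]
  have "fps_nth (shape_series \<nu> (seq_diagram \<xi>)) (Suc j) = (\<Sum>p\<in>?P. pf_residue ?a ?b ?P p * ?a p ^ j)" .
  also have "\<dots> = (\<Sum>p\<in>?P. - (2 / \<nu>) * (removal_weight ?P p * box_weight \<nu> (p - 1) ^ j))"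
  proof (rule sum.cong[OF refl])
    fix p assume "p \<in> ?P"
    then have "?a p = box_weight \<nu> (p - 1)"
      using pos[of p] by (simp add: box_weight_def)
    moreover have "?a p - ?b p = - (2 / \<nu>) * real p" using \<nu> by (simp add: field_simps)
    moreover have "(?a p - ?b q) / (?a p - ?a q) = removal_factor p q" for q
      using \<nu> by (simp add: removal_factor_def flip: diff_divide_distrib)
    ultimately show "pf_residue ?a ?b ?P p * ?a p ^ j =
        - (2 / \<nu>) * (removal_weight ?P p * box_weight \<nu> (p - 1) ^ j)"
      by (simp add: pf_residue_def removal_weight_def)
  qed
  finally show ?thesis by (simp add: sum_distrib_left)
qed

lemma shape_series_nth_0: "fps_nth (shape_series \<nu> D) 0 = 1"
  unfolding shape_series_def
  by (induction D rule: infinite_finite_induct) (simp_all add: box_factor_nth_0)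

lemma shape_series_nth_1: "fps_nth (shape_series \<nu> D) (Suc 0) = - (2 / \<nu>) * real (card D)"
proof (induction D rule: infinite_finite_induct)
  case (insert b D)
  have "fps_nth (box_factor \<nu> c) (Suc 0) = - (2 / \<nu>)" for c
    by (simp add: box_factor_def box_series_def)
  moreover have "shape_series \<nu> (insert b D) = box_factor \<nu> (box_content b) * shape_series \<nu> D"
    using insert.hyps by (simp add: shape_series_def)
  ultimately show ?case
    using insert shape_series_nth_0[of \<nu> D]
    by (simp add: fps_mult_nth box_factor_nth_0 distrib_left add_divide_distrib)
qed (simp_all add: shape_series_def)

lemma sum_removal_weight:
  assumes "strict_seq \<xi>"
  shows "(\<Sum>p\<in>parts \<xi>. removal_weight (parts \<xi>) p) = real (card (seq_diagram \<xi>))"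
  using shape_series_nth[OF assms, of 1 0] shape_series_nth_1[of 1 "seq_diagram \<xi>"] by simp

lemma parts_eq_empty:
  assumes "seq_diagram \<xi> = {}" shows "parts \<xi> = {}"
proof -
  have "(Suc y, y) \<notin> seq_diagram \<xi>" for y using assms by simp
  then have "\<xi> y = 0" for y by (simp add: seq_diagram_def Suc_le_eq)
  then show ?thesis by (simp add: parts_def)
qed

lemma card_standard_tableaux:
  assumes "strict_seq \<xi>"
  shows "real (card (standard_tableaux (seq_diagram \<xi>))) =
    fact (card (seq_diagram \<xi>)) * schur_product (parts \<xi>)"
  using assms
proof (induction "card (seq_diagram \<xi>)" arbitrary: \<xi>)
  case 0
  then have "seq_diagram \<xi> = {}" using finite_seq_diagram by simp
  then show ?case by (simp add: linear_extensions_empty parts_eq_empty schur_product_empty)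
next
  case (Suc m)
  let ?D = "seq_diagram \<xi>" and ?w = "removal_weight (parts \<xi>)"
  have fin: "finite ?D" and ne: "?D \<noteq> {}" using Suc.hyps(2) finite_seq_diagram[OF Suc.prems] by auto
  have "real (card (standard_tableaux (?D - {b}))) =
      fact m * schur_product (parts \<xi>) * (?w (box_content b + 1) * 1)" if b: "b \<in> corners ?D" for b
  proof -
    obtain \<eta> where \<eta>: "strict_seq \<eta>" "?D - {b} = seq_diagram \<eta>"
      "schur_product (parts \<eta>) = schur_product (parts \<xi>) * ?w (box_content b + 1)"
      using corner_removal[OF Suc.prems b] .
    have "m = card (seq_diagram \<eta>)"
      using card_remove_maximal_element[OF fin b] Suc.hyps(2) \<eta>(2) by simp
    then show ?thesis using Suc.hyps(1)[of \<eta>] \<eta> by simp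
  qed
  then have "real (card (standard_tableaux ?D)) = fact m * schur_product (parts \<xi>) *
      (\<Sum>b\<in>corners ?D. ?w (box_content b + 1) * 1)"
    unfolding card_linear_extensions[OF fin ne] by (simp add: sum_distrib_left)
  also have "(\<Sum>b\<in>corners ?D. ?w (box_content b + 1) * 1) = real (Suc m)"
    unfolding sum_corners_by_parts[OF Suc.prems, of "\<lambda>_. 1"]
    using sum_removal_weight[OF Suc.prems] Suc.hyps(2) by simp
  finally show ?case unfolding Suc.hyps(2)[symmetric] by simp
qed

lemma standard_tableaux_nonempty:
  assumes "shifted_shape D" shows "standard_tableaux D \<noteq> {}"
proof -
  obtain \<xi> where \<xi>: "strict_seq \<xi>" "D = seq_diagram \<xi>" using assms by (rule shifted_shapeE)
  have "real (card (standard_tableaux D)) > 0"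
    unfolding \<xi>(2) card_standard_tableaux[OF \<xi>(1)]
    using schur_product_pos[OF finite_parts[OF \<xi>(1)]] by simp
  then show ?thesis by auto
qed

abbreviation corner_prob :: "(nat \<times> nat) set \<Rightarrow> nat \<times> nat \<Rightarrow> real" where
  "corner_prob \<equiv> removal_prob box_less"

lemma sum_corner_prob:
  assumes "shifted_shape D" "D \<noteq> {}"
  shows "(\<Sum>b\<in>corners D. corner_prob D b) = 1"
  using assms by (intro sum_removal_prob finite_shifted_shape standard_tableaux_nonempty)

lemma corner_prob_eq:
  assumes \<xi>: "strict_seq \<xi>" and b: "b \<in> corners (seq_diagram \<xi>)"
  shows "corner_prob (seq_diagram \<xi>) b =
    removal_weight (parts \<xi>) (box_content b + 1) / real (card (seq_diagram \<xi>))"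
proof -
  obtain \<eta> where \<eta>: "strict_seq \<eta>" "seq_diagram \<xi> - {b} = seq_diagram \<eta>"
    "schur_product (parts \<eta>) = schur_product (parts \<xi>) * removal_weight (parts \<xi>) (box_content b + 1)"
    using corner_removal[OF \<xi> b] .
  have "card (seq_diagram \<xi>) = Suc (card (seq_diagram \<eta>))"
    using card_remove_maximal_element[OF finite_seq_diagram[OF \<xi>] b] \<eta>(2) by simp
  then show ?thesis
    unfolding removal_prob_def \<eta>(2) card_standard_tableaux[OF \<xi>] card_standard_tableaux[OF \<eta>(1)] \<eta>(3)
    using schur_product_pos[OF finite_parts[OF \<xi>]] by simp
qed

lemma corner_prob_moment:
  assumes D: "shifted_shape D" "D \<noteq> {}" and \<nu>: "\<nu> \<noteq> 0"
  shows "(\<Sum>b\<in>corners D. corner_prob D b * box_weight \<nu> (box_content b) ^ j) =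
    - (\<nu> / (2 * real (card D))) * fps_nth (shape_series \<nu> D) (Suc j)"
proof -
  obtain \<xi> where \<xi>: "strict_seq \<xi>" "D = seq_diagram \<xi>" using D(1) by (rule shifted_shapeE)
  let ?w = "removal_weight (parts \<xi>)"
  have "(\<Sum>b\<in>corners D. corner_prob D b * box_weight \<nu> (box_content b) ^ j) =
     (\<Sum>b\<in>corners D. ?w (box_content b + 1) * box_weight \<nu> (box_content b) ^ j) / real (card D)"
    unfolding sum_divide_distrib by (rule sum.cong) (simp_all add: \<xi> corner_prob_eq)
  also have "\<dots> = (\<Sum>p\<in>parts \<xi>. ?w p * box_weight \<nu> (p - 1) ^ j) / real (card D)"
    unfolding \<xi>(2) sum_corners_by_parts[OF \<xi>(1), of "\<lambda>c. box_weight \<nu> c ^ j"] ..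
  also have "\<dots> = - (\<nu> / (2 * real (card D))) * fps_nth (shape_series \<nu> D) (Suc j)"
    unfolding \<xi>(2) shape_series_nth[OF \<xi>(1) \<nu>] using \<nu> by simp
  finally show ?thesis .
qed

section \<open>Perturbation of powers of power series\<close>

lemma fps_nth_power_diff:
  fixes f g :: "'a :: comm_ring_1 fps"
  assumes "fps_nth f 0 = 1" "fps_nth g 0 = 1" "\<And>i. i < j \<Longrightarrow> fps_nth f i = fps_nth g i"
  shows "fps_nth (f ^ a) j - fps_nth (g ^ a) j = of_nat a * (fps_nth f j - fps_nth g j)"
proof -
  let ?S = "\<Sum>i<a. g ^ (a - Suc i) * f ^ i"
  have "fps_nth (f ^ a) j - fps_nth (g ^ a) j = (\<Sum>i=0..j. fps_nth (f - g) i * fps_nth ?S (j - i))"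
    unfolding fps_sub_nth[symmetric] power_diff_sumr2 by (rule fps_mult_nth)
  also have "\<dots> = fps_nth (f - g) j * fps_nth ?S 0"
    using assms(3) by (subst sum.remove[of _ j]) (auto intro!: sum.neutral)
  also have "fps_nth ?S 0 = of_nat a" using assms(1,2) by (simp add: fps_sum_nth fps_nth_power_0)
  finally show ?thesis by (simp add: mult.commute)
qed

definition fps_seminorm :: "nat \<Rightarrow> 'a :: real_normed_field fps \<Rightarrow> real" where
  "fps_seminorm K f = (\<Sum>j\<le>K. norm (fps_nth f j))"

lemma norm_fps_nth_le: "j \<le> K \<Longrightarrow> norm (fps_nth f j) \<le> fps_seminorm K f"
  unfolding fps_seminorm_def by (rule member_le_sum) auto

lemma fps_seminorm_nonneg: "0 \<le> fps_seminorm K f"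
  by (simp add: fps_seminorm_def sum_nonneg)

lemma fps_seminorm_1: "fps_seminorm K 1 = 1"
  by (simp add: fps_seminorm_def if_distrib[of norm] cong: if_cong)

lemma fps_seminorm_add_le: "fps_seminorm K (f + g) \<le> fps_seminorm K f + fps_seminorm K g"
  unfolding fps_seminorm_def by (simp add: sum_mono norm_triangle_ineq flip: sum.distrib)

lemma fps_seminorm_diff_le: "fps_seminorm K (f - g) \<le> fps_seminorm K f + fps_seminorm K g"
  unfolding fps_seminorm_def by (simp add: sum_mono norm_triangle_ineq4 flip: sum.distrib)

lemma fps_seminorm_cmult: "fps_seminorm K (fps_const c * f) = norm c * fps_seminorm K f"
  by (simp add: fps_seminorm_def norm_mult sum_distrib_left)

lemma fps_seminorm_mult_le: "fps_seminorm K (f * g) \<le> fps_seminorm K f * fps_seminorm K g"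
proof -
  let ?h = "\<lambda>(i, j). norm (fps_nth f i) * norm (fps_nth g j)"
  have "fps_seminorm K (f * g) \<le> (\<Sum>j\<le>K. \<Sum>i\<le>j. norm (fps_nth f i) * norm (fps_nth g (j - i)))"
    unfolding fps_seminorm_def fps_mult_nth atMost_atLeast0[symmetric]
    by (intro sum_mono order_trans[OF norm_sum]) (simp add: norm_mult)
  also have "\<dots> = sum ?h {(i, j). i + j \<le> K}"
    by (rule sum.triangle_reindex_eq[symmetric])
  also have "\<dots> \<le> sum ?h ({..K} \<times> {..K})"
    by (rule sum_mono2) auto
  also have "\<dots> = fps_seminorm K f * fps_seminorm K g"
    unfolding fps_seminorm_def sum_product sum.cartesian_product ..
  finally show ?thesis .
qed

lemma fps_seminorm_power_le: "fps_seminorm K (f ^ a) \<le> fps_seminorm K f ^ a"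
proof (induction a)
  case (Suc a)
  have "fps_seminorm K (f ^ Suc a) \<le> fps_seminorm K f * fps_seminorm K (f ^ a)"
    by (simp add: fps_seminorm_mult_le)
  also have "\<dots> \<le> fps_seminorm K f ^ Suc a"
    using Suc by (simp add: mult_left_mono fps_seminorm_nonneg)
  finally show ?case .
qed (simp add: fps_seminorm_1)

lemma fps_seminorm_one_minus_power_le:
  assumes x: "fps_seminorm K x \<le> t"
  shows "fps_seminorm K ((1 - x) ^ a - 1 + of_nat a * x) \<le> (real a)\<^sup>2 * (1 + t) ^ a * t\<^sup>2"
proof (induction a)
  case 0
  then show ?case by (simp add: fps_seminorm_def)
next
  case (Suc a)
  define f where "f = (1 - x) ^ a - 1 + of_nat a * x"
  have t: "0 \<le> t" using x fps_seminorm_nonneg[of K x] by linarith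
  have power: "1 \<le> (1 + t) ^ Suc a" using t by (intro one_le_power) simp
  have "(1 - x) ^ Suc a - 1 + of_nat (Suc a) * x = (1 - x) * f + fps_const (of_nat a) * (x * x)"
    by (simp add: f_def algebra_simps fps_of_nat)
  then have "fps_seminorm K ((1 - x) ^ Suc a - 1 + of_nat (Suc a) * x) \<le>
      fps_seminorm K ((1 - x) * f) + fps_seminorm K (fps_const (of_nat a) * (x * x))"
    by (simp only: fps_seminorm_add_le)
  also have "fps_seminorm K ((1 - x) * f) \<le> (1 + t) * ((real a)\<^sup>2 * (1 + t) ^ a * t\<^sup>2)"
    using Suc fps_seminorm_diff_le[of K 1 x] x t fps_seminorm_nonneg
    by (intro order_trans[OF fps_seminorm_mult_le] mult_mono) (auto simp: f_def fps_seminorm_1)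
  also have "\<dots> = (real a)\<^sup>2 * (1 + t) ^ Suc a * t\<^sup>2" by simp
  also have "fps_seminorm K (fps_const (of_nat a) * (x * x)) \<le> real a * t\<^sup>2"
    unfolding fps_seminorm_cmult norm_of_nat power2_eq_square
    using x t fps_seminorm_nonneg
    by (intro mult_left_mono order_trans[OF fps_seminorm_mult_le] mult_mono) auto
  also have "\<dots> \<le> real a * (1 + t) ^ Suc a * t\<^sup>2"
    using power by (intro mult_right_mono) (auto simp: mult_le_cancel_left1)
  also have "(real a)\<^sup>2 * (1 + t) ^ Suc a * t\<^sup>2 + real a * (1 + t) ^ Suc a * t\<^sup>2 =
      ((real a)\<^sup>2 + real a) * ((1 + t) ^ Suc a * t\<^sup>2)"
    by (simp only: distrib_right mult.assoc)
  also have "\<dots> \<le> (real (Suc a))\<^sup>2 * ((1 + t) ^ Suc a * t\<^sup>2)"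
    using t by (intro mult_right_mono) (auto simp: power2_eq_square algebra_simps)
  finally show ?case by (simp only: mult.assoc add_left_mono)
qed

lemma fps_seminorm_of_nat_mult: "fps_seminorm K (of_nat a * f) = real a * fps_seminorm K f"
  by (simp add: fps_seminorm_cmult flip: fps_of_nat)

definition perturbation_bound :: "nat \<Rightarrow> real \<Rightarrow> real" where
  "perturbation_bound a E = real a * E + (real a)\<^sup>2 * (1 + E) ^ a * E\<^sup>2"

lemma perturbation_bound_nonneg: "0 \<le> E \<Longrightarrow> 0 \<le> perturbation_bound a E"
  by (simp add: perturbation_bound_def)

lemma fps_seminorm_perturbation_le:
  fixes f x :: "'a :: real_normed_field fps" and a :: nat
  assumes f: "fps_seminorm K f \<le> p" and x: "fps_seminorm K x \<le> \<epsilon> * E"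
    and \<epsilon>: "0 \<le> \<epsilon>" "\<epsilon> \<le> 1" and E: "0 \<le> E"
  defines "g \<equiv> f * (1 - x) ^ a"
  shows "fps_seminorm K (f - g) \<le> p * perturbation_bound a E * \<epsilon>"
    and "fps_seminorm K (f - g - of_nat a * (x * g)) \<le> p * perturbation_bound a E * (1 + real a * E) * \<epsilon>\<^sup>2"
proof -
  define R where "R = (1 - x) ^ a - 1 + of_nat a * x"
  let ?c = "perturbation_bound a E"
  define q where "q = (real a)\<^sup>2 * (1 + E) ^ a * E\<^sup>2"
  have p: "0 \<le> p" using f fps_seminorm_nonneg[of K f] by linarith
  have q: "0 \<le> q" "q \<le> ?c" using E by (simp_all add: q_def perturbation_bound_def)
  have "\<epsilon> * E \<le> E" using \<epsilon> E by (simp add: mult_left_le_one_le)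
  then have "(real a)\<^sup>2 * (1 + \<epsilon> * E) ^ a * (\<epsilon> * E)\<^sup>2 \<le> (real a)\<^sup>2 * (1 + E) ^ a * (\<epsilon> * E)\<^sup>2"
    using \<epsilon> E by (intro mult_right_mono mult_left_mono power_mono) auto
  then have "fps_seminorm K R \<le> q * \<epsilon>\<^sup>2"
    using fps_seminorm_one_minus_power_le[OF x, of a] by (simp add: R_def q_def power_mult_distrib mult_ac)
  then have fR: "fps_seminorm K (f * R) \<le> p * (q * \<epsilon>\<^sup>2)"
    using f p fps_seminorm_nonneg by (intro order_trans[OF fps_seminorm_mult_le] mult_mono)
  have times_x: "fps_seminorm K (of_nat a * (x * h)) \<le> real a * (\<epsilon> * E * m)" if "fps_seminorm K h \<le> m" for h m
    unfolding fps_seminorm_of_nat_mult using x that \<epsilon> E fps_seminorm_nonneg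
    by (intro mult_left_mono order_trans[OF fps_seminorm_mult_le] mult_mono) auto
  have g: "g = f - of_nat a * (x * f) + f * R" by (simp add: g_def R_def algebra_simps)
  have "fps_seminorm K (f - g) \<le> fps_seminorm K (of_nat a * (x * f)) + fps_seminorm K (f * R)"
    unfolding g by (rule order_trans[OF _ fps_seminorm_diff_le]) simp
  also have "\<dots> \<le> real a * (\<epsilon> * E * p) + p * (q * \<epsilon>)"
    using \<epsilon> p q
    by (intro add_mono times_x[OF f] order_trans[OF fR] mult_left_mono) (auto simp: power2_eq_square mult_left_le)
  also have "\<dots> = p * ?c * \<epsilon>" by (simp add: perturbation_bound_def q_def algebra_simps)
  finally show fg: "fps_seminorm K (f - g) \<le> p * ?c * \<epsilon>" .
  have "f - g - of_nat a * (x * g) = of_nat a * (x * (f - g)) - f * R"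
    by (simp add: g algebra_simps)
  then have "fps_seminorm K (f - g - of_nat a * (x * g)) \<le>
      fps_seminorm K (of_nat a * (x * (f - g))) + fps_seminorm K (f * R)"
    by (simp only: fps_seminorm_diff_le)
  also have "\<dots> \<le> real a * (\<epsilon> * E * (p * ?c * \<epsilon>)) + p * (?c * \<epsilon>\<^sup>2)"
    using p q by (intro add_mono times_x[OF fg] order_trans[OF fR] mult_left_mono mult_right_mono) auto
  also have "\<dots> = p * ?c * (1 + real a * E) * \<epsilon>\<^sup>2" by (simp add: algebra_simps power2_eq_square)
  finally show "fps_seminorm K (f - g - of_nat a * (x * g)) \<le> p * ?c * (1 + real a * E) * \<epsilon>\<^sup>2" .
qed

section \<open>Concentration\<close>

definition balanced :: "real \<Rightarrow> real \<Rightarrow> (nat \<times> nat) set \<Rightarrow> bool" where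
  "balanced C n D \<longleftrightarrow> shifted_shape D \<and> real (card D) \<le> n \<and>
     (\<forall>b\<in>D. real (box_content b) + 1 \<le> C * sqrt n)"

lemma balanced_subset:
  assumes "balanced C n D" "shifted_shape E" "E \<subseteq> D"
  shows "balanced C n E"
  using assms card_mono[OF finite_shifted_shape, of D E] by (force simp: balanced_def)

lemma balanced_remove_corner:
  assumes "balanced C n D" "b \<in> corners D"
  shows "balanced C n (D - {b})"
  using assms shifted_shape_remove_corner by (intro balanced_subset[OF assms(1)]) (auto simp: balanced_def)

lemma balanced_box_weight_le:
  assumes D: "balanced C n D" and b: "b \<in> D" and n: "n > 0"
  shows "box_weight (2 * n) (box_content b) \<le> C\<^sup>2 / 2"
proof -
  have "real (box_content b) + 1 \<le> C * sqrt n" using D b by (simp add: balanced_def)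
  then have "real (box_content b) * (real (box_content b) + 1) \<le> (C * sqrt n) * (C * sqrt n)"
    by (intro mult_mono) auto
  also have "\<dots> = C\<^sup>2 * n" using n by (simp add: power2_eq_square)
  finally show ?thesis using n by (simp add: box_weight_def divide_le_eq)
qed

definition shape_series_bound :: "real \<Rightarrow> nat \<Rightarrow> real" where
  "shape_series_bound C K = 1 + (\<Sum>i<K. (C\<^sup>2 / 2) ^ i)"

lemma shape_series_bound_nonneg: "0 \<le> shape_series_bound C K"
  by (simp add: shape_series_bound_def sum_nonneg)

lemma abs_shape_series_nth_le:
  assumes D: "balanced C n D" and n: "n > 0"
  shows "\<bar>fps_nth (shape_series (2 * n) D) (Suc i)\<bar> \<le> (C\<^sup>2 / 2) ^ i"
proof (cases "D = {}")
  case False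
  have shape: "shifted_shape D" and "real (card D) \<le> n" using D by (auto simp: balanced_def)
  let ?w = "\<lambda>b. box_weight (2 * n) (box_content b) ^ i"
  have weight: "0 \<le> ?w b \<and> ?w b \<le> (C\<^sup>2 / 2) ^ i" if "b \<in> corners D" for b
    using balanced_box_weight_le[OF D _ n, of b] box_weight_nonneg[of "2 * n" "box_content b"] n
      subsetD[OF maximal_elements_subset that] by (auto intro!: power_mono)
  have mean: "0 \<le> (\<Sum>b\<in>corners D. corner_prob D b * ?w b)"
    by (intro sum_nonneg mult_nonneg_nonneg removal_prob_nonneg) (use weight in blast)
  have "(\<Sum>b\<in>corners D. corner_prob D b * ?w b) \<le> (\<Sum>b\<in>corners D. corner_prob D b * (C\<^sup>2 / 2) ^ i)"
    by (intro sum_mono mult_left_mono removal_prob_nonneg) (use weight in blast)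
  also have "\<dots> = (C\<^sup>2 / 2) ^ i"
    using sum_corner_prob[OF shape False] by (simp flip: sum_distrib_right)
  finally have mean_le: "(\<Sum>b\<in>corners D. corner_prob D b * ?w b) \<le> (C\<^sup>2 / 2) ^ i" .
  have "fps_nth (shape_series (2 * n) D) (Suc i) =
      - (real (card D) / n * (\<Sum>b\<in>corners D. corner_prob D b * ?w b))"
    using corner_prob_moment[OF shape False, of "2 * n" i] n False finite_shifted_shape[OF shape]
    by (simp add: field_simps)
  then have "\<bar>fps_nth (shape_series (2 * n) D) (Suc i)\<bar> =
      real (card D) / n * (\<Sum>b\<in>corners D. corner_prob D b * ?w b)"
    using mean n by (simp add: abs_mult)
  also have "\<dots> \<le> 1 * (C\<^sup>2 / 2) ^ i"
    using mean mean_le \<open>real (card D) \<le> n\<close> n by (intro mult_mono) auto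
  finally show ?thesis by simp
qed (simp add: shape_series_def)

lemma fps_seminorm_shape_series_le:
  assumes "balanced C n D" "n > 0"
  shows "fps_seminorm K (shape_series (2 * n) D) \<le> shape_series_bound C K"
  unfolding fps_seminorm_def shape_series_bound_def lessThan_Suc_atMost[symmetric] sum.lessThan_Suc_shift
  using abs_shape_series_nth_le[OF assms] by (simp add: shape_series_nth_0 sum_mono)

lemma fps_seminorm_box_series_mono:
  assumes "0 \<le> w" "w \<le> v"
  shows "fps_seminorm K (box_series w) \<le> fps_seminorm K (box_series v)"
  unfolding fps_seminorm_def
proof (rule sum_mono)
  fix j
  have "w ^ (j - 1) \<le> v ^ (j - 1)" using assms by (intro power_mono) auto
  then show "norm (fps_nth (box_series w) j) \<le> norm (fps_nth (box_series v) j)"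
    using assms by (simp add: box_series_def abs_mult mult_left_mono)
qed

lemma fps_seminorm_box_series_le:
  assumes "box_weight \<nu> c \<le> M" "\<nu> \<ge> 0"
  shows "fps_seminorm K (fps_const (1 / \<nu>) * box_series (box_weight \<nu> c)) \<le>
    1 / \<nu> * fps_seminorm K (box_series M)"
  unfolding fps_seminorm_cmult
  using assms box_weight_nonneg[of \<nu> c]
  by (intro mult_mono fps_seminorm_box_series_mono) (auto simp: fps_seminorm_nonneg)

lemma shape_series_remove:
  assumes "finite D" "b \<in> D"
  shows "shape_series \<nu> D = shape_series \<nu> (D - {b}) * box_factor \<nu> (box_content b)"
  using assms by (simp add: shape_series_def prod.remove mult.commute)

definition power_coeff :: "nat \<Rightarrow> nat \<Rightarrow> real \<Rightarrow> (nat \<times> nat) set \<Rightarrow> real" where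
  "power_coeff a k \<nu> D = fps_nth (shape_series \<nu> D ^ a) k"

lemma abs_power_coeff_le:
  assumes "balanced C n D" "n > 0"
  shows "\<bar>power_coeff a k (2 * n) D\<bar> \<le> shape_series_bound C k ^ a"
proof -
  have "\<bar>power_coeff a k (2 * n) D\<bar> \<le> fps_seminorm k (shape_series (2 * n) D ^ a)"
    unfolding power_coeff_def by (metis norm_fps_nth_le order_refl real_norm_def)
  also have "\<dots> \<le> fps_seminorm k (shape_series (2 * n) D) ^ a" by (rule fps_seminorm_power_le)
  also have "\<dots> \<le> shape_series_bound C k ^ a"
    by (intro power_mono fps_seminorm_shape_series_le assms fps_seminorm_nonneg)
  finally show ?thesis .
qed

definition removal_error :: "real \<Rightarrow> nat \<Rightarrow> nat \<Rightarrow> real" where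
  "removal_error C a k = (let E = fps_seminorm k (box_series (C\<^sup>2 / 2))
     in shape_series_bound C k ^ a * perturbation_bound a E * (1 + real a * E))"

lemma removal_error_nonneg: "0 \<le> removal_error C a k"
  by (simp add: removal_error_def Let_def shape_series_bound_nonneg perturbation_bound_nonneg
      fps_seminorm_nonneg)

lemma shape_series_power_remove_corner:
  fixes D :: "(nat \<times> nat) set" and n :: real
  defines "S \<equiv> shape_series (2 * n)"
  assumes n: "n \<ge> 1" and D: "balanced C n D" and b: "b \<in> corners D"
  shows "fps_seminorm k (S (D - {b}) ^ a - S D ^ a) \<le> removal_error C a k / n"
    and "fps_seminorm k (S (D - {b}) ^ a - S D ^ a - fps_const (real a / (2 * n)) *
      (box_series (box_weight (2 * n) (box_content b)) * S D ^ a)) \<le> removal_error C a k / n\<^sup>2"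
proof -
  define E where "E = fps_seminorm k (box_series (C\<^sup>2 / 2))"
  define p where "p = shape_series_bound C k ^ a"
  define e where "e = box_series (box_weight (2 * n) (box_content b))"
  define x where "x = fps_const (1 / (2 * n)) * e"
  let ?f = "S (D - {b}) ^ a" and ?g = "S D ^ a" and ?B = "removal_error C a k" and ?c = "perturbation_bound a E"
  have E: "0 \<le> E" by (simp add: E_def fps_seminorm_nonneg)
  have B: "?B = p * ?c * (1 + real a * E)" by (simp add: removal_error_def E_def p_def Let_def)
  have "0 \<le> p * ?c" using E by (simp add: p_def shape_series_bound_nonneg perturbation_bound_nonneg)
  then have pc: "p * ?c \<le> ?B" using E by (simp add: B mult_le_cancel_left1)
  have bD: "b \<in> D" and fin: "finite D"
    using subsetD[OF maximal_elements_subset b] D finite_shifted_shape by (auto simp: balanced_def)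
  have "fps_seminorm k ?f \<le> p"
    unfolding S_def p_def using n balanced_remove_corner[OF D b]
    by (intro order_trans[OF fps_seminorm_power_le] power_mono fps_seminorm_shape_series_le
        fps_seminorm_nonneg) auto
  moreover have "fps_seminorm k x \<le> 1 / (2 * n) * E"
    unfolding x_def e_def E_def using balanced_box_weight_le[OF D bD] n
    by (intro fps_seminorm_box_series_le) auto
  moreover have g: "?g = ?f * (1 - x) ^ a"
    unfolding S_def x_def e_def shape_series_remove[OF fin bD] box_factor_def
    by (simp add: power_mult_distrib)
  ultimately have bounds: "fps_seminorm k (?f - ?g) \<le> p * ?c * (1 / (2 * n))"
    "fps_seminorm k (?f - ?g - of_nat a * (x * ?g)) \<le> ?B * (1 / (2 * n))\<^sup>2"
    unfolding B g using n E by (intro fps_seminorm_perturbation_le; simp)+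
  have le: "p * ?c * (1 / (2 * n)) \<le> ?B / n" "?B * (1 / (2 * n))\<^sup>2 \<le> ?B / n\<^sup>2"
    using pc n removal_error_nonneg[of C a k] by (simp_all add: power2_eq_square divide_simps)
  have first_order: "of_nat a * (x * ?g) = fps_const (real a / (2 * n)) * (e * ?g)"
    by (simp add: x_def mult.assoc flip: fps_of_nat)
  show "fps_seminorm k (?f - ?g) \<le> ?B / n"
    by (rule order_trans[OF bounds(1) le(1)])
  show "fps_seminorm k (?f - ?g - fps_const (real a / (2 * n)) * (box_series (box_weight (2 * n) (box_content b)) * ?g))
      \<le> ?B / n\<^sup>2"
    using order_trans[OF bounds(2) le(2)] unfolding first_order e_def .
qed

lemma power_coeff_remove_corner:
  assumes n: "n \<ge> 1" and D: "balanced C n D" and b: "b \<in> corners D"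
  shows "\<bar>power_coeff a k (2 * n) (D - {b}) - power_coeff a k (2 * n) D\<bar> \<le> removal_error C a k / n"
    and "\<bar>power_coeff a k (2 * n) (D - {b}) - power_coeff a k (2 * n) D - real a / (2 * n) *
      fps_nth (box_series (box_weight (2 * n) (box_content b)) * shape_series (2 * n) D ^ a) k\<bar>
      \<le> removal_error C a k / n\<^sup>2"
  using order_trans[OF norm_fps_nth_le[OF order_refl] shape_series_power_remove_corner(1)[OF n D b, of k a]]
    order_trans[OF norm_fps_nth_le[OF order_refl] shape_series_power_remove_corner(2)[OF n D b, of k a]]
  unfolding power_coeff_def real_norm_def fps_sub_nth fps_mult_left_const_nth .

text \<open>Lagrange inversion: this is what makes the exponent \<open>2 k - 1\<close> special.\<close>

lemma lagrange_coeff_eq_0: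
  fixes f :: "'a :: field_char_0 fps"
  assumes k: "k \<ge> 1"
  shows "fps_nth ((2 * (fps_X * fps_deriv f) - f) * f ^ (2 * k - 1)) k = 0"
proof -
  have power: "f * f ^ (2 * k - 1) = f ^ (2 * k)" using k by (simp flip: power_Suc)
  have "fps_X * fps_deriv (f ^ (2 * k)) = fps_const (of_nat k) * (2 * (fps_X * fps_deriv f) * f ^ (2 * k - 1))"
    unfolding fps_deriv_power by (simp add: mult_ac numeral_fps_const)
  then have "fps_nth (fps_X * fps_deriv (f ^ (2 * k))) k =
      of_nat k * fps_nth (2 * (fps_X * fps_deriv f) * f ^ (2 * k - 1)) k"
    by (simp only: fps_mult_left_const_nth)
  moreover have "fps_nth (fps_X * fps_deriv (f ^ (2 * k))) k = of_nat k * fps_nth (f ^ (2 * k)) k"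
    using k by simp
  ultimately show ?thesis using k unfolding left_diff_distrib fps_sub_nth power by simp
qed

lemma mean_box_series:
  assumes D: "shifted_shape D" "D \<noteq> {}" and \<nu>: "\<nu> > 0"
  defines "f \<equiv> shape_series \<nu> D"
  shows "(\<Sum>b\<in>corners D. fps_const (corner_prob D b) * box_series (box_weight \<nu> (box_content b))) =
    fps_const (- (\<nu> / real (card D))) * (1 + (2 * (fps_X * fps_deriv f) - f))"
proof (rule fps_ext)
  fix i
  show "fps_nth (\<Sum>b\<in>corners D. fps_const (corner_prob D b) * box_series (box_weight \<nu> (box_content b))) i =
    fps_nth (fps_const (- (\<nu> / real (card D))) * (1 + (2 * (fps_X * fps_deriv f) - f))) i"
  proof (cases i)
    case 0
    then show ?thesis by (simp add: fps_sum_nth box_series_def f_def shape_series_nth_0)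
  next
    case (Suc j)
    have "fps_nth (\<Sum>b\<in>corners D. fps_const (corner_prob D b) * box_series (box_weight \<nu> (box_content b))) i =
        (4 * real i - 2) * (\<Sum>b\<in>corners D. corner_prob D b * box_weight \<nu> (box_content b) ^ j)"
      using Suc by (simp add: fps_sum_nth box_series_def sum_distrib_left mult_ac)
    also have "\<dots> = - (\<nu> / real (card D)) * ((2 * real i - 1) * fps_nth f i)"
      using corner_prob_moment[OF D, of \<nu> j] \<nu> Suc
      by (simp add: f_def algebra_simps add_divide_distrib)
    also have "\<dots> = fps_nth (fps_const (- (\<nu> / real (card D))) * (1 + (2 * (fps_X * fps_deriv f) - f))) i"
      using Suc by (simp add: algebra_simps numeral_fps_const)
    finally show ?thesis .
  qed
qed

lemma mean_box_series_odd_power: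
  assumes D: "shifted_shape D" "D \<noteq> {}" and \<nu>: "\<nu> > 0" and k: "k \<ge> 1"
  shows "(\<Sum>b\<in>corners D. corner_prob D b *
      fps_nth (box_series (box_weight \<nu> (box_content b)) * shape_series \<nu> D ^ (2 * k - 1)) k) =
    - (\<nu> / real (card D)) * power_coeff (2 * k - 1) k \<nu> D"
proof -
  let ?f = "shape_series \<nu> D"
  have "(\<Sum>b\<in>corners D. corner_prob D b * fps_nth (box_series (box_weight \<nu> (box_content b)) * ?f ^ (2 * k - 1)) k) =
      fps_nth ((\<Sum>b\<in>corners D. fps_const (corner_prob D b) * box_series (box_weight \<nu> (box_content b)))
        * ?f ^ (2 * k - 1)) k"
    by (simp add: sum_distrib_right fps_sum_nth mult.assoc)
  also have "\<dots> = - (\<nu> / real (card D)) * power_coeff (2 * k - 1) k \<nu> D"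
    unfolding mean_box_series[OF D \<nu>] mult.assoc fps_mult_left_const_nth
    unfolding distrib_right fps_add_nth lagrange_coeff_eq_0[OF k] by (simp add: power_coeff_def)
  finally show ?thesis .
qed

lemma abs_mean_power_coeff_change_le:
  assumes n: "n \<ge> 1" and D: "balanced C n D" "D \<noteq> {}" and k: "k \<ge> 1"
  defines "X \<equiv> power_coeff (2 * k - 1) k (2 * n)"
  shows "\<bar>(\<Sum>b\<in>corners D. corner_prob D b * (X (D - {b}) - X D)) + real (2 * k - 1) / real (card D) * X D\<bar>
    \<le> removal_error C (2 * k - 1) k / n\<^sup>2"
proof -
  let ?a = "2 * k - 1" and ?\<epsilon> = "removal_error C (2 * k - 1) k / n\<^sup>2"
  let ?l = "\<lambda>b. real ?a / (2 * n) *
    fps_nth (box_series (box_weight (2 * n) (box_content b)) * shape_series (2 * n) D ^ ?a) k"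
  have shape: "shifted_shape D" using D by (simp add: balanced_def)
  have "(\<Sum>b\<in>corners D. corner_prob D b * ?l b) = real ?a / (2 * n) * (\<Sum>b\<in>corners D. corner_prob D b *
      fps_nth (box_series (box_weight (2 * n) (box_content b)) * shape_series (2 * n) D ^ ?a) k)"
    by (simp only: sum_distrib_left mult.left_commute)
  also have "\<dots> = - (real ?a / real (card D) * X D)"
    using mean_box_series_odd_power[OF shape D(2) _ k, of "2 * n"] n by (simp add: X_def)
  finally have linear: "(\<Sum>b\<in>corners D. corner_prob D b * ?l b) = - (real ?a / real (card D) * X D)" .
  have "(\<Sum>b\<in>corners D. corner_prob D b * (X (D - {b}) - X D)) + real ?a / real (card D) * X D =
      (\<Sum>b\<in>corners D. corner_prob D b * (X (D - {b}) - X D - ?l b))"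
    by (simp only: right_diff_distrib[of _ _ "?l _"] sum_subtractf linear diff_minus_eq_add)
  also have "\<bar>\<dots>\<bar> \<le> (\<Sum>b\<in>corners D. corner_prob D b * ?\<epsilon>)"
  proof (intro order_trans[OF sum_abs] sum_mono)
    fix b assume "b \<in> corners D"
    from power_coeff_remove_corner(2)[OF n D(1) this, of ?a k]
    show "\<bar>corner_prob D b * (X (D - {b}) - X D - ?l b)\<bar> \<le> corner_prob D b * ?\<epsilon>"
      unfolding abs_mult X_def abs_of_nonneg[OF removal_prob_nonneg]
      by (intro mult_left_mono removal_prob_nonneg)
  qed
  also have "\<dots> = ?\<epsilon>" using sum_corner_prob[OF shape D(2)] by (simp only: sum_distrib_right[symmetric] mult_1_left)
  finally show ?thesis .
qed

lemma norm_power_diff_first_order: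
  fixes x y :: "'a :: real_normed_field"
  assumes "norm x \<le> 1" "norm y \<le> 1"
  shows "norm (x ^ a - y ^ a - of_nat a * x ^ (a - 1) * (x - y)) \<le> (real a)\<^sup>2 * (norm (x - y))\<^sup>2"
proof -
  have "(\<Sum>i<a. x ^ i * x ^ (a - Suc i)) = (\<Sum>i<a. x ^ (a - 1))"
    by (rule sum.cong) (auto simp flip: power_add)
  then have derivative: "of_nat a * x ^ (a - 1) = (\<Sum>i<a. x ^ i * x ^ (a - Suc i))" by simp
  have "x ^ a - y ^ a - of_nat a * x ^ (a - 1) * (x - y) =
      (x - y) * (\<Sum>i<a. x ^ i * (y ^ (a - Suc i) - x ^ (a - Suc i)))"
    unfolding derivative power_diff_sumr2[of x a y] by (simp add: algebra_simps sum_subtractf)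
  also have "norm \<dots> \<le> norm (x - y) * (\<Sum>i<a. real a * norm (x - y))"
    unfolding norm_mult
  proof (intro mult_left_mono norm_ge_zero order_trans[OF norm_sum] sum_mono)
    fix i assume "i \<in> {..<a}"
    have "norm (y ^ (a - Suc i) - x ^ (a - Suc i)) \<le> real (a - Suc i) * norm (x - y)"
      using norm_power_diff[OF assms(2,1)] by (simp add: norm_minus_commute)
    also have "\<dots> \<le> real a * norm (x - y)" by (intro mult_right_mono) auto
    finally have "norm (y ^ (a - Suc i) - x ^ (a - Suc i)) \<le> real a * norm (x - y)" .
    moreover have "norm x ^ i \<le> 1" using assms by (simp add: power_le_one)
    ultimately show "norm (x ^ i * (y ^ (a - Suc i) - x ^ (a - Suc i))) \<le> real a * norm (x - y)"
      unfolding norm_mult norm_power by (intro order_trans[OF mult_left_le_one_le]) auto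
  qed
  also have "\<dots> = (real a)\<^sup>2 * (norm (x - y))\<^sup>2" by (simp add: power2_eq_square)
  finally show ?thesis .
qed

lemma power_ratio_step:
  fixes a m :: nat and n :: real
  assumes m: "m \<ge> 1" "real m \<le> n"
  shows "\<bar>(real (m - 1) / n) ^ a - (real m / n) ^ a\<bar> \<le> real a / n"
    and "\<bar>(real (m - 1) / n) ^ a - (real m / n) ^ a + real a / real m * (real m / n) ^ a\<bar> \<le> (real a)\<^sup>2 / n\<^sup>2"
proof -
  let ?x = "real m / n" and ?y = "real (m - 1) / n"
  have n: "n > 0" and "real (m - 1) \<le> n" using m by linarith+
  then have unit: "norm ?x \<le> 1" "norm ?y \<le> 1" using m by simp_all
  have diff: "?x - ?y = 1 / n" using m by (simp add: diff_divide_distrib)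
  show "\<bar>?y ^ a - ?x ^ a\<bar> \<le> real a / n"
    using norm_power_diff[OF unit(2,1), of a] diff n by (simp add: abs_minus_commute)
  have "real a * ?x ^ (a - 1) * (1 / n) = real a / real m * ?x ^ a"
    using m n by (cases a) auto
  then have "\<bar>?x ^ a - ?y ^ a - real a / real m * ?x ^ a\<bar> \<le> (real a)\<^sup>2 / n\<^sup>2"
    using norm_power_diff_first_order[OF unit, of a] unfolding diff by (simp add: power_divide)
  then show "\<bar>?y ^ a - ?x ^ a + real a / real m * ?x ^ a\<bar> \<le> (real a)\<^sup>2 / n\<^sup>2"
    by linarith
qed

lemma second_moment_of_mean_reverting_step:
  fixes w d :: "'b \<Rightarrow> real"
  assumes w: "\<And>b. b \<in> A \<Longrightarrow> 0 \<le> w b" "sum w A = 1"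
    and mean: "\<bar>(\<Sum>b\<in>A. w b * d b) + c * \<delta>\<bar> \<le> \<epsilon>" "0 \<le> c"
    and d: "\<And>b. b \<in> A \<Longrightarrow> \<bar>d b\<bar> \<le> \<eta>"
  shows "(\<Sum>b\<in>A. w b * (\<delta> + d b)\<^sup>2) \<le> \<delta>\<^sup>2 + 2 * \<bar>\<delta>\<bar> * \<epsilon> + \<eta>\<^sup>2"
proof -
  let ?S = "\<Sum>b\<in>A. w b * d b"
  have "\<delta> * ?S = \<delta> * (?S + c * \<delta>) - c * \<delta>\<^sup>2" by (simp add: algebra_simps power2_eq_square)
  also have "\<dots> \<le> \<bar>\<delta>\<bar> * \<bar>?S + c * \<delta>\<bar> - 0"
    using mean(2) by (intro diff_mono) (simp_all flip: abs_mult)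
  also have "\<dots> \<le> \<bar>\<delta>\<bar> * \<epsilon>" using mean(1) by (simp add: mult_left_mono)
  finally have cross: "\<delta> * ?S \<le> \<bar>\<delta>\<bar> * \<epsilon>" .
  have "(\<Sum>b\<in>A. w b * (d b)\<^sup>2) \<le> (\<Sum>b\<in>A. w b * \<eta>\<^sup>2)"
  proof (intro sum_mono mult_left_mono w(1))
    fix b assume "b \<in> A"
    then show "(d b)\<^sup>2 \<le> \<eta>\<^sup>2" using d[of b] by (metis abs_ge_zero power2_abs power_mono)
  qed
  also have "\<dots> = \<eta>\<^sup>2" using w(2) by (simp flip: sum_distrib_right)
  finally have square: "(\<Sum>b\<in>A. w b * (d b)\<^sup>2) \<le> \<eta>\<^sup>2" .
  have "(\<Sum>b\<in>A. w b * (\<delta> + d b)\<^sup>2) = sum w A * \<delta>\<^sup>2 + 2 * (\<delta> * ?S) + (\<Sum>b\<in>A. w b * (d b)\<^sup>2)"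
    by (simp add: power2_eq_square algebra_simps sum.distrib sum_distrib_left sum_distrib_right)
  then show ?thesis using w(2) cross square by simp
qed

definition compensated_coeff :: "nat \<Rightarrow> real \<Rightarrow> real \<Rightarrow> (nat \<times> nat) set \<Rightarrow> real" where
  "compensated_coeff k n \<rho> D =
     power_coeff (2 * k - 1) k (2 * n) D - (real (card D) / n) ^ (2 * k - 1) * \<rho>"

lemma compensated_coeff_remove_corner:
  fixes D :: "(nat \<times> nat) set" and k :: nat
  defines "a \<equiv> 2 * k - 1"
  assumes n: "n \<ge> 1" and D: "balanced C n D" and b: "b \<in> corners D" and \<rho>: "\<bar>\<rho>\<bar> \<le> p"
  shows "\<bar>compensated_coeff k n \<rho> (D - {b}) - compensated_coeff k n \<rho> D\<bar> \<le> (removal_error C a k + real a * p) / n"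
proof -
  let ?r = "(real (card D - 1) / n) ^ a" and ?s = "(real (card D) / n) ^ a"
  have fin: "finite D" and le: "real (card D) \<le> n" using D finite_shifted_shape by (auto simp: balanced_def)
  have card: "card D = Suc (card (D - {b}))" by (rule card_remove_maximal_element[OF fin b])
  have "\<bar>(?r - ?s) * \<rho>\<bar> \<le> real a / n * p"
    unfolding abs_mult using power_ratio_step(1)[of "card D" n a] card le \<rho> n by (intro mult_mono) auto
  moreover have "compensated_coeff k n \<rho> (D - {b}) - compensated_coeff k n \<rho> D =
      (power_coeff a k (2 * n) (D - {b}) - power_coeff a k (2 * n) D) - (?r - ?s) * \<rho>"
    using card by (simp add: compensated_coeff_def a_def left_diff_distrib)
  ultimately show ?thesis
    using power_coeff_remove_corner(1)[OF n D b, of a k] by (simp add: add_divide_distrib)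
qed

lemma abs_mean_compensated_coeff_change_le:
  fixes D :: "(nat \<times> nat) set" and k :: nat and n \<rho> :: real
  defines "a \<equiv> 2 * k - 1" and "V \<equiv> compensated_coeff k n \<rho>"
  assumes n: "n \<ge> 1" and D: "balanced C n D" "D \<noteq> {}" and k: "k \<ge> 1" and \<rho>: "\<bar>\<rho>\<bar> \<le> p"
  shows "\<bar>(\<Sum>b\<in>corners D. corner_prob D b * (V (D - {b}) - V D)) + real a / real (card D) * V D\<bar>
    \<le> (removal_error C a k + (real a)\<^sup>2 * p) / n\<^sup>2"
proof -
  let ?r = "(real (card D - 1) / n) ^ a" and ?s = "(real (card D) / n) ^ a"
  let ?w = "corner_prob D" and ?X = "power_coeff a k (2 * n)" and ?c = "real a / real (card D)"
  have shape: "shifted_shape D" and m: "card D \<ge> 1" "real (card D) \<le> n"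
    using D finite_shifted_shape by (auto simp: balanced_def Suc_le_eq card_gt_0_iff)
  have "V (D - {b}) - V D = (?X (D - {b}) - ?X D) - (?r - ?s) * \<rho>" if "b \<in> corners D" for b
    using card_remove_maximal_element[OF finite_shifted_shape[OF shape] that]
    by (simp add: V_def compensated_coeff_def a_def left_diff_distrib)
  then have "(\<Sum>b\<in>corners D. ?w b * (V (D - {b}) - V D)) =
      (\<Sum>b\<in>corners D. ?w b * (?X (D - {b}) - ?X D) - ?w b * ((?r - ?s) * \<rho>))"
    by (intro sum.cong refl) (simp only: right_diff_distrib)
  also have "\<dots> = (\<Sum>b\<in>corners D. ?w b * (?X (D - {b}) - ?X D)) - (?r - ?s) * \<rho>"
    by (simp only: sum_subtractf sum_distrib_right[symmetric] sum_corner_prob[OF shape D(2)] mult_1_left)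
  finally have "(\<Sum>b\<in>corners D. ?w b * (V (D - {b}) - V D)) + ?c * V D =
      ((\<Sum>b\<in>corners D. ?w b * (?X (D - {b}) - ?X D)) + ?c * ?X D) - (?r - ?s + ?c * ?s) * \<rho>"
    by (simp add: V_def compensated_coeff_def a_def algebra_simps)
  also have "\<bar>\<dots>\<bar> \<le> removal_error C a k / n\<^sup>2 + (real a)\<^sup>2 / n\<^sup>2 * p"
  proof (intro order_trans[OF abs_triangle_ineq4] add_mono)
    show "\<bar>(\<Sum>b\<in>corners D. ?w b * (?X (D - {b}) - ?X D)) + ?c * ?X D\<bar> \<le> removal_error C a k / n\<^sup>2"
      unfolding a_def by (rule abs_mean_power_coeff_change_le[OF n D k])
    show "\<bar>(?r - ?s + ?c * ?s) * \<rho>\<bar> \<le> (real a)\<^sup>2 / n\<^sup>2 * p"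
      unfolding abs_mult using power_ratio_step(2)[OF m, of a] \<rho> by (intro mult_mono) auto
  qed
  finally show ?thesis by (simp add: add_divide_distrib)
qed

definition second_moment_error :: "real \<Rightarrow> nat \<Rightarrow> real" where
  "second_moment_error C k = (let a = 2 * k - 1; p = shape_series_bound C k ^ a; B = removal_error C a k
     in 4 * p * (B + (real a)\<^sup>2 * p) + (B + real a * p)\<^sup>2)"

lemma second_moment_error_nonneg: "0 \<le> second_moment_error C k"
  by (simp add: second_moment_error_def Let_def removal_error_nonneg shape_series_bound_nonneg)

lemma compensated_coeff_second_moment:
  fixes D :: "(nat \<times> nat) set" and k :: nat and C n \<rho> :: real
  defines "p \<equiv> shape_series_bound C k ^ (2 * k - 1)" and "V \<equiv> compensated_coeff k n \<rho>"
  assumes n: "n \<ge> 1" and D: "balanced C n D" "D \<noteq> {}" and k: "k \<ge> 1" and \<rho>: "\<bar>\<rho>\<bar> \<le> p"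
  shows "(\<Sum>b\<in>corners D. corner_prob D b * (V (D - {b}))\<^sup>2) \<le> (V D)\<^sup>2 + second_moment_error C k / n\<^sup>2"
proof -
  let ?a = "2 * k - 1" and ?B = "removal_error C (2 * k - 1) k"
  have shape: "shifted_shape D" and "real (card D) / n \<le> 1" using D n by (auto simp: balanced_def)
  have p: "0 \<le> p" by (simp add: p_def shape_series_bound_nonneg)
  have "\<bar>(real (card D) / n) ^ ?a * \<rho>\<bar> \<le> 1 * p"
    unfolding abs_mult using p \<rho> \<open>real (card D) / n \<le> 1\<close> n
    by (intro mult_mono) (auto simp: power_abs power_le_one)
  moreover have "\<bar>power_coeff ?a k (2 * n) D\<bar> \<le> p"
    unfolding p_def using abs_power_coeff_le[OF D(1)] n by simp
  ultimately have V_le: "\<bar>V D\<bar> \<le> 2 * p" unfolding V_def compensated_coeff_def by linarith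
  have "(\<Sum>b\<in>corners D. corner_prob D b * (V (D - {b}))\<^sup>2) =
      (\<Sum>b\<in>corners D. corner_prob D b * (V D + (V (D - {b}) - V D))\<^sup>2)"
    by simp
  also have "\<dots> \<le> (V D)\<^sup>2 + 2 * \<bar>V D\<bar> * ((?B + (real ?a)\<^sup>2 * p) / n\<^sup>2) + ((?B + real ?a * p) / n)\<^sup>2"
  proof (rule second_moment_of_mean_reverting_step[OF removal_prob_nonneg sum_corner_prob[OF shape D(2)]])
    show "\<bar>(\<Sum>b\<in>corners D. corner_prob D b * (V (D - {b}) - V D)) + real ?a / real (card D) * V D\<bar>
      \<le> (?B + (real ?a)\<^sup>2 * p) / n\<^sup>2"
      unfolding V_def by (rule abs_mean_compensated_coeff_change_le[OF n D k \<rho>])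
    show "\<bar>V (D - {b}) - V D\<bar> \<le> (?B + real ?a * p) / n" if "b \<in> corners D" for b
      unfolding V_def by (rule compensated_coeff_remove_corner[OF n D(1) that \<rho>])
  qed simp
  also have "\<dots> \<le> (V D)\<^sup>2 + 2 * (2 * p) * ((?B + (real ?a)\<^sup>2 * p) / n\<^sup>2) + ((?B + real ?a * p) / n)\<^sup>2"
    using V_le p by (intro add_mono mult_mono) (auto simp: removal_error_nonneg)
  also have "\<dots> = (V D)\<^sup>2 + second_moment_error C k / n\<^sup>2"
    unfolding second_moment_error_def Let_def p_def power_divide by (simp add: distrib_left add_divide_distrib)
  finally show ?thesis .
qed

lemma power_coeff_concentration:
  fixes D :: "(nat \<times> nat) set" and k :: nat
  defines "n \<equiv> real (card D)" and "a \<equiv> 2 * k - 1"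
  assumes D: "balanced C n D" "D \<noteq> {}" and k: "k \<ge> 1" and m: "m \<le> card D"
  shows "sublevel_mean box_less D m (\<lambda>E. (power_coeff a k (2 * n) E -
      (real m / n) ^ a * power_coeff a k (2 * n) D)\<^sup>2) \<le> second_moment_error C k / n"
proof -
  let ?\<rho> = "power_coeff a k (2 * n) D" and ?\<epsilon> = "second_moment_error C k / n\<^sup>2"
  let ?V = "compensated_coeff k n ?\<rho>"
  have shape: "shifted_shape D" using D by (simp add: balanced_def)
  have n: "n \<ge> 1" using D(2) finite_shifted_shape[OF shape] by (simp add: n_def Suc_le_eq card_gt_0_iff)
  have \<rho>: "\<bar>?\<rho>\<bar> \<le> shape_series_bound C k ^ (2 * k - 1)"
    unfolding a_def using abs_power_coeff_le[OF D(1)] n by simp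
  have "sublevel_mean box_less D m (\<lambda>E. (power_coeff a k (2 * n) E - (real m / n) ^ a * ?\<rho>)\<^sup>2) =
      sublevel_mean box_less D m (\<lambda>E. (?V E)\<^sup>2)"
    unfolding sublevel_mean_eq_sum[OF finite_shifted_shape[OF shape] standard_tableaux_nonempty[OF shape]]
    by (intro arg_cong[where f = "\<lambda>s. s / _"] sum.cong)
       (simp_all add: compensated_coeff_def a_def card_sublevel[OF _ m])
  also have "\<dots> \<le> (?V D)\<^sup>2 + real (card D - m) * ?\<epsilon>"
  proof (rule sublevel_mean_le_of_removal_drift[where Q = "balanced C n"])
    show "(\<Sum>b\<in>corners E. corner_prob E b * (?V (E - {b}))\<^sup>2) \<le> (?V E)\<^sup>2 + ?\<epsilon>"
      if "balanced C n E" "E \<noteq> {}" for E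
      by (rule compensated_coeff_second_moment[OF n that k \<rho>])
    show "finite E \<and> standard_tableaux E \<noteq> {}" if "balanced C n E" for E
      using that finite_shifted_shape standard_tableaux_nonempty by (simp add: balanced_def)
  qed (use D m balanced_remove_corner in auto)
  also have "(?V D)\<^sup>2 = 0" using n by (simp add: compensated_coeff_def n_def a_def)
  also have "0 + real (card D - m) * ?\<epsilon> \<le> n * ?\<epsilon>"
    unfolding add_0 using second_moment_error_nonneg[of C k] by (intro mult_right_mono) (simp_all add: n_def)
  also have "\<dots> = second_moment_error C k / n" using n by (simp add: power2_eq_square)
  finally show ?thesis .
qed

section \<open>Logarithmic derivatives\<close>

definition fps_log_deriv :: "'a :: field fps \<Rightarrow> 'a fps" where
  "fps_log_deriv f = fps_X * fps_deriv f * inverse f"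

lemma fps_log_deriv_nth_0: "fps_nth (fps_log_deriv f) 0 = 0"
  by (simp add: fps_log_deriv_def)

lemma mult_fps_log_deriv:
  assumes "fps_nth f 0 \<noteq> 0"
  shows "f * fps_log_deriv f = fps_X * fps_deriv f"
  unfolding fps_log_deriv_def
  using inverse_mult_eq_1[OF assms] by (metis mult.assoc mult.commute mult_1_left)

lemma fps_log_deriv_mult:
  assumes "fps_nth f 0 \<noteq> 0" "fps_nth g 0 \<noteq> 0"
  shows "fps_log_deriv (f * g) = fps_log_deriv f + fps_log_deriv g"
proof -
  have "f * g * fps_log_deriv (f * g) = f * g * (fps_log_deriv f + fps_log_deriv g)"
    using assms mult_fps_log_deriv[of "f * g"] mult_fps_log_deriv[of f] mult_fps_log_deriv[of g]
    by (simp add: algebra_simps)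
  moreover have "f * g \<noteq> 0" using assms by auto
  ultimately show ?thesis by (metis mult_left_cancel)
qed

lemma fps_log_deriv_prod:
  assumes "\<And>b. b \<in> A \<Longrightarrow> fps_nth (f b) 0 = 1"
  shows "fps_log_deriv (\<Prod>b\<in>A. f b) = (\<Sum>b\<in>A. fps_log_deriv (f b)) \<and> fps_nth (\<Prod>b\<in>A. f b) 0 = 1"
  using assms
  by (induction A rule: infinite_finite_induct)
     (simp_all add: fps_log_deriv_mult fps_log_deriv_def[of 1])

lemma fps_log_deriv_recurrence:
  assumes "fps_nth f 0 = 1"
  shows "of_nat j * fps_nth f j = (\<Sum>i=1..j. fps_nth (fps_log_deriv f) i * fps_nth f (j - i))"
proof -
  have "of_nat j * fps_nth f j = fps_nth (fps_X * fps_deriv f) j" by (cases j) auto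
  also have "\<dots> = fps_nth (fps_log_deriv f * f) j"
    using mult_fps_log_deriv[of f] assms by (simp add: mult.commute)
  also have "\<dots> = (\<Sum>i=1..j. fps_nth (fps_log_deriv f) i * fps_nth f (j - i))"
    by (simp add: fps_mult_nth sum.atLeast_Suc_atMost fps_log_deriv_nth_0)
  finally show ?thesis .
qed

lemma fps_seminorm_mono: "j \<le> K \<Longrightarrow> fps_seminorm j f \<le> fps_seminorm K f"
  unfolding fps_seminorm_def by (rule sum_mono2) auto

lemma fps_seminorm_X_mult: "fps_seminorm (Suc K) (fps_X * f) = fps_seminorm K f"
  by (simp add: fps_seminorm_def sum.atMost_Suc_shift del: sum.atMost_Suc)

lemma fps_seminorm_mult_le_Suc:
  assumes "fps_nth x 0 = 0"
  shows "fps_seminorm (Suc K) (x * f) \<le> fps_seminorm (Suc K) x * fps_seminorm K f"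
proof -
  have "x = fps_X * fps_shift 1 x" using assms by (intro fps_ext) simp
  then show ?thesis by (metis fps_seminorm_X_mult fps_seminorm_mult_le mult.assoc)
qed

lemma fps_seminorm_inverse_one_minus_le:
  fixes x :: "'a :: real_normed_field fps"
  assumes x: "fps_nth x 0 = 0" and j: "j \<le> K"
  shows "fps_seminorm j (inverse (1 - x)) \<le> (1 + fps_seminorm K x) ^ j"
  using j
proof (induction j)
  case 0
  then show ?case using x by (simp add: fps_seminorm_def)
next
  case (Suc j)
  let ?t = "fps_seminorm K x" and ?g = "inverse (1 - x)"
  have t: "0 \<le> ?t" by (rule fps_seminorm_nonneg)
  have "?g * (1 - x) = 1" using x by (intro inverse_mult_eq_1) simp
  then have "?g = 1 + x * ?g" by (simp add: algebra_simps)
  then have "fps_seminorm (Suc j) ?g \<le> 1 + fps_seminorm (Suc j) (x * ?g)"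
    by (metis fps_seminorm_1 fps_seminorm_add_le)
  also have "fps_seminorm (Suc j) (x * ?g) \<le> ?t * (1 + ?t) ^ j"
    using Suc t fps_seminorm_mono[of "Suc j" K x] fps_seminorm_nonneg
    by (intro order_trans[OF fps_seminorm_mult_le_Suc[OF x]] mult_mono) auto
  also have "1 + ?t * (1 + ?t) ^ j \<le> (1 + ?t) ^ j + ?t * (1 + ?t) ^ j"
    using t by (intro add_right_mono one_le_power) simp
  also have "\<dots> = (1 + ?t) ^ Suc j" by (simp add: algebra_simps)
  finally show ?case by simp
qed

lemma fps_seminorm_X_deriv_le:
  fixes f :: "'a :: real_normed_field fps"
  shows "fps_seminorm K (fps_X * fps_deriv f) \<le> real K * fps_seminorm K f"
  unfolding fps_seminorm_def sum_distrib_left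
proof (rule sum_mono)
  fix j assume "j \<in> {..K}"
  moreover have "fps_nth (fps_X * fps_deriv f) j = of_nat j * fps_nth f j" by (cases j) auto
  ultimately show "norm (fps_nth (fps_X * fps_deriv f) j) \<le> real K * norm (fps_nth f j)"
    by (simp add: norm_mult mult_right_mono)
qed

lemma fps_seminorm_log_deriv_one_minus_le:
  fixes x :: "'a :: real_normed_field fps"
  assumes x: "fps_nth x 0 = 0" "fps_seminorm K x \<le> t"
  shows "fps_seminorm K (fps_log_deriv (1 - x) + fps_X * fps_deriv x) \<le> real K * (1 + t) ^ K * t\<^sup>2"
proof -
  let ?g = "inverse (1 - x)"
  have "?g * (1 - x) = 1" using x(1) by (intro inverse_mult_eq_1) simp
  then have g: "?g = 1 + x * ?g" by (simp add: algebra_simps)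
  have "fps_log_deriv (1 - x) + fps_X * fps_deriv x = fps_X * fps_deriv x * (1 - ?g)"
    by (simp add: fps_log_deriv_def algebra_simps)
  also have "\<dots> = fps_const (-1) * (fps_X * fps_deriv x * (x * ?g))"
    by (subst g) (simp add: algebra_simps flip: fps_const_neg)
  finally have "fps_seminorm K (fps_log_deriv (1 - x) + fps_X * fps_deriv x) =
      fps_seminorm K (fps_X * fps_deriv x * (x * ?g))" by (simp only: fps_seminorm_cmult) simp
  also have "\<dots> \<le> (real K * t) * (t * (1 + t) ^ K)"
  proof (rule order_trans[OF fps_seminorm_mult_le], intro mult_mono)
    show "fps_seminorm K (fps_X * fps_deriv x) \<le> real K * t"
      using x(2) by (intro order_trans[OF fps_seminorm_X_deriv_le] mult_left_mono) auto
    have "fps_seminorm K ?g \<le> (1 + t) ^ K"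
      using x fps_seminorm_nonneg[of K x]
      by (intro order_trans[OF fps_seminorm_inverse_one_minus_le[OF x(1) order_refl]] power_mono) auto
    then show "fps_seminorm K (x * ?g) \<le> t * (1 + t) ^ K"
      using x(2) fps_seminorm_nonneg[of K x] fps_seminorm_nonneg[of K ?g]
      by (intro order_trans[OF fps_seminorm_mult_le] mult_mono) auto
  qed (simp_all add: fps_seminorm_nonneg order_trans[OF fps_seminorm_nonneg x(2)])
  also have "\<dots> = real K * (1 + t) ^ K * t\<^sup>2" by (simp add: power2_eq_square)
  finally show ?thesis .
qed

definition log_deriv_error :: "real \<Rightarrow> nat \<Rightarrow> real" where
  "log_deriv_error M i = (let E = fps_seminorm i (box_series M) in real i * (1 + E) ^ i * E\<^sup>2)"

lemma log_deriv_error_nonneg: "0 \<le> log_deriv_error M i"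
  by (simp add: log_deriv_error_def Let_def fps_seminorm_nonneg)

lemma log_deriv_box_factor_approx:
  assumes \<nu>: "\<nu> \<ge> 1" and w: "box_weight \<nu> c \<le> M"
  shows "\<bar>fps_nth (fps_log_deriv (box_factor \<nu> c)) i + real i / \<nu> * fps_nth (box_series (box_weight \<nu> c)) i\<bar>
    \<le> log_deriv_error M i / \<nu>\<^sup>2"
proof -
  define x where "x = fps_const (1 / \<nu>) * box_series (box_weight \<nu> c)"
  define E where "E = fps_seminorm i (box_series M)"
  have E: "0 \<le> E" by (simp add: E_def fps_seminorm_nonneg)
  have x: "fps_seminorm i x \<le> 1 / \<nu> * E"
    unfolding x_def E_def using w \<nu> by (intro fps_seminorm_box_series_le) auto
  have x0: "fps_nth x 0 = 0" by (simp add: x_def box_series_def)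
  have "1 / \<nu> * E \<le> E" using \<nu> E by (simp add: divide_le_eq mult_le_cancel_left1)
  have "fps_nth (fps_X * fps_deriv x) i = real i / \<nu> * fps_nth (box_series (box_weight \<nu> c)) i"
    by (cases i) (simp_all add: x_def)
  then have "\<bar>fps_nth (fps_log_deriv (box_factor \<nu> c)) i + real i / \<nu> * fps_nth (box_series (box_weight \<nu> c)) i\<bar> \<le>
      fps_seminorm i (fps_log_deriv (1 - x) + fps_X * fps_deriv x)"
    using norm_fps_nth_le[of i i "fps_log_deriv (1 - x) + fps_X * fps_deriv x"]
    by (simp add: box_factor_def x_def)
  also have "\<dots> \<le> real i * (1 + 1 / \<nu> * E) ^ i * (1 / \<nu> * E)\<^sup>2"
    by (rule fps_seminorm_log_deriv_one_minus_le[OF x0 x])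
  also have "\<dots> \<le> real i * (1 + E) ^ i * (1 / \<nu> * E)\<^sup>2"
    using \<open>1 / \<nu> * E \<le> E\<close> E \<nu> by (intro mult_right_mono mult_left_mono power_mono) auto
  also have "\<dots> = log_deriv_error M i / \<nu>\<^sup>2"
    by (simp add: log_deriv_error_def E_def Let_def power_divide)
  finally show ?thesis .
qed

definition box_moment :: "real \<Rightarrow> nat \<Rightarrow> (nat \<times> nat) set \<Rightarrow> real" where
  "box_moment \<nu> j D = (\<Sum>b\<in>D. box_weight \<nu> (box_content b) ^ j) / \<nu>"

lemma log_deriv_shape_series_approx:
  assumes D: "balanced C n D" and n: "n \<ge> 1"
  shows "\<bar>fps_nth (fps_log_deriv (shape_series (2 * n) D)) (Suc j) +
      real (Suc j) * (4 * real (Suc j) - 2) * box_moment (2 * n) j D\<bar> \<le> log_deriv_error (C\<^sup>2 / 2) (Suc j) / n"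
proof -
  let ?s = "\<lambda>b. fps_nth (fps_log_deriv (box_factor (2 * n) (box_content b))) (Suc j)"
  let ?e = "\<lambda>b. real (Suc j) / (2 * n) * fps_nth (box_series (box_weight (2 * n) (box_content b))) (Suc j)"
  let ?B = "log_deriv_error (C\<^sup>2 / 2) (Suc j)"
  have "fps_log_deriv (shape_series (2 * n) D) = (\<Sum>b\<in>D. fps_log_deriv (box_factor (2 * n) (box_content b)))"
    unfolding shape_series_def by (intro fps_log_deriv_prod[THEN conjunct1] box_factor_nth_0)
  moreover have "real (Suc j) * (4 * real (Suc j) - 2) * box_moment (2 * n) j D = (\<Sum>b\<in>D. ?e b)"
    unfolding box_moment_def box_series_def fps_nth_Abs_fps sum_divide_distrib sum_distrib_left
    by (rule sum.cong) auto
  ultimately have "\<bar>fps_nth (fps_log_deriv (shape_series (2 * n) D)) (Suc j) +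
      real (Suc j) * (4 * real (Suc j) - 2) * box_moment (2 * n) j D\<bar> = \<bar>\<Sum>b\<in>D. ?s b + ?e b\<bar>"
    by (simp only: fps_sum_nth sum.distrib)
  also have "\<dots> \<le> (\<Sum>b\<in>D. ?B / (2 * n)\<^sup>2)"
    using n by (intro order_trans[OF sum_abs] sum_mono log_deriv_box_factor_approx balanced_box_weight_le[OF D]) auto
  also have "\<dots> = real (card D) * (?B / (2 * n)\<^sup>2)" by simp
  also have "\<dots> \<le> n * (?B / n\<^sup>2)"
    using D n log_deriv_error_nonneg[of "C\<^sup>2 / 2" "Suc j"]
    by (intro mult_mono divide_left_mono power_mono) (auto simp: balanced_def)
  also have "\<dots> = ?B / n" using n by (simp add: power2_eq_square)
  finally show ?thesis .
qed

section \<open>Convergence in mean\<close>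

locale finite_pmf_sequence =
  fixes P :: "nat \<Rightarrow> 'a pmf"
  assumes finite_set_pmf: "finite (set_pmf (P k))"
begin

abbreviation mean :: "nat \<Rightarrow> ('a \<Rightarrow> real) \<Rightarrow> real" where
  "mean k \<equiv> measure_pmf.expectation (P k)"

lemma integrable_finite_pmf [simp]: "integrable (measure_pmf (P k)) (f :: 'a \<Rightarrow> real)"
  by (rule integrable_measure_pmf_finite[OF finite_set_pmf])

lemma mean_mono: "(\<And>T. T \<in> set_pmf (P k) \<Longrightarrow> f T \<le> g T) \<Longrightarrow> mean k f \<le> mean k g"
  by (rule integral_mono_AE) (auto simp: AE_measure_pmf_iff)

definition converges_in_mean :: "(nat \<Rightarrow> 'a \<Rightarrow> real) \<Rightarrow> real \<Rightarrow> bool" where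
  "converges_in_mean Z x \<longleftrightarrow> (\<lambda>k. mean k (\<lambda>T. \<bar>Z k T - x\<bar>)) \<longlonglongrightarrow> 0"

definition convergent_in_mean :: "(nat \<Rightarrow> 'a \<Rightarrow> real) \<Rightarrow> bool" where
  "convergent_in_mean Z \<longleftrightarrow> (\<exists>x. converges_in_mean Z x)"

lemma converges_in_mean_bound:
  assumes "\<forall>\<^sub>F k in sequentially. mean k (\<lambda>T. \<bar>Z k T - x\<bar>) \<le> g k" "g \<longlonglongrightarrow> 0"
  shows "converges_in_mean Z x"
  unfolding converges_in_mean_def by (rule Lim_null_comparison[OF _ assms(2)]) (use assms(1) in simp)

lemma converges_in_mean_deterministic:
  assumes "z \<longlonglongrightarrow> x" shows "converges_in_mean (\<lambda>k T. z k) x"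
  using assms by (simp add: converges_in_mean_def LIM_zero tendsto_rabs_zero)

lemma converges_in_mean_close:
  assumes W: "converges_in_mean W x" and close: "(\<lambda>k. mean k (\<lambda>T. \<bar>Z k T - W k T\<bar>)) \<longlonglongrightarrow> 0"
  shows "converges_in_mean Z x"
proof (rule converges_in_mean_bound)
  have "mean k (\<lambda>T. \<bar>Z k T - x\<bar>) \<le> mean k (\<lambda>T. \<bar>W k T - x\<bar> + \<bar>Z k T - W k T\<bar>)" for k
    by (rule mean_mono) linarith
  then show "\<forall>\<^sub>F k in sequentially. mean k (\<lambda>T. \<bar>Z k T - x\<bar>) \<le>
     mean k (\<lambda>T. \<bar>W k T - x\<bar>) + mean k (\<lambda>T. \<bar>Z k T - W k T\<bar>)"
    by simp
  show "(\<lambda>k. mean k (\<lambda>T. \<bar>W k T - x\<bar>) + mean k (\<lambda>T. \<bar>Z k T - W k T\<bar>)) \<longlonglongrightarrow> 0"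
    using tendsto_add[OF W[unfolded converges_in_mean_def] close] by simp
qed

lemma converges_in_mean_close_uniform:
  assumes W: "converges_in_mean W x" and g: "g \<longlonglongrightarrow> 0"
    and close: "\<And>k T. T \<in> set_pmf (P k) \<Longrightarrow> \<bar>Z k T - W k T\<bar> \<le> g k"
  shows "converges_in_mean Z x"
proof (rule converges_in_mean_close[OF W Lim_null_comparison[OF _ g]])
  have "mean k (\<lambda>T. \<bar>Z k T - W k T\<bar>) \<le> mean k (\<lambda>_. g k)" for k
    by (rule mean_mono) (rule close)
  then show "\<forall>\<^sub>F k in sequentially. norm (mean k (\<lambda>T. \<bar>Z k T - W k T\<bar>)) \<le> g k" by simp
qed

lemma convergent_in_mean_iff_close:
  assumes g: "g \<longlonglongrightarrow> 0" and close: "\<And>k T. T \<in> set_pmf (P k) \<Longrightarrow> \<bar>Z k T - W k T\<bar> \<le> g k"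
  shows "convergent_in_mean Z \<longleftrightarrow> convergent_in_mean W"
proof -
  have close_sym: "\<bar>W k T - Z k T\<bar> \<le> g k" if "T \<in> set_pmf (P k)" for k T
    using close[OF that] by (simp add: abs_minus_commute)
  have "converges_in_mean Z x \<longleftrightarrow> converges_in_mean W x" for x
    using converges_in_mean_close_uniform[of W x g Z] converges_in_mean_close_uniform[of Z x g W] g close close_sym
    by blast
  then show ?thesis by (simp add: convergent_in_mean_def)
qed

lemma convergent_in_mean_cong:
  assumes "convergent_in_mean W" "\<And>k T. T \<in> set_pmf (P k) \<Longrightarrow> Z k T = W k T"
  shows "convergent_in_mean Z"
  using convergent_in_mean_iff_close[OF tendsto_const, of Z W] assms by simp

lemma converges_in_mean_add:
  assumes "converges_in_mean Z x" "converges_in_mean W y"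
  shows "converges_in_mean (\<lambda>k T. Z k T + W k T) (x + y)"
proof (rule converges_in_mean_bound)
  have "mean k (\<lambda>T. \<bar>Z k T + W k T - (x + y)\<bar>) \<le> mean k (\<lambda>T. \<bar>Z k T - x\<bar> + \<bar>W k T - y\<bar>)" for k
    by (rule mean_mono) linarith
  then show "\<forall>\<^sub>F k in sequentially. mean k (\<lambda>T. \<bar>Z k T + W k T - (x + y)\<bar>) \<le>
     mean k (\<lambda>T. \<bar>Z k T - x\<bar>) + mean k (\<lambda>T. \<bar>W k T - y\<bar>)"
    by simp
  show "(\<lambda>k. mean k (\<lambda>T. \<bar>Z k T - x\<bar>) + mean k (\<lambda>T. \<bar>W k T - y\<bar>)) \<longlonglongrightarrow> 0"
    using tendsto_add[OF assms[unfolded converges_in_mean_def]] by simp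
qed

lemma converges_in_mean_mult:
  assumes Z: "converges_in_mean Z x" and W: "converges_in_mean W y"
    and bounded: "\<And>k T. T \<in> set_pmf (P k) \<Longrightarrow> \<bar>W k T\<bar> \<le> B"
  shows "converges_in_mean (\<lambda>k T. Z k T * W k T) (x * y)"
proof (rule converges_in_mean_bound)
  have "mean k (\<lambda>T. \<bar>Z k T * W k T - x * y\<bar>) \<le> mean k (\<lambda>T. B * \<bar>Z k T - x\<bar> + \<bar>x\<bar> * \<bar>W k T - y\<bar>)" for k
  proof (rule mean_mono)
    fix T assume T: "T \<in> set_pmf (P k)"
    have "Z k T * W k T - x * y = W k T * (Z k T - x) + x * (W k T - y)" by (simp add: algebra_simps)
    then have "\<bar>Z k T * W k T - x * y\<bar> \<le> \<bar>W k T\<bar> * \<bar>Z k T - x\<bar> + \<bar>x\<bar> * \<bar>W k T - y\<bar>"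
      by (metis abs_mult abs_triangle_ineq)
    also have "\<dots> \<le> B * \<bar>Z k T - x\<bar> + \<bar>x\<bar> * \<bar>W k T - y\<bar>"
      using bounded[OF T] by (intro add_right_mono mult_right_mono) auto
    finally show "\<bar>Z k T * W k T - x * y\<bar> \<le> B * \<bar>Z k T - x\<bar> + \<bar>x\<bar> * \<bar>W k T - y\<bar>" .
  qed
  then show "\<forall>\<^sub>F k in sequentially. mean k (\<lambda>T. \<bar>Z k T * W k T - x * y\<bar>) \<le>
     B * mean k (\<lambda>T. \<bar>Z k T - x\<bar>) + \<bar>x\<bar> * mean k (\<lambda>T. \<bar>W k T - y\<bar>)"
    by simp
  show "(\<lambda>k. B * mean k (\<lambda>T. \<bar>Z k T - x\<bar>) + \<bar>x\<bar> * mean k (\<lambda>T. \<bar>W k T - y\<bar>)) \<longlonglongrightarrow> 0"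
    using Z W unfolding converges_in_mean_def by (auto intro!: tendsto_eq_intros)
qed

lemma convergent_in_mean_deterministic:
  "convergent z \<Longrightarrow> convergent_in_mean (\<lambda>k T. z k)"
  unfolding convergent_def convergent_in_mean_def using converges_in_mean_deterministic by blast

lemma convergent_in_mean_const: "convergent_in_mean (\<lambda>k T. c)"
  by (rule convergent_in_mean_deterministic) (rule convergent_const)

lemma convergent_in_mean_mult:
  assumes "convergent_in_mean Z" "convergent_in_mean W"
    and "\<exists>B. \<forall>k. \<forall>T\<in>set_pmf (P k). \<bar>W k T\<bar> \<le> B"
  shows "convergent_in_mean (\<lambda>k T. Z k T * W k T)"
  using assms converges_in_mean_mult unfolding convergent_in_mean_def by blast

lemma convergent_in_mean_cmult:
  assumes "convergent_in_mean Z" shows "convergent_in_mean (\<lambda>k T. c * Z k T)"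
  using convergent_in_mean_mult[OF assms convergent_in_mean_const[of c]] by (auto simp: mult.commute)

lemma convergent_in_mean_add:
  "convergent_in_mean Z \<Longrightarrow> convergent_in_mean W \<Longrightarrow> convergent_in_mean (\<lambda>k T. Z k T + W k T)"
  unfolding convergent_in_mean_def using converges_in_mean_add by blast

lemma convergent_in_mean_diff:
  "convergent_in_mean Z \<Longrightarrow> convergent_in_mean W \<Longrightarrow> convergent_in_mean (\<lambda>k T. Z k T - W k T)"
  using convergent_in_mean_add[of Z "\<lambda>k T. -1 * W k T"] convergent_in_mean_cmult[of W "-1"] by simp

lemma convergent_in_mean_sum:
  assumes "\<And>i. i \<in> I \<Longrightarrow> convergent_in_mean (Z i)"
  shows "convergent_in_mean (\<lambda>k T. \<Sum>i\<in>I. Z i k T)"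
  using assms
  by (induction I rule: infinite_finite_induct) (auto intro: convergent_in_mean_const convergent_in_mean_add)

lemma tendsto_mean:
  assumes "converges_in_mean Z x" shows "(\<lambda>k. mean k (Z k)) \<longlonglongrightarrow> x"
proof (rule LIM_zero_cancel, rule Lim_null_comparison)
  have "\<bar>mean k (\<lambda>T. Z k T - x)\<bar> \<le> mean k (\<lambda>T. \<bar>Z k T - x\<bar>)" for k
    by (rule integral_abs_bound)
  then show "\<forall>\<^sub>F k in sequentially. norm (mean k (Z k) - x) \<le> mean k (\<lambda>T. \<bar>Z k T - x\<bar>)" by simp
  show "(\<lambda>k. mean k (\<lambda>T. \<bar>Z k T - x\<bar>)) \<longlonglongrightarrow> 0" using assms by (simp add: converges_in_mean_def)
qed

lemma converges_in_mean_lim: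
  assumes "convergent_in_mean Z" shows "converges_in_mean Z (lim (\<lambda>k. mean k (Z k)))"
  using assms tendsto_mean[of Z] limI unfolding convergent_in_mean_def by metis

lemma converges_in_mean_le:
  assumes Z: "converges_in_mean Z x" and W: "converges_in_mean W y"
    and le: "\<And>k T. T \<in> set_pmf (P k) \<Longrightarrow> Z k T \<le> W k T"
  shows "x \<le> y"
  using le by (intro LIMSEQ_le[OF tendsto_mean[OF Z] tendsto_mean[OF W]]) (auto intro: mean_mono)

text \<open>The only candidate for the limit is the limit of the means, which form a Cauchy sequence.\<close>

lemma convergent_in_mean_of_near_constants:
  assumes near: "\<And>\<epsilon>. \<epsilon> > 0 \<Longrightarrow> \<exists>x. \<forall>\<^sub>F k in sequentially. mean k (\<lambda>T. \<bar>Z k T - x\<bar>) < \<epsilon>"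
  shows "convergent_in_mean Z"
proof -
  have mean_near: "\<bar>mean k (Z k) - x\<bar> \<le> mean k (\<lambda>T. \<bar>Z k T - x\<bar>)" for k x
    using integral_abs_bound[of "measure_pmf (P k)" "\<lambda>T. Z k T - x"] by simp
  have "Cauchy (\<lambda>k. mean k (Z k))"
  proof (rule metric_CauchyI)
    fix \<epsilon> :: real assume "\<epsilon> > 0"
    then obtain x k0 where x: "\<And>k. k \<ge> k0 \<Longrightarrow> mean k (\<lambda>T. \<bar>Z k T - x\<bar>) < \<epsilon> / 2"
      using near[of "\<epsilon> / 2"] by (auto simp: eventually_sequentially)
    have "dist (mean k (Z k)) (mean l (Z l)) < \<epsilon>" if "k \<ge> k0" "l \<ge> k0" for k l
      using x[OF that(1)] x[OF that(2)] mean_near[of k x] mean_near[of l x] unfolding dist_real_def by linarith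
    then show "\<exists>k0. \<forall>k\<ge>k0. \<forall>l\<ge>k0. dist (mean k (Z k)) (mean l (Z l)) < \<epsilon>" by blast
  qed
  then obtain z where z: "(\<lambda>k. mean k (Z k)) \<longlonglongrightarrow> z"
    using real_Cauchy_convergent convergent_def by blast
  have "converges_in_mean Z z"
    unfolding converges_in_mean_def
  proof (rule tendstoI)
    fix \<epsilon> :: real assume "\<epsilon> > 0"
    then obtain x where "\<forall>\<^sub>F k in sequentially. mean k (\<lambda>T. \<bar>Z k T - x\<bar>) < \<epsilon> / 3"
      using near[of "\<epsilon> / 3"] by auto
    moreover have "\<forall>\<^sub>F k in sequentially. \<bar>mean k (Z k) - z\<bar> < \<epsilon> / 3"
      using tendstoD[OF z, of "\<epsilon> / 3"] \<open>\<epsilon> > 0\<close> by (simp add: dist_real_def)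
    ultimately show "\<forall>\<^sub>F k in sequentially. dist (mean k (\<lambda>T. \<bar>Z k T - z\<bar>)) 0 < \<epsilon>"
    proof eventually_elim
      case (elim k)
      have "mean k (\<lambda>T. \<bar>Z k T - z\<bar>) \<le> mean k (\<lambda>T. \<bar>Z k T - x\<bar> + \<bar>x - z\<bar>)"
        by (rule mean_mono) linarith
      moreover have "\<bar>x - z\<bar> < 2 * (\<epsilon> / 3)" using elim mean_near[of k x] by linarith
      ultimately show ?case using elim(1) by (simp add: dist_real_def)
    qed
  qed
  then show ?thesis by (auto simp: convergent_in_mean_def)
qed

lemma convergent_in_mean_approx:
  assumes approx: "\<And>\<epsilon>. \<epsilon> > 0 \<Longrightarrow> \<exists>W. convergent_in_mean W \<and>
      (\<forall>\<^sub>F k in sequentially. mean k (\<lambda>T. \<bar>Z k T - W k T\<bar>) \<le> \<epsilon>)"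
  shows "convergent_in_mean Z"
proof (rule convergent_in_mean_of_near_constants)
  fix \<epsilon> :: real assume \<epsilon>: "\<epsilon> > 0"
  obtain W x where W: "converges_in_mean W x"
    "\<forall>\<^sub>F k in sequentially. mean k (\<lambda>T. \<bar>Z k T - W k T\<bar>) \<le> \<epsilon> / 2"
    using approx[OF half_gt_zero[OF \<epsilon>]] unfolding convergent_in_mean_def by blast
  have "\<forall>\<^sub>F k in sequentially. mean k (\<lambda>T. \<bar>W k T - x\<bar>) < \<epsilon> / 2"
    using order_tendstoD(2)[OF W(1)[unfolded converges_in_mean_def], of "\<epsilon> / 2"] \<epsilon> by simp
  with W(2) have "\<forall>\<^sub>F k in sequentially. mean k (\<lambda>T. \<bar>Z k T - x\<bar>) < \<epsilon>"
  proof eventually_elim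
    case (elim k)
    have "mean k (\<lambda>T. \<bar>Z k T - x\<bar>) \<le> mean k (\<lambda>T. \<bar>Z k T - W k T\<bar> + \<bar>W k T - x\<bar>)"
      by (rule mean_mono) linarith
    then show ?case using elim by simp
  qed
  then show "\<exists>x. \<forall>\<^sub>F k in sequentially. mean k (\<lambda>T. \<bar>Z k T - x\<bar>) < \<epsilon>" by blast
qed

lemma convergent_in_mean_close_square:
  assumes W: "convergent_in_mean W"
    and close: "(\<lambda>k. mean k (\<lambda>T. (Z k T - W k T)\<^sup>2)) \<longlonglongrightarrow> 0"
  shows "convergent_in_mean Z"
proof -
  have "(mean k (\<lambda>T. \<bar>Z k T - W k T\<bar>))\<^sup>2 \<le> mean k (\<lambda>T. (Z k T - W k T)\<^sup>2)" for k
    using measure_pmf.variance_eq[of "P k" "\<lambda>T. \<bar>Z k T - W k T\<bar>"]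
      measure_pmf.variance_positive[of "P k" "\<lambda>T. \<bar>Z k T - W k T\<bar>"] by simp
  then have "mean k (\<lambda>T. \<bar>Z k T - W k T\<bar>) \<le> sqrt (mean k (\<lambda>T. (Z k T - W k T)\<^sup>2))" for k
    by (rule real_le_rsqrt)
  moreover have "(\<lambda>k. sqrt (mean k (\<lambda>T. (Z k T - W k T)\<^sup>2))) \<longlonglongrightarrow> 0"
    using tendsto_real_sqrt[OF close] by simp
  ultimately have "(\<lambda>k. mean k (\<lambda>T. \<bar>Z k T - W k T\<bar>)) \<longlonglongrightarrow> 0"
    by (elim Lim_null_comparison[rotated]) simp
  then show ?thesis using W converges_in_mean_close unfolding convergent_in_mean_def by blast
qed

lemma converges_in_mean_imp_in_prob:
  assumes Z: "converges_in_mean Z x" and \<epsilon>: "\<epsilon> > 0"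
  shows "(\<lambda>k. measure_pmf.prob (P k) {T. \<bar>Z k T - x\<bar> > \<epsilon>}) \<longlonglongrightarrow> 0"
proof (rule Lim_null_comparison)
  show "(\<lambda>k. mean k (\<lambda>T. \<bar>Z k T - x\<bar>) / \<epsilon>) \<longlonglongrightarrow> 0"
    using Z \<epsilon> unfolding converges_in_mean_def by (auto intro!: tendsto_eq_intros)
  have "measure_pmf.prob (P k) {T. \<bar>Z k T - x\<bar> > \<epsilon>} \<le> mean k (\<lambda>T. \<bar>Z k T - x\<bar>) / \<epsilon>" for k
  proof -
    have "measure_pmf.prob (P k) {T. \<bar>Z k T - x\<bar> > \<epsilon>} \<le> measure_pmf.prob (P k) {T. \<bar>Z k T - x\<bar> \<ge> \<epsilon>}"
      by (intro measure_pmf.finite_measure_mono) auto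
    also have "\<dots> \<le> mean k (\<lambda>T. \<bar>Z k T - x\<bar>) / \<epsilon>"
      using integral_Markov_inequality_measure[of "measure_pmf (P k)" "\<lambda>T. \<bar>Z k T - x\<bar>" UNIV \<epsilon>] \<epsilon> by simp
    finally show ?thesis .
  qed
  then show "\<forall>\<^sub>F k in sequentially. norm (measure_pmf.prob (P k) {T. \<bar>Z k T - x\<bar> > \<epsilon>}) \<le>
      mean k (\<lambda>T. \<bar>Z k T - x\<bar>) / \<epsilon>"
    by simp
qed

subsection \<open>Power series with random coefficients\<close>

definition coeffs_convergent :: "(nat \<Rightarrow> 'a \<Rightarrow> real fps) \<Rightarrow> bool" where
  "coeffs_convergent f \<longleftrightarrow> (\<forall>j. convergent_in_mean (\<lambda>k T. fps_nth (f k T) j))"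

definition coeffs_bounded :: "(nat \<Rightarrow> 'a \<Rightarrow> real fps) \<Rightarrow> bool" where
  "coeffs_bounded f \<longleftrightarrow> (\<forall>j. \<exists>B. \<forall>k. \<forall>T\<in>set_pmf (P k). \<bar>fps_nth (f k T) j\<bar> \<le> B)"

lemma coeffs_convergent_power:
  assumes f: "coeffs_convergent f" "coeffs_bounded f"
  shows "coeffs_convergent (\<lambda>k T. f k T ^ a)"
proof (induction a)
  case 0
  then show ?case by (simp add: coeffs_convergent_def convergent_in_mean_const)
next
  case (Suc a)
  show ?case
    unfolding coeffs_convergent_def power_Suc2 fps_mult_nth
    using Suc f unfolding coeffs_convergent_def coeffs_bounded_def
    by (intro allI convergent_in_mean_sum convergent_in_mean_mult) blast+
qed

lemma coeffs_convergent_of_power_coeffs: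
  assumes f0: "\<And>k T. T \<in> set_pmf (P k) \<Longrightarrow> fps_nth (f k T) 0 = 1" and bounded: "coeffs_bounded f"
    and a: "\<And>j. j \<ge> 1 \<Longrightarrow> a j \<ge> 1"
    and power: "\<And>j. j \<ge> 1 \<Longrightarrow> convergent_in_mean (\<lambda>k T. fps_nth (f k T ^ a j) j)"
  shows "coeffs_convergent f"
  unfolding coeffs_convergent_def
proof
  fix j show "convergent_in_mean (\<lambda>k T. fps_nth (f k T) j)"
  proof (induction j rule: less_induct)
    case (less j)
    show ?case
    proof (cases "j = 0")
      case True
      then show ?thesis using f0 by (intro convergent_in_mean_cong[OF convergent_in_mean_const[of 1]]) simp
    next
      case False
      let ?g = "\<lambda>k T. fps_cutoff j (f k T)"
      have "convergent_in_mean (\<lambda>k T. fps_nth (?g k T) i)" for i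
        using less[of i] convergent_in_mean_const by (cases "i < j") auto
      moreover have "\<exists>B. \<forall>k. \<forall>T\<in>set_pmf (P k). \<bar>fps_nth (?g k T) i\<bar> \<le> B" for i
        using bounded by (cases "i < j") (auto simp: coeffs_bounded_def)
      ultimately have "coeffs_convergent (\<lambda>k T. ?g k T ^ a j)"
        by (intro coeffs_convergent_power) (simp_all add: coeffs_convergent_def coeffs_bounded_def)
      then have "convergent_in_mean (\<lambda>k T. 1 / real (a j) * (fps_nth (f k T ^ a j) j - fps_nth (?g k T ^ a j) j))"
        using False
        by (intro convergent_in_mean_cmult convergent_in_mean_diff power) (simp_all add: coeffs_convergent_def)
      moreover have "fps_nth (f k T) j = 1 / real (a j) * (fps_nth (f k T ^ a j) j - fps_nth (?g k T ^ a j) j)"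
        if "T \<in> set_pmf (P k)" for k T
        using fps_nth_power_diff[of "f k T" "?g k T" j "a j"] f0[OF that] False a[of j] by simp
      ultimately show ?thesis by (rule convergent_in_mean_cong)
    qed
  qed
qed

lemma coeffs_convergent_log_deriv:
  assumes f: "coeffs_convergent f" "coeffs_bounded f"
    and f0: "\<And>k T. T \<in> set_pmf (P k) \<Longrightarrow> fps_nth (f k T) 0 = 1"
  shows "coeffs_convergent (\<lambda>k T. fps_log_deriv (f k T))"
  unfolding coeffs_convergent_def
proof
  fix j show "convergent_in_mean (\<lambda>k T. fps_nth (fps_log_deriv (f k T)) j)"
  proof (induction j rule: less_induct)
    case (less j)
    show ?case
    proof (cases "j = 0")
      case False
      then have "{1..j} = insert j {1..<j}" by auto
      then have "fps_nth (fps_log_deriv (f k T)) j = real j * fps_nth (f k T) j -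
          (\<Sum>i=1..<j. fps_nth (fps_log_deriv (f k T)) i * fps_nth (f k T) (j - i))"
        if "T \<in> set_pmf (P k)" for k T
        using fps_log_deriv_recurrence[OF f0[OF that], of j] f0[OF that] by simp
      moreover have "convergent_in_mean (\<lambda>k T. real j * fps_nth (f k T) j -
          (\<Sum>i=1..<j. fps_nth (fps_log_deriv (f k T)) i * fps_nth (f k T) (j - i)))"
        using f less unfolding coeffs_convergent_def coeffs_bounded_def
        by (intro convergent_in_mean_diff convergent_in_mean_cmult convergent_in_mean_sum
            convergent_in_mean_mult) auto
      ultimately show ?thesis by (rule convergent_in_mean_cong[rotated])
    qed (simp add: fps_log_deriv_nth_0 convergent_in_mean_const)
  qed
qed

lemma coeffs_convergent_of_log_deriv:
  assumes s: "coeffs_convergent (\<lambda>k T. fps_log_deriv (f k T))" and bounded: "coeffs_bounded f"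
    and f0: "\<And>k T. T \<in> set_pmf (P k) \<Longrightarrow> fps_nth (f k T) 0 = 1"
  shows "coeffs_convergent f"
  unfolding coeffs_convergent_def
proof
  fix j show "convergent_in_mean (\<lambda>k T. fps_nth (f k T) j)"
  proof (induction j rule: less_induct)
    case (less j)
    show ?case
    proof (cases "j = 0")
      case True
      then show ?thesis using f0 by (intro convergent_in_mean_cong[OF convergent_in_mean_const[of 1]]) simp
    next
      case False
      have "fps_nth (f k T) j =
          1 / real j * (\<Sum>i=1..j. fps_nth (fps_log_deriv (f k T)) i * fps_nth (f k T) (j - i))"
        if "T \<in> set_pmf (P k)" for k T
        using fps_log_deriv_recurrence[OF f0[OF that], of j] False by (simp add: field_simps)
      moreover have "convergent_in_mean (\<lambda>k T.
          1 / real j * (\<Sum>i=1..j. fps_nth (fps_log_deriv (f k T)) i * fps_nth (f k T) (j - i)))"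
        using s bounded less unfolding coeffs_convergent_def coeffs_bounded_def
        by (intro convergent_in_mean_cmult convergent_in_mean_sum convergent_in_mean_mult) auto
      ultimately show ?thesis by (rule convergent_in_mean_cong[rotated])
    qed
  qed
qed

end

section \<open>Diagonals and profiles\<close>

definition diag_count :: "nat \<Rightarrow> (nat \<times> nat) set \<Rightarrow> nat" where
  "diag_count c D = card {b \<in> D. box_content b = c}"

lemma diag_count_seq_diagram: "diag_count c (seq_diagram \<xi>) = card {y. c < \<xi> y}"
proof -
  have "bij_betw (\<lambda>y. (Suc (y + c), y)) {y. c < \<xi> y} {b \<in> seq_diagram \<xi>. box_content b = c}"
    by (rule bij_betw_byWitness[where f' = snd]) (auto simp: seq_diagram_def box_content_def)
  from bij_betw_same_card[OF this] show ?thesis unfolding diag_count_def by (rule sym)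
qed

lemma finite_long_rows: "strict_seq \<xi> \<Longrightarrow> finite {y. c < \<xi> y}"
  by (rule finite_subset[of _ "{y. \<xi> y > 0}"]) (auto simp: strict_seq_def)

lemma long_rows_eq:
  assumes \<xi>: "strict_seq \<xi>"
  shows "{y. c < \<xi> y} = {1..diag_count c (seq_diagram \<xi>)}"
proof (cases "{y. c < \<xi> y} = {}")
  case False
  define L where "L = Max {y. c < \<xi> y}"
  have L: "c < \<xi> L" "\<And>y. c < \<xi> y \<Longrightarrow> y \<le> L"
    using Max_in[OF finite_long_rows[OF \<xi>] False] Max_ge[OF finite_long_rows[OF \<xi>]] by (auto simp: L_def)
  have "c < \<xi> y \<longleftrightarrow> y \<in> {1..L}" for y
    using L strict_seq_row_pos[OF \<xi>, of y] strict_seq_gap[OF \<xi>, of L y] by fastforce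
  then have "{y. c < \<xi> y} = {1..L}" by blast
  then show ?thesis unfolding diag_count_seq_diagram by simp
qed (simp add: diag_count_seq_diagram)

lemma diag_count_mono:
  assumes "finite D" "E \<subseteq> D" shows "diag_count c E \<le> diag_count c D"
  unfolding diag_count_def using assms by (intro card_mono) auto

lemma diag_count_antimono:
  assumes "shifted_shape D" "c \<le> c'" shows "diag_count c' D \<le> diag_count c D"
proof -
  obtain \<xi> where \<xi>: "strict_seq \<xi>" "D = seq_diagram \<xi>" using assms(1) by (rule shifted_shapeE)
  show ?thesis unfolding \<xi>(2) diag_count_seq_diagram
    using assms(2) by (intro card_mono finite_long_rows[OF \<xi>(1)]) auto
qed

lemma diag_count_le_Suc:
  assumes "shifted_shape D" shows "diag_count c D \<le> Suc (diag_count (Suc c) D)"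
proof -
  obtain \<xi> where \<xi>: "strict_seq \<xi>" "D = seq_diagram \<xi>" using assms by (rule shifted_shapeE)
  have fin: "finite {y. \<xi> y = Suc c}"
    by (rule finite_subset[OF _ finite_long_rows[OF \<xi>(1), of c]]) auto
  have "{y. c < \<xi> y} = {y. Suc c < \<xi> y} \<union> {y. \<xi> y = Suc c}" by auto
  then have "card {y. c < \<xi> y} \<le> card {y. Suc c < \<xi> y} + card {y. \<xi> y = Suc c}"
    by (metis card_Un_le)
  moreover have "card {y. \<xi> y = Suc c} \<le> Suc 0"
    using inj_on_strict_seq[OF \<xi>(1)] card_le_Suc0_iff_eq[OF fin] by (auto simp: inj_on_def)
  ultimately show ?thesis unfolding \<xi>(2) diag_count_seq_diagram by simp
qed

lemma diag_count_le_add: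
  assumes "shifted_shape D" shows "diag_count c D \<le> diag_count (c + i) D + i"
proof (induction i)
  case (Suc i)
  then show ?case using diag_count_le_Suc[OF assms, of "c + i"] by simp
qed simp

lemma abs_diag_count_diff_le:
  assumes "shifted_shape D"
  shows "\<bar>real (diag_count c D) - real (diag_count c' D)\<bar> \<le> \<bar>real c - real c'\<bar>"
proof (induction c c' rule: linorder_wlog)
  case (le c c')
  then show ?case
    using diag_count_antimono[OF assms le] diag_count_le_add[OF assms, of c "c' - c"] by simp
qed (simp add: abs_minus_commute)

lemma diag_count_le_content_bound:
  assumes D: "shifted_shape D" and content: "\<And>b. b \<in> D \<Longrightarrow> box_content b < n"
  shows "diag_count c D \<le> n"
proof -
  obtain \<xi> where \<xi>: "strict_seq \<xi>" "D = seq_diagram \<xi>" using D by (rule shifted_shapeE)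
  let ?L = "diag_count 0 D"
  have "?L \<le> n"
  proof (cases "?L = 0")
    case False
    then have ge: "1 \<le> ?L" by simp
    then have "?L \<in> {y. 0 < \<xi> y}" unfolding long_rows_eq[OF \<xi>(1)] \<xi>(2) by simp
    then have pos: "0 < \<xi> ?L" by simp
    then have "?L \<le> \<xi> 1" using strict_seq_gap[OF \<xi>(1) pos _ ge] by linarith
    moreover from this have "\<xi> 1 > 0" using ge by linarith
    then have "(Suc (\<xi> 1), 1) \<in> D" by (auto simp: \<xi>(2) seq_diagram_def)
    from content[OF this] have "\<xi> 1 \<le> n" using \<open>\<xi> 1 > 0\<close> by (simp add: box_content_def)
    ultimately show ?thesis by simp
  qed simp
  then show ?thesis using diag_count_antimono[OF D, of 0 c] by simp
qed

lemma diag_count_eq_0: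
  assumes "\<And>b. b \<in> D \<Longrightarrow> box_content b < c" shows "diag_count c D = 0"
proof -
  have "{b \<in> D. box_content b = c} = {}" using assms by fastforce
  then show ?thesis unfolding diag_count_def by (simp only: card.empty)
qed

lemma sum_by_content:
  assumes "finite D" "\<And>b. b \<in> D \<Longrightarrow> box_content b < K"
  shows "(\<Sum>b\<in>D. g (box_content b)) = (\<Sum>c<K. of_nat (diag_count c D) * g c)"
proof -
  have "(\<Sum>c<K. of_nat (diag_count c D) * g c) = (\<Sum>c<K. \<Sum>b\<in>{b \<in> D. box_content b = c}. g (box_content b))"
    by (rule sum.cong) (auto simp: diag_count_def)
  also have "\<dots> = (\<Sum>b\<in>D. g (box_content b))"
    using assms by (intro sum.group) auto
  finally show ?thesis by simp
qed

lemma diag_count_Diff: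
  assumes "finite D" "E \<subseteq> D"
  shows "diag_count c (D - E) = diag_count c D - diag_count c E"
proof -
  have "{b \<in> D - E. box_content b = c} = {b \<in> D. box_content b = c} - {b \<in> E. box_content b = c}" by auto
  then show ?thesis
    using assms finite_subset[OF assms(2,1)] by (auto simp: diag_count_def intro!: card_Diff_subset)
qed

text \<open>A diagonal that has grown by \<open>d\<close> boxes forces its neighbours to have grown by \<open>d - 1, d - 2, \<dots>\<close>.\<close>

lemma square_diag_count_growth_le:
  assumes D: "shifted_shape D" and E: "shifted_shape E" "E \<subseteq> D"
  shows "(diag_count c D - diag_count c E)\<^sup>2 \<le> 2 * card (D - E)"
proof -
  define d where "d = diag_count c D - diag_count c E"
  have fin: "finite D" by (rule finite_shifted_shape[OF D])
  have "d\<^sup>2 \<le> 2 * (\<Sum>i<d. d - i)"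
  proof -
    have "(\<Sum>i<d. d - i) = (\<Sum>i<d. Suc i)"
      by (rule sum.reindex_bij_witness[of _ "\<lambda>i. d - Suc i" "\<lambda>i. d - Suc i"]) auto
    moreover have "2 * (\<Sum>i<d. Suc i) = d\<^sup>2 + d" by (induction d) (auto simp: power2_eq_square)
    ultimately show ?thesis by simp
  qed
  also have "(\<Sum>i<d. d - i) \<le> (\<Sum>i<d. diag_count (c + i) (D - E))"
    unfolding diag_count_Diff[OF fin E(2)]
  proof (rule sum_mono)
    fix i
    show "d - i \<le> diag_count (c + i) D - diag_count (c + i) E"
      using diag_count_le_add[OF D, of c i] diag_count_antimono[OF E(1), of c "c + i"] by (simp add: d_def)
  qed
  also have "\<dots> = card (\<Union>i<d. {b \<in> D - E. box_content b = c + i})"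
    unfolding diag_count_def using fin by (intro card_UN_disjoint[symmetric]) auto
  also have "\<dots> \<le> card (D - E)" using fin by (intro card_mono) auto
  finally show ?thesis by (simp add: d_def)
qed

lemma seq_diagram_nth_part: "shifted_diagram ys = seq_diagram (nth_part ys)"
  by (auto simp: shifted_diagram_def seq_diagram_def nth_part_def split: if_splits)

lemma strict_seq_nth_part:
  assumes "ys \<in> strict_partitions n" shows "strict_seq (nth_part ys)"
proof -
  have "finite {y. nth_part ys y > 0}"
    by (rule finite_subset[of _ "{..length ys}"]) (auto simp: nth_part_def split: if_splits)
  moreover have "nth_part ys (Suc y) = 0 \<or> nth_part ys (Suc y) < nth_part ys y" if "y \<ge> 1" for y
    using assms sorted_wrt_nth_less[of "(>)" ys "y - 1" y] that
    by (cases "Suc y \<le> length ys") (simp_all add: strict_partitions_def nth_part_def)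
  moreover have "nth_part ys 0 = 0" by (simp add: nth_part_def)
  ultimately show ?thesis unfolding strict_seq_def by blast
qed

lemma shifted_shape_shifted_diagram:
  "ys \<in> strict_partitions n \<Longrightarrow> shifted_shape (shifted_diagram ys)"
  using strict_seq_nth_part seq_diagram_nth_part by (auto simp: shifted_shape_def)

lemma parts_nth_part:
  assumes "ys \<in> strict_partitions n" shows "parts (nth_part ys) = set ys"
proof (intro equalityI subsetI)
  fix p assume "p \<in> parts (nth_part ys)"
  then show "p \<in> set ys" by (auto simp: parts_def nth_part_def split: if_splits)
next
  fix p assume p: "p \<in> set ys"
  then obtain i where "i < length ys" "ys ! i = p" by (auto simp: in_set_conv_nth)
  then have "nth_part ys (Suc i) = p" by (simp add: nth_part_def)
  then show "p \<in> parts (nth_part ys)"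
    using p assms parts_memI[of "nth_part ys" "Suc i"] by (auto simp: strict_partitions_def)
qed

lemma card_shifted_diagram:
  assumes "ys \<in> strict_partitions n" shows "card (shifted_diagram ys) = n"
proof -
  have "sorted_wrt (>) ys" using assms by (simp add: strict_partitions_def)
  then have "distinct ys" by (induction ys) auto
  then show ?thesis
    using assms card_seq_diagram[OF strict_seq_nth_part[OF assms]]
    by (simp add: seq_diagram_nth_part parts_nth_part strict_partitions_def distinct_sum_list_conv_Sum)
qed

lemma shifted_tableaux_eq_standard_tableaux:
  assumes "ys \<in> strict_partitions n"
  shows "shifted_tableaux ys = standard_tableaux (shifted_diagram ys)"
proof -
  have "sum_list ys = n" using assms by (simp add: strict_partitions_def)
  then show ?thesis
    unfolding shifted_tableaux_def linear_extensions_def card_shifted_diagram[OF assms] box_less_def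
    by (auto; metis)
qed

lemma box_content_less_first_part:
  assumes ys: "ys \<in> strict_partitions n" and b: "b \<in> shifted_diagram ys"
  shows "box_content b < nth_part ys 1"
proof -
  obtain x y where xy: "b = (x, y)" "y < x" "x \<le> y + nth_part ys y"
    using b by (cases b) (auto simp: shifted_diagram_def)
  then have "0 < nth_part ys y" by simp
  note strict_seq_gap[OF strict_seq_nth_part[OF ys] this, of 1]
    strict_seq_row_pos[OF strict_seq_nth_part[OF ys] this]
  then show ?thesis using xy by (simp add: box_content_def)
qed

lemma profile_heights_le:
  assumes ys: "ys \<in> strict_partitions n" and z: "z \<ge> 0" and t: "t \<in> profile_heights ys z"
  shows "t \<le> z + 2 * real (diag_count (nat \<lfloor>z\<rfloor>) (shifted_diagram ys)) + 2"
proof -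
  let ?D = "shifted_diagram ys" and ?c = "nat \<lfloor>z\<rfloor>"
  have shape: "shifted_shape ?D" by (rule shifted_shape_shifted_diagram[OF ys])
  obtain x y where xy: "t = x + y - 1 / 2" "(x, y) \<in> shifted_region ys" "x - y - 1 / 2 = z"
    using t by (auto simp: profile_heights_def)
  then obtain X Y where XY: "(X, Y) \<in> ?D" "real X - 1 \<le> x" "x \<le> real X" "real Y - 1 \<le> y" "y \<le> real Y"
    by (auto simp: shifted_region_def)
  define c where "c = X - Y - 1"
  have row: "Y < X" "c < nth_part ys Y" using XY(1) by (auto simp: shifted_diagram_def c_def)
  then have "real c = real X - real Y - 1" by (simp add: c_def)
  then have "?c \<le> Suc c" using XY xy z by linarith
  have "Y \<in> {1..diag_count c ?D}"
    using row(2) long_rows_eq[OF strict_seq_nth_part[OF ys], of c] by (auto simp: seq_diagram_nth_part)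
  then have "Y \<le> diag_count c ?D" by simp
  also have "\<dots> \<le> Suc (diag_count (Suc c) ?D)" by (rule diag_count_le_Suc[OF shape])
  also have "\<dots> \<le> Suc (diag_count ?c ?D)" using diag_count_antimono[OF shape \<open>?c \<le> Suc c\<close>] by simp
  finally show ?thesis using xy XY by linarith
qed

lemma profile_heights_memI:
  assumes ys: "ys \<in> strict_partitions n" and z: "z \<ge> 0"
  defines "N \<equiv> diag_count (nat \<lfloor>z\<rfloor>) (shifted_diagram ys)"
  assumes N: "N > 0"
  shows "z + 2 * real N - 1 \<in> profile_heights ys z"
proof -
  define c where "c = nat \<lfloor>z\<rfloor>"
  have c: "real c \<le> z" "z \<le> real c + 1" using z by (auto simp: c_def)
  have "N \<in> {y. c < nth_part ys y}"
    using N long_rows_eq[OF strict_seq_nth_part[OF ys], of c] by (simp add: N_def c_def seq_diagram_nth_part)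
  then have box: "(Suc (N + c), N) \<in> shifted_diagram ys" using N by (auto simp: shifted_diagram_def)
  have "(z + real N, real N - 1 / 2) \<in> {real (Suc (N + c)) - 1..real (Suc (N + c))} \<times> {real N - 1..real N}"
    using c by simp
  then have "(z + real N, real N - 1 / 2) \<in> shifted_region ys"
    unfolding shifted_region_def using box by blast
  then show ?thesis unfolding profile_heights_def
    by (intro CollectI exI[of _ "z + real N"] exI[of _ "real N - 1 / 2"]) auto
qed

lemma profile_approx:
  assumes ys: "ys \<in> strict_partitions n" and z: "z \<ge> 0"
  shows "\<bar>profile ys z - (z + 2 * real (diag_count (nat \<lfloor>z\<rfloor>) (shifted_diagram ys)))\<bar> \<le> 2"
proof -
  define N where "N = diag_count (nat \<lfloor>z\<rfloor>) (shifted_diagram ys)"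
  have upper: "t \<le> z + 2 * real N + 2" if "t \<in> profile_heights ys z" for t
    unfolding N_def by (rule profile_heights_le[OF ys z that])
  then have bdd: "bdd_above (profile_heights ys z)" by (rule bdd_aboveI)
  have "z + 2 * real N - 1 \<le> profile ys z"
  proof (cases "N = 0")
    case True
    then show ?thesis using z by (auto simp: profile_def)
  next
    case False
    then have "z + 2 * real N - 1 \<in> profile_heights ys z"
      unfolding N_def by (intro profile_heights_memI[OF ys z]) simp
    then show ?thesis using cSup_upper[OF _ bdd] z by (auto simp: profile_def le_max_iff_disj)
  qed
  moreover have "profile ys z \<le> z + 2 * real N + 2"
  proof (cases "profile_heights ys z = {}")
    case False
    then have "Sup (profile_heights ys z) \<le> z + 2 * real N + 2" using upper by (intro cSup_least) auto
    then show ?thesis using False z by (simp add: profile_def)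
  qed (use z in \<open>simp add: profile_def\<close>)
  ultimately show ?thesis unfolding N_def by linarith
qed

lemma tableau_le_diagram:
  assumes "xs \<in> strict_partitions n" "T \<in> shifted_tableaux xs"
  shows "(\<exists>m. tableau_le xs T s \<in> strict_partitions m) \<and>
    shifted_diagram (tableau_le xs T s) = {b \<in> shifted_diagram xs. real (T b) \<le> s}"
  unfolding tableau_le_def by (rule theI'[OF tableau_le_ex1[OF assms]])

definition diag_height :: "real \<Rightarrow> real \<Rightarrow> (nat \<times> nat) set \<Rightarrow> real" where
  "diag_height r z D = real (diag_count (nat \<lfloor>r * z\<rfloor>) D) / r"

lemma abs_nat_floor_scaled_le:
  fixes r z :: real
  assumes "r > 0" "z \<ge> 0" shows "\<bar>real (nat \<lfloor>r * z\<rfloor>) / r - z\<bar> \<le> 1 / r"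
proof -
  have "0 \<le> r * z" using assms by simp
  then have "\<bar>real (nat \<lfloor>r * z\<rfloor>) - r * z\<bar> \<le> 1" by linarith
  moreover have "real (nat \<lfloor>r * z\<rfloor>) / r - z = (real (nat \<lfloor>r * z\<rfloor>) - r * z) / r"
    using assms by (simp add: diff_divide_distrib)
  ultimately show ?thesis using assms by (simp add: divide_right_mono)
qed

lemma tendsto_nat_floor_scaled:
  fixes r :: "nat \<Rightarrow> real"
  assumes r: "\<And>k. r k > 0" "(\<lambda>k. 1 / r k) \<longlonglongrightarrow> 0" and z: "z \<ge> 0"
  shows "(\<lambda>k. real (nat \<lfloor>r k * z\<rfloor>) / r k) \<longlonglongrightarrow> z"
proof (rule LIM_zero_cancel, rule Lim_null_comparison[OF _ r(2)])
  show "\<forall>\<^sub>F k in sequentially. norm (real (nat \<lfloor>r k * z\<rfloor>) / r k - z) \<le> 1 / r k"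
    using abs_nat_floor_scaled_le[OF r(1) z] by simp
qed

lemma dilated_profile_approx:
  assumes "ys \<in> strict_partitions n" "z \<ge> 0" "r > 0"
  shows "\<bar>dilated_profile (1 / r) ys z - (z + 2 * diag_height r z (shifted_diagram ys))\<bar> \<le> 2 / r"
proof -
  let ?N = "real (diag_count (nat \<lfloor>r * z\<rfloor>) (shifted_diagram ys))"
  have "\<bar>profile ys (r * z) - (r * z + 2 * ?N)\<bar> \<le> 2"
    using assms by (intro profile_approx) auto
  then have "\<bar>profile ys (r * z) - (r * z + 2 * ?N)\<bar> / r \<le> 2 / r"
    using assms by (intro divide_right_mono) auto
  moreover have "dilated_profile (1 / r) ys z - (z + 2 * diag_height r z (shifted_diagram ys)) =
      (profile ys (r * z) - (r * z + 2 * ?N)) / r"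
    using assms by (simp add: dilated_profile_def diag_height_def diff_divide_distrib add_divide_distrib mult.commute)
  ultimately show ?thesis using assms by simp
qed

lemma diag_height_nonneg: "r > 0 \<Longrightarrow> 0 \<le> diag_height r z D"
  by (simp add: diag_height_def)

lemma diag_height_mono:
  assumes "r > 0" "finite D" "E \<subseteq> D" shows "diag_height r z E \<le> diag_height r z D"
  unfolding diag_height_def using diag_count_mono[OF assms(2,3)] assms(1) by (intro divide_right_mono) auto

lemma diag_height_antimono:
  assumes "r > 0" "shifted_shape D" "z \<le> z'" shows "diag_height r z' D \<le> diag_height r z D"
proof -
  have "nat \<lfloor>r * z\<rfloor> \<le> nat \<lfloor>r * z'\<rfloor>" using assms by (intro nat_mono floor_mono mult_left_mono) auto
  then show ?thesis unfolding diag_height_def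
    using assms(1) diag_count_antimono[OF assms(2)] by (intro divide_right_mono) auto
qed

lemma abs_diag_count_minus_diag_height_le:
  assumes "r > 0" "shifted_shape D" "z \<ge> 0"
  shows "\<bar>real (diag_count c D) / r - diag_height r z D\<bar> \<le> \<bar>real c / r - z\<bar> + 1 / r"
proof -
  define d where "d = nat \<lfloor>r * z\<rfloor>"
  have "\<bar>real (diag_count c D) / r - diag_height r z D\<bar> = \<bar>real (diag_count c D) - real (diag_count d D)\<bar> / r"
    using assms(1) by (simp add: diag_height_def d_def flip: diff_divide_distrib)
  also have "\<dots> \<le> \<bar>real c - real d\<bar> / r"
    using assms by (intro divide_right_mono abs_diag_count_diff_le) auto
  also have "\<dots> = \<bar>real c / r - real d / r\<bar>" using assms(1) by (simp flip: diff_divide_distrib)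
  finally show ?thesis
    using abs_nat_floor_scaled_le[OF assms(1,3)] unfolding d_def by linarith
qed

lemma diag_height_lipschitz:
  assumes "r > 0" "shifted_shape D" "0 \<le> z" "z \<le> z'"
  shows "diag_height r z D \<le> diag_height r z' D + (z' - z) + 2 / r"
proof -
  have "\<bar>diag_height r z D - diag_height r z' D\<bar> \<le> \<bar>real (nat \<lfloor>r * z\<rfloor>) / r - z'\<bar> + 1 / r"
    using abs_diag_count_minus_diag_height_le[OF assms(1,2), of z' "nat \<lfloor>r * z\<rfloor>"] assms(3,4)
    by (simp add: diag_height_def)
  moreover have "2 / r = 1 / r + 1 / r" by simp
  ultimately show ?thesis using abs_nat_floor_scaled_le[OF assms(1,3)] assms(4) by linarith
qed

lemma diag_height_growth_le:
  assumes D: "shifted_shape D" and E: "shifted_shape E" "E \<subseteq> D"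
  shows "diag_height r z D \<le> diag_height r z E + sqrt (2 * real (card (D - E)) / r\<^sup>2)"
proof -
  let ?c = "nat \<lfloor>r * z\<rfloor>"
  let ?d = "real (diag_count ?c D - diag_count ?c E)"
  have "?d\<^sup>2 \<le> 2 * real (card (D - E))"
    using of_nat_mono[OF square_diag_count_growth_le[OF D E, of ?c], where 'a = real] by simp
  then have "(?d / r)\<^sup>2 \<le> 2 * real (card (D - E)) / r\<^sup>2"
    unfolding power_divide by (intro divide_right_mono) auto
  then have "?d / r \<le> sqrt (2 * real (card (D - E)) / r\<^sup>2)" by (rule real_le_rsqrt)
  moreover have "diag_height r z D = diag_height r z E + ?d / r"
    using diag_count_mono[OF finite_shifted_shape[OF D] E(2), of ?c]
    by (simp add: diag_height_def flip: add_divide_distrib)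
  ultimately show ?thesis by simp
qed

section \<open>Riemann sums of step functions\<close>

lemma step_function_has_integral:
  fixes F :: "nat \<Rightarrow> real"
  assumes r: "r > 0"
  shows "((\<lambda>z. F (nat \<lfloor>r * z\<rfloor>)) has_integral (\<Sum>c<K. F c) / r) {0..real K / r}"
proof (induction K)
  case 0
  show ?case using has_integral_refl(1)[of "\<lambda>z. F (nat \<lfloor>r * z\<rfloor>)" 0] by simp
next
  case (Suc K)
  let ?a = "real K / r" and ?b = "real (Suc K) / r"
  have ab: "0 \<le> ?a" "?a \<le> ?b" using r by (simp_all add: divide_right_mono)
  have "((\<lambda>_. F K) has_integral (?b - ?a) * F K) {?a..?b}"
    using has_integral_const_real[of "F K" ?a ?b] ab by simp
  then have "((\<lambda>z. F (nat \<lfloor>r * z\<rfloor>)) has_integral (?b - ?a) * F K) {?a..?b}"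
  proof (rule has_integral_spike_finite[where S = "{?b}", rotated 2])
    fix z assume "z \<in> {?a..?b} - {?b}"
    then have "real K \<le> r * z" "r * z < real K + 1" using r by (auto simp: field_simps)
    then have "\<lfloor>r * z\<rfloor> = int K" by linarith
    then show "F (nat \<lfloor>r * z\<rfloor>) = F K" by simp
  qed simp
  from has_integral_combine[OF ab Suc this] show ?case
    using r by (simp add: field_simps)
qed

lemma step_function_has_integral_of_support:
  fixes F :: "nat \<Rightarrow> real"
  assumes r: "r \<ge> 1" and B: "B \<ge> 0" and support: "\<And>c. real c \<ge> B * r \<Longrightarrow> F c = 0"
    and K: "real K \<ge> B * r"
  shows "((\<lambda>z. F (nat \<lfloor>r * z\<rfloor>)) has_integral (\<Sum>c<K. F c) / r) {0..B + 1}"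
proof -
  define L where "L = nat \<lceil>B * r\<rceil>"
  have L: "B * r \<le> real L" "real L \<le> B * r + 1" using B r by (auto simp: L_def of_nat_ceiling)
  have "(B + 1) * r \<ge> real L" using L r by (simp add: algebra_simps)
  then have le: "real L / r \<le> B + 1" using r by (simp add: divide_le_eq)
  have "L \<le> K" using K by (simp add: L_def ceiling_le_iff nat_le_iff)
  then have "(\<Sum>c<K. F c) = (\<Sum>c<L. F c)"
    using L support by (intro sum.mono_neutral_right) auto
  then have inside: "((\<lambda>z. F (nat \<lfloor>r * z\<rfloor>)) has_integral (\<Sum>c<K. F c) / r) {0..real L / r}"
    using step_function_has_integral[of r F L] r by simp
  have "F (nat \<lfloor>r * z\<rfloor>) = 0" if "z \<in> {real L / r..B + 1}" for z
  proof -
    have "real L \<le> r * z" using that r by (simp add: field_simps)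
    then have "L \<le> nat \<lfloor>r * z\<rfloor>" by (simp add: le_nat_iff le_floor_iff)
    then show ?thesis using L by (intro support) linarith
  qed
  then have outside: "((\<lambda>z. F (nat \<lfloor>r * z\<rfloor>)) has_integral 0) {real L / r..B + 1}"
    by (rule has_integral_is_0)
  show ?thesis using has_integral_combine[OF _ le inside outside] r by simp
qed

lemma riemann_sum_tendsto_integral:
  fixes F :: "nat \<Rightarrow> nat \<Rightarrow> real"
  assumes r: "\<And>k. r k \<ge> 1" and B: "B \<ge> 0"
    and support: "\<And>k c. real c \<ge> B * r k \<Longrightarrow> F k c = 0" and bounded: "\<And>k c. \<bar>F k c\<bar> \<le> A"
    and lim: "\<And>z. 0 \<le> z \<Longrightarrow> (\<lambda>k. F k (nat \<lfloor>r k * z\<rfloor>)) \<longlonglongrightarrow> f z"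
    and K: "\<And>k. real (K k) \<ge> B * r k"
  shows "(\<lambda>k. (\<Sum>c<K k. F k c) / r k) \<longlonglongrightarrow> integral {0..B + 1} f"
proof -
  let ?g = "\<lambda>k z. F k (nat \<lfloor>r k * z\<rfloor>)"
  have int: "(?g k has_integral (\<Sum>c<K k. F k c) / r k) {0..B + 1}" for k
    by (rule step_function_has_integral_of_support[OF r B support K])
  have "(\<lambda>k. integral {0..B + 1} (?g k)) \<longlonglongrightarrow> integral {0..B + 1} f"
    by (rule dominated_convergence(2)[where h = "\<lambda>_. A"])
       (use int bounded lim in auto)
  moreover have "integral {0..B + 1} (?g k) = (\<Sum>c<K k. F k c) / r k" for k
    using int by (rule integral_unique)
  ultimately show ?thesis by simp
qed

section \<open>Convergence of the diagonal heights of random shapes\<close>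

lemma abs_weighted_sum_deviation_le:
  fixes w g :: "'a \<Rightarrow> real"
  assumes "\<And>c. c \<in> A \<Longrightarrow> 0 \<le> w c" "\<And>c. c \<in> A \<Longrightarrow> w c \<noteq> 0 \<Longrightarrow> \<bar>g c - x\<bar> \<le> e"
  shows "\<bar>(\<Sum>c\<in>A. g c * w c) - x * (\<Sum>c\<in>A. w c)\<bar> \<le> e * (\<Sum>c\<in>A. w c)"
proof -
  have "(\<Sum>c\<in>A. g c * w c) - x * (\<Sum>c\<in>A. w c) = (\<Sum>c\<in>A. (g c - x) * w c)"
    by (simp add: left_diff_distrib sum_subtractf sum_distrib_left)
  also have "\<bar>\<dots>\<bar> \<le> (\<Sum>c\<in>A. e * w c)"
  proof (intro order_trans[OF sum_abs] sum_mono)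
    fix c assume "c \<in> A"
    then show "\<bar>(g c - x) * w c\<bar> \<le> e * w c"
      using assms[of c] by (cases "w c = 0") (auto simp: abs_mult intro: mult_right_mono)
  qed
  finally show ?thesis by (simp add: sum_distrib_left)
qed

definition hat :: "real \<Rightarrow> real \<Rightarrow> real \<Rightarrow> real" where
  "hat z \<eta> w = max 0 (1 - \<bar>sqrt w - z\<bar> / \<eta>)"

lemma hat_nonneg: "0 \<le> hat z \<eta> w"
  by (simp add: hat_def)

lemma hat_le_1: "\<eta> > 0 \<Longrightarrow> hat z \<eta> w \<le> 1"
  by (simp add: hat_def)

lemma hat_support: "\<eta> > 0 \<Longrightarrow> hat z \<eta> w \<noteq> 0 \<Longrightarrow> \<bar>sqrt w - z\<bar> < \<eta>"
  by (auto simp: hat_def max_def field_simps split: if_splits)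

lemma continuous_on_hat: "\<eta> > 0 \<Longrightarrow> continuous_on S (hat z \<eta>)"
  unfolding hat_def by (intro continuous_intros) auto

lemma integral_hat_pos:
  assumes \<eta>: "\<eta> > 0" and z: "0 \<le> z" "z < B"
  shows "integral {0..B} (\<lambda>t. hat z \<eta> (t\<^sup>2)) > 0"
proof -
  have cont: "continuous_on {0..B} (\<lambda>t. hat z \<eta> (t\<^sup>2))"
    unfolding hat_def using \<eta> by (intro continuous_intros) auto
  have "hat z \<eta> (z\<^sup>2) \<noteq> 0" "z \<in> {0..B}" "0 < B" using z by (auto simp: hat_def)
  then have "integral {0..B} (\<lambda>t. hat z \<eta> (t\<^sup>2)) \<noteq> 0"
    using integral_eq_0_iff[OF cont] hat_nonneg by blast
  moreover have "integral {0..B} (\<lambda>t. hat z \<eta> (t\<^sup>2)) \<ge> 0"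
    using hat_nonneg integrable_continuous_real[OF cont] by (intro integral_nonneg) auto
  ultimately show ?thesis by simp
qed

locale scale_sequence =
  fixes n :: "nat \<Rightarrow> real" and C :: real
  assumes n_ge_1: "n k \<ge> 1" and n_at_top: "filterlim n at_top sequentially" and C_pos: "C > 0"
begin

definition r :: "nat \<Rightarrow> real" where "r k = sqrt (2 * n k)"

abbreviation weight :: "nat \<Rightarrow> nat \<Rightarrow> real" where
  "weight k \<equiv> box_weight (2 * n k)"

lemma r_mult_r: "r k * r k = 2 * n k"
  using n_ge_1[of k] by (simp add: r_def)

lemma r_ge_1: "r k \<ge> 1"
  using n_ge_1[of k] by (simp add: r_def)

lemma r_pos: "r k > 0"
  using r_ge_1[of k] by linarith

lemma inverse_n_tendsto_0: "(\<lambda>k. 1 / n k) \<longlonglongrightarrow> 0"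
  using tendsto_inverse_0_at_top[OF n_at_top] by (simp add: inverse_eq_divide)

lemma inverse_r_tendsto_0: "(\<lambda>k. 1 / r k) \<longlonglongrightarrow> 0"
proof -
  have "filterlim (\<lambda>k. 2 * n k) at_top sequentially"
    by (rule filterlim_tendsto_pos_mult_at_top[OF tendsto_const _ n_at_top]) simp
  then have "filterlim r at_top sequentially"
    unfolding r_def by (rule filterlim_compose[OF sqrt_at_top])
  from tendsto_inverse_0_at_top[OF this] show ?thesis by (simp add: inverse_eq_divide)
qed

lemma weight_nonneg: "0 \<le> weight k c"
  using n_ge_1[of k] by (simp add: box_weight_nonneg)

lemma weight_eq: "weight k c = (real c / r k) * (real c / r k + 1 / r k)"
  unfolding box_weight_def r_mult_r[symmetric] by (simp add: distrib_left add_divide_distrib)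

lemma weight_tendsto:
  assumes z: "z \<ge> 0" shows "(\<lambda>k. weight k (nat \<lfloor>r k * z\<rfloor>)) \<longlonglongrightarrow> z\<^sup>2"
proof -
  have "(\<lambda>k. real (nat \<lfloor>r k * z\<rfloor>) / r k) \<longlonglongrightarrow> z"
    by (rule tendsto_nat_floor_scaled[OF r_pos inverse_r_tendsto_0 z])
  from tendsto_mult[OF this tendsto_add[OF this inverse_r_tendsto_0]] show ?thesis
    unfolding weight_eq by (simp add: power2_eq_square)
qed

lemma sqrt_weight_bounds:
  shows "real c / r k \<le> sqrt (weight k c)" and "sqrt (weight k c) \<le> real c / r k + 1 / r k"
proof -
  let ?x = "real c / r k" and ?y = "real c / r k + 1 / r k"
  have xy: "0 \<le> ?x" "?x \<le> ?y" using r_pos[of k] by auto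
  have "?x\<^sup>2 \<le> ?x * ?y" "?x * ?y \<le> ?y\<^sup>2"
    unfolding power2_eq_square using xy by (intro mult_mono; simp)+
  then show "?x \<le> sqrt (weight k c)" "sqrt (weight k c) \<le> ?y"
    unfolding weight_eq using xy by (auto intro: real_le_rsqrt real_le_lsqrt)
qed

context
  fixes k :: nat and E :: "(nat \<times> nat) set"
  assumes E: "balanced C (n k) E"
begin

lemma box_content_less:
  assumes "b \<in> E" shows "real (box_content b) < C * r k"
proof -
  have "real (box_content b) + 1 \<le> C * sqrt (n k)" using E assms by (simp add: balanced_def)
  also have "\<dots> \<le> C * r k" using C_pos n_ge_1[of k] by (simp add: r_def)
  finally show ?thesis by simp
qed

lemma diag_count_eq_0_of_ge: "real c \<ge> C * r k \<Longrightarrow> diag_count c E = 0"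
  using box_content_less by (intro diag_count_eq_0) fastforce

lemma diag_count_le_scaled: "real (diag_count c E) \<le> C * r k"
proof -
  have "diag_count c E \<le> nat \<lfloor>C * sqrt (n k)\<rfloor>"
    using E by (intro diag_count_le_content_bound) (force simp: balanced_def le_nat_floor less_eq_Suc_le)+
  then have "real (diag_count c E) \<le> C * sqrt (n k)"
    using C_pos n_ge_1[of k] by (simp add: le_nat_iff le_floor_iff)
  also have "\<dots> \<le> C * r k" using C_pos n_ge_1[of k] by (simp add: r_def)
  finally show ?thesis .
qed

lemma statistic_eq_riemann_sum:
  assumes K: "real K \<ge> C * r k"
  shows "(\<Sum>b\<in>E. h (weight k (box_content b))) / (2 * n k) =
    (\<Sum>c<K. real (diag_count c E) / r k * h (weight k c)) / r k"
proof -
  have "finite E" "\<And>b. b \<in> E \<Longrightarrow> box_content b < K"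
    using E finite_shifted_shape box_content_less K by (force simp: balanced_def)+
  from sum_by_content[OF this, of "\<lambda>c. h (weight k c)"] show ?thesis
    unfolding r_mult_r[symmetric] by (simp add: sum_divide_distrib)
qed

lemma diag_count_mult_weight_power_le:
  "\<bar>real (diag_count c E) / r k * weight k c ^ j\<bar> \<le> C * (C\<^sup>2 / 2) ^ j"
proof (cases "diag_count c E = 0")
  case True
  then show ?thesis using C_pos by simp
next
  case False
  then obtain b where b: "b \<in> E" "box_content b = c"
    unfolding diag_count_def by (metis (mono_tags, lifting) card.empty empty_Collect_eq)
  then have "weight k c \<le> C\<^sup>2 / 2"
    using balanced_box_weight_le[OF E b(1)] n_ge_1[of k] by simp
  moreover have "real (diag_count c E) / r k \<le> C"
    using diag_count_le_scaled r_pos[of k] by (simp add: divide_le_eq)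
  ultimately have "real (diag_count c E) / r k * weight k c ^ j \<le> C * (C\<^sup>2 / 2) ^ j"
    using weight_nonneg C_pos by (intro mult_mono power_mono) auto
  then show ?thesis using weight_nonneg[of k c] r_pos[of k] by (simp add: abs_mult)
qed

end

lemma box_moment_convergent:
  assumes D: "\<And>k. balanced C (n k) (D k)"
    and heights: "\<And>z. z \<ge> 0 \<Longrightarrow> (\<lambda>k. diag_height (r k) z (D k)) \<longlonglongrightarrow> h z"
  shows "convergent (\<lambda>k. box_moment (2 * n k) j (D k))"
proof -
  define F where "F k c = real (diag_count c (D k)) / r k * weight k c ^ j" for k c
  define K where "K k = nat \<lceil>C * r k\<rceil>" for k
  have K: "real (K k) \<ge> C * r k" for k unfolding K_def by linarith
  have "(\<lambda>k. (\<Sum>c<K k. F k c) / r k) \<longlonglongrightarrow> integral {0..C + 1} (\<lambda>z. h z * (z\<^sup>2) ^ j)"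
  proof (rule riemann_sum_tendsto_integral[OF r_ge_1 _ _ _ _ K])
    show "F k c = 0" if "real c \<ge> C * r k" for k c
      using diag_count_eq_0_of_ge[OF D that] by (simp add: F_def)
    show "\<bar>F k c\<bar> \<le> C * (C\<^sup>2 / 2) ^ j" for k c
      unfolding F_def by (rule diag_count_mult_weight_power_le[OF D])
    show "(\<lambda>k. F k (nat \<lfloor>r k * z\<rfloor>)) \<longlonglongrightarrow> h z * (z\<^sup>2) ^ j" if "z \<ge> 0" for z
      unfolding F_def
      by (intro tendsto_mult tendsto_power weight_tendsto[OF that] heights[OF that, unfolded diag_height_def])
  qed (use C_pos in simp)
  moreover have "box_moment (2 * n k) j (D k) = (\<Sum>c<K k. F k c) / r k" for k
    unfolding box_moment_def F_def by (rule statistic_eq_riemann_sum[OF D K])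
  ultimately show ?thesis by (auto simp: convergent_def)
qed

definition hat_statistic :: "real \<Rightarrow> real \<Rightarrow> nat \<Rightarrow> (nat \<times> nat) set \<Rightarrow> real" where
  "hat_statistic z \<eta> k E = (\<Sum>b\<in>E. hat z \<eta> (weight k (box_content b))) / (2 * n k)"

definition hat_mass :: "real \<Rightarrow> real \<Rightarrow> nat \<Rightarrow> real" where
  "hat_mass z \<eta> k = (\<Sum>c<nat \<lceil>(C + z + \<eta>) * r k\<rceil>. hat z \<eta> (weight k c)) / r k"

lemma hat_statistic_bounds:
  assumes "balanced C (n k) E" "\<eta> > 0"
  shows "0 \<le> hat_statistic z \<eta> k E" "hat_statistic z \<eta> k E \<le> 1"
proof -
  have "(\<Sum>b\<in>E. hat z \<eta> (weight k (box_content b))) \<le> (\<Sum>b\<in>E. 1)"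
    by (rule sum_mono) (rule hat_le_1[OF assms(2)])
  also have "\<dots> \<le> 2 * n k" using assms n_ge_1[of k] by (simp add: balanced_def)
  finally show "hat_statistic z \<eta> k E \<le> 1" using n_ge_1[of k] by (simp add: hat_statistic_def divide_le_eq)
  show "0 \<le> hat_statistic z \<eta> k E"
    using n_ge_1[of k] by (auto simp: hat_statistic_def hat_nonneg intro!: divide_nonneg_nonneg sum_nonneg)
qed

lemma hat_mass_tendsto:
  assumes \<eta>: "\<eta> > 0" and z: "z \<ge> 0"
  shows "hat_mass z \<eta> \<longlonglongrightarrow> integral {0..z + \<eta> + 1} (\<lambda>t. hat z \<eta> (t\<^sup>2))"
  unfolding hat_mass_def
proof (rule riemann_sum_tendsto_integral[where A = 1, OF r_ge_1])
  show "0 \<le> z + \<eta>" using \<eta> z by simp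
  show "real (nat \<lceil>(C + z + \<eta>) * r k\<rceil>) \<ge> (z + \<eta>) * r k" for k
  proof -
    have "(z + \<eta>) * r k \<le> (C + z + \<eta>) * r k" using C_pos r_pos[of k] by (intro mult_right_mono) auto
    then show ?thesis by linarith
  qed
  show "\<bar>hat z \<eta> (weight k c)\<bar> \<le> 1" for k c using hat_nonneg hat_le_1[OF \<eta>] by simp
  show "hat z \<eta> (weight k c) = 0" if "(z + \<eta>) * r k \<le> real c" for k c
  proof -
    have "z + \<eta> \<le> real c / r k" using that r_pos[of k] by (simp add: le_divide_eq)
    then show ?thesis using hat_support[OF \<eta>] sqrt_weight_bounds(1)[of c k] by fastforce
  qed
  show "(\<lambda>k. hat z \<eta> (weight k (nat \<lfloor>r k * t\<rfloor>))) \<longlonglongrightarrow> hat z \<eta> (t\<^sup>2)" if "0 \<le> t" for t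
  proof (rule isCont_tendsto_compose[OF _ weight_tendsto[OF that]])
    show "isCont (hat z \<eta>) (t\<^sup>2)"
      using continuous_on_hat[OF \<eta>, of UNIV z] by (simp add: continuous_on_eq_continuous_at)
  qed
qed

text \<open>The heights of a shape are Lipschitz, hence close to their averages against narrow hat functions.\<close>

lemma diag_height_near_hat_average:
  assumes E: "balanced C (n k) E" and \<eta>: "\<eta> > 0" and z: "z \<ge> 0" and mass: "hat_mass z \<eta> k > 0"
  shows "\<bar>diag_height (r k) z E - hat_statistic z \<eta> k E / hat_mass z \<eta> k\<bar> \<le> \<eta> + 2 / r k"
proof -
  define K where "K = nat \<lceil>(C + z + \<eta>) * r k\<rceil>"
  define m where "m = (\<Sum>c<K. hat z \<eta> (weight k c))"
  let ?x = "diag_height (r k) z E" and ?g = "\<lambda>c. real (diag_count c E) / r k"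
  have shape: "shifted_shape E" using E by (simp add: balanced_def)
  have hat_mass: "hat_mass z \<eta> k = m / r k" by (simp add: hat_mass_def K_def m_def)
  then have m: "m > 0" using mass r_pos[of k] by (simp add: zero_less_divide_iff)
  have "C * r k \<le> (C + z + \<eta>) * r k" using \<eta> z r_pos[of k] by (intro mult_right_mono) auto
  then have "C * r k \<le> real K" unfolding K_def by linarith
  define S where "S = (\<Sum>c<K. ?g c * hat z \<eta> (weight k c))"
  have average: "hat_statistic z \<eta> k E / hat_mass z \<eta> k = S / m"
    using statistic_eq_riemann_sum[OF E \<open>C * r k \<le> real K\<close>, of "hat z \<eta>"] r_pos[of k]
    by (simp add: hat_statistic_def hat_mass S_def)
  have deviation: "\<bar>S - ?x * m\<bar> \<le> (\<eta> + 2 / r k) * m"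
    unfolding m_def S_def
  proof (rule abs_weighted_sum_deviation_le)
    fix c assume "hat z \<eta> (weight k c) \<noteq> 0"
    then have "\<bar>real c / r k - z\<bar> \<le> \<eta> + 1 / r k"
      using hat_support[OF \<eta>, of z "weight k c"] sqrt_weight_bounds(1)[of c k] sqrt_weight_bounds(2)[of k c] by linarith
    then show "\<bar>?g c - ?x\<bar> \<le> \<eta> + 2 / r k"
      using abs_diag_count_minus_diag_height_le[OF r_pos shape z, of c k] by simp
  qed (rule hat_nonneg)
  have "?x - S / m = - ((S - ?x * m) / m)" using m by (simp add: diff_divide_distrib)
  then have "\<bar>?x - S / m\<bar> = \<bar>S - ?x * m\<bar> / m" using m by (simp only: abs_minus_cancel abs_divide abs_of_pos)
  also have "\<dots> \<le> \<eta> + 2 / r k" using deviation m by (simp add: divide_le_eq)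
  finally show ?thesis unfolding average .
qed

end

locale balanced_random_shapes = scale_sequence n C + finite_pmf_sequence P
  for n :: "nat \<Rightarrow> real" and C :: real and P :: "nat \<Rightarrow> 'a pmf" +
  fixes E :: "nat \<Rightarrow> 'a \<Rightarrow> (nat \<times> nat) set"
  assumes balanced_E: "T \<in> set_pmf (P k) \<Longrightarrow> balanced C (n k) (E k T)"
begin

abbreviation series :: "nat \<Rightarrow> 'a \<Rightarrow> real fps" where
  "series k T \<equiv> shape_series (2 * n k) (E k T)"

lemma coeffs_bounded_series: "coeffs_bounded series"
  unfolding coeffs_bounded_def
proof (intro allI exI ballI)
  fix j k T assume T: "T \<in> set_pmf (P k)"
  have "n k > 0" using n_ge_1[of k] by linarith
  from fps_seminorm_shape_series_le[OF balanced_E[OF T] this, of j]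
  show "\<bar>fps_nth (series k T) j\<bar> \<le> shape_series_bound C j"
    using norm_fps_nth_le[of j j "series k T"] by simp
qed

lemma coeffs_convergent_log_deriv_iff_moments:
  "coeffs_convergent (\<lambda>k T. fps_log_deriv (series k T)) \<longleftrightarrow>
    (\<forall>j. convergent_in_mean (\<lambda>k T. box_moment (2 * n k) j (E k T)))"
proof -
  let ?s = "\<lambda>j k T. fps_nth (fps_log_deriv (series k T)) j" and ?p = "\<lambda>j k T. box_moment (2 * n k) j (E k T)"
  have Suc_iff: "convergent_in_mean (?s (Suc j)) \<longleftrightarrow> convergent_in_mean (?p j)" for j
  proof -
    define a where "a = real (Suc j) * (4 * real (Suc j) - 2)"
    let ?B = "log_deriv_error (C\<^sup>2 / 2) (Suc j)"
    have error: "(\<lambda>k. ?B * (1 / n k)) \<longlonglongrightarrow> 0"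
      by (rule tendsto_mult_right_zero[OF inverse_n_tendsto_0])
    have close: "\<bar>?s (Suc j) k T - - a * ?p j k T\<bar> \<le> ?B * (1 / n k)" if "T \<in> set_pmf (P k)" for k T
      using log_deriv_shape_series_approx[OF balanced_E[OF that] n_ge_1, of j] by (simp add: a_def)
    have "convergent_in_mean (?s (Suc j)) \<longleftrightarrow> convergent_in_mean (\<lambda>k T. - a * ?p j k T)"
      by (rule convergent_in_mean_iff_close[OF error close])
    also have "\<dots> \<longleftrightarrow> convergent_in_mean (?p j)"
      using convergent_in_mean_cmult[of "\<lambda>k T. - a * ?p j k T" "- (1 / a)"] convergent_in_mean_cmult[of "?p j" "- a"]
      by (auto simp: a_def)
    finally show ?thesis .
  qed
  have zero: "convergent_in_mean (?s 0)" by (simp add: fps_log_deriv_nth_0 convergent_in_mean_const)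
  have "(\<forall>j. convergent_in_mean (?s j)) \<longleftrightarrow> (\<forall>j. convergent_in_mean (?s (Suc j)))"
  proof (intro iffI allI)
    fix j assume "\<forall>j. convergent_in_mean (?s (Suc j))"
    then show "convergent_in_mean (?s j)" using zero by (cases j) simp_all
  qed blast
  then show ?thesis unfolding coeffs_convergent_def by (simp only: Suc_iff)
qed

lemma coeffs_convergent_iff_moments:
  "coeffs_convergent series \<longleftrightarrow> (\<forall>j. convergent_in_mean (\<lambda>k T. box_moment (2 * n k) j (E k T)))"
  using coeffs_convergent_log_deriv[of series] coeffs_convergent_of_log_deriv[of series]
  by (auto simp: coeffs_bounded_series shape_series_nth_0 coeffs_convergent_log_deriv_iff_moments)

lemma continuous_statistic_convergent:
  assumes moments: "\<And>j. convergent_in_mean (\<lambda>k T. box_moment (2 * n k) j (E k T))"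
    and h: "continuous_on {0..C\<^sup>2 / 2} h"
  shows "convergent_in_mean (\<lambda>k T. (\<Sum>b\<in>E k T. h (weight k (box_content b))) / (2 * n k))"
proof (rule convergent_in_mean_approx)
  fix \<epsilon> :: real assume \<epsilon>: "\<epsilon> > 0"
  obtain g where g: "real_polynomial_function g" "\<And>x. x \<in> {0..C\<^sup>2 / 2} \<Longrightarrow> \<bar>h x - g x\<bar> < \<epsilon>"
    using Stone_Weierstrass_real_polynomial_function[OF _ h \<epsilon>] by auto
  obtain a d where a: "g = (\<lambda>x. \<Sum>i\<le>(d::nat). a i * x ^ i)"
    using real_polynomial_function_imp_sum[OF g(1)] by blast
  let ?S = "\<lambda>f k T. (\<Sum>b\<in>E k T. f (weight k (box_content b))) / (2 * n k)"
  have "?S g k T = (\<Sum>i\<le>d. a i * box_moment (2 * n k) i (E k T))" for k T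
    unfolding a box_moment_def by (subst sum.swap) (simp add: sum_distrib_left sum_divide_distrib)
  then have "convergent_in_mean (?S g)"
    by (simp only:) (intro convergent_in_mean_sum convergent_in_mean_cmult moments)
  moreover have "mean k (\<lambda>T. \<bar>?S h k T - ?S g k T\<bar>) \<le> mean k (\<lambda>_. \<epsilon>)" for k
  proof (rule mean_mono)
    fix T assume T: "T \<in> set_pmf (P k)"
    have "\<bar>\<Sum>b\<in>E k T. h (weight k (box_content b)) - g (weight k (box_content b))\<bar> \<le> (\<Sum>b\<in>E k T. \<epsilon>)"
    proof (intro order_trans[OF sum_abs] sum_mono)
      fix b assume "b \<in> E k T"
      then have "weight k (box_content b) \<in> {0..C\<^sup>2 / 2}"
        using balanced_box_weight_le[OF balanced_E[OF T]] weight_nonneg n_ge_1[of k] by simp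
      then show "\<bar>h (weight k (box_content b)) - g (weight k (box_content b))\<bar> \<le> \<epsilon>"
        using g(2) by (simp add: less_imp_le)
    qed
    also have "\<dots> \<le> \<epsilon> * (2 * n k)"
      using balanced_E[OF T] n_ge_1[of k] \<epsilon> by (simp add: balanced_def mult.commute)
    finally have "\<bar>\<Sum>b\<in>E k T. h (weight k (box_content b)) - g (weight k (box_content b))\<bar> / (2 * n k) \<le> \<epsilon>"
      using n_ge_1[of k] by (subst pos_divide_le_eq) auto
    then show "\<bar>?S h k T - ?S g k T\<bar> \<le> \<epsilon>"
      using n_ge_1[of k] by (simp add: sum_subtractf flip: diff_divide_distrib)
  qed
  ultimately show "\<exists>W. convergent_in_mean W \<and>
      (\<forall>\<^sub>F k in sequentially. mean k (\<lambda>T. \<bar>?S h k T - W k T\<bar>) \<le> \<epsilon>)"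
    by (intro exI[of _ "?S g"]) simp
qed

lemma diag_height_convergent:
  assumes moments: "\<And>j. convergent_in_mean (\<lambda>k T. box_moment (2 * n k) j (E k T))" and z: "z \<ge> 0"
  shows "convergent_in_mean (\<lambda>k T. diag_height (r k) z (E k T))"
proof (rule convergent_in_mean_approx)
  fix \<epsilon> :: real assume "\<epsilon> > 0"
  define \<eta> where "\<eta> = \<epsilon> / 2"
  have \<eta>: "\<eta> > 0" using \<open>\<epsilon> > 0\<close> by (simp add: \<eta>_def)
  let ?X = "\<lambda>k T. hat_statistic z \<eta> k (E k T)" and ?m = "hat_mass z \<eta>"
  have mass: "?m \<longlonglongrightarrow> integral {0..z + \<eta> + 1} (\<lambda>t. hat z \<eta> (t\<^sup>2))"
    by (rule hat_mass_tendsto[OF \<eta> z])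
  have pos: "integral {0..z + \<eta> + 1} (\<lambda>t. hat z \<eta> (t\<^sup>2)) > 0"
    using \<eta> z by (intro integral_hat_pos) auto
  have "convergent (\<lambda>k. 1 / ?m k)"
    using tendsto_divide[OF tendsto_const mass] pos by (auto simp: convergent_def)
  moreover have "convergent_in_mean ?X"
    unfolding hat_statistic_def by (rule continuous_statistic_convergent[OF moments continuous_on_hat[OF \<eta>]])
  moreover have "\<bar>?X k T\<bar> \<le> 1" if "T \<in> set_pmf (P k)" for k T
    using hat_statistic_bounds[OF balanced_E[OF that] \<eta>, of z] by simp
  ultimately have "convergent_in_mean (\<lambda>k T. 1 / ?m k * ?X k T)"
    by (intro convergent_in_mean_mult convergent_in_mean_deterministic) blast+
  moreover have "\<forall>\<^sub>F k in sequentially. mean k (\<lambda>T. \<bar>diag_height (r k) z (E k T) - 1 / ?m k * ?X k T\<bar>) \<le> \<epsilon>"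
    using order_tendstoD(1)[OF mass pos] order_tendstoD(2)[OF inverse_r_tendsto_0 half_gt_zero[OF \<eta>]]
  proof eventually_elim
    case (elim k)
    have "mean k (\<lambda>T. \<bar>diag_height (r k) z (E k T) - 1 / ?m k * ?X k T\<bar>) \<le> mean k (\<lambda>_. \<eta> + 2 / r k)"
      using diag_height_near_hat_average[OF balanced_E \<eta> z elim(1)] by (intro mean_mono) simp
    then show ?case using elim(2) by (simp add: \<eta>_def)
  qed
  ultimately show "\<exists>W. convergent_in_mean W \<and>
      (\<forall>\<^sub>F k in sequentially. mean k (\<lambda>T. \<bar>diag_height (r k) z (E k T) - W k T\<bar>) \<le> \<epsilon>)"
    by blast
qed

end

section \<open>Level curves of a growing family of heights\<close>

definition level_function :: "(real \<Rightarrow> real \<Rightarrow> real) \<Rightarrow> real \<times> real \<Rightarrow> real" where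
  "level_function G = (\<lambda>(x, y). Inf (insert 1 {\<beta>. 0 < \<beta> \<and> \<beta> < 1 \<and> y < G \<beta> (x - y)}))"

lemma bdd_below_levels:
  fixes G :: "real \<Rightarrow> real \<Rightarrow> real"
  shows "bdd_below (insert 1 {\<beta>. 0 < \<beta> \<and> \<beta> < 1 \<and> y < G \<beta> u})"
  by (rule bdd_belowI[of _ 0]) auto

lemma level_function_in_unit_interval: "level_function G p \<in> {0..1}"
proof -
  obtain x y where p: "p = (x, y)" by (cases p)
  have "0 \<le> level_function G p" unfolding level_function_def p prod.case by (rule cInf_greatest) auto
  moreover have "level_function G p \<le> 1"
    unfolding level_function_def p prod.case by (rule cInf_lower[OF _ bdd_below_levels]) simp
  ultimately show ?thesis by simp
qed

lemma level_function_le: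
  assumes "0 < \<alpha>" "\<alpha> < 1" "y < G \<alpha> (x - y)" shows "level_function G (x, y) \<le> \<alpha>"
  unfolding level_function_def prod.case by (rule cInf_lower[OF _ bdd_below_levels]) (use assms in simp)

lemma le_of_level_function_le:
  assumes mono: "\<And>\<beta> \<gamma>. 0 < \<beta> \<Longrightarrow> \<beta> \<le> \<gamma> \<Longrightarrow> \<gamma> < 1 \<Longrightarrow> G \<beta> (x - y) \<le> G \<gamma> (x - y)"
    and right_cont: "\<And>e. e > 0 \<Longrightarrow> \<exists>\<beta>>\<alpha>. \<beta> < 1 \<and> G \<beta> (x - y) < G \<alpha> (x - y) + e"
    and level: "level_function G (x, y) \<le> \<alpha>"
  shows "y \<le> G \<alpha> (x - y)"
proof (rule ccontr)
  assume "\<not> y \<le> G \<alpha> (x - y)"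
  then obtain \<beta> where \<beta>: "\<alpha> < \<beta>" "\<beta> < 1" "G \<beta> (x - y) < y"
    using right_cont[of "y - G \<alpha> (x - y)"] by auto
  have "Inf (insert 1 {\<beta>. 0 < \<beta> \<and> \<beta> < 1 \<and> y < G \<beta> (x - y)}) < \<beta>"
    using level \<beta>(1) by (simp add: level_function_def)
  then obtain \<gamma> where "\<gamma> \<in> insert 1 {\<beta>. 0 < \<beta> \<and> \<beta> < 1 \<and> y < G \<beta> (x - y)}" "\<gamma> < \<beta>"
    using cInf_less_iff[OF _ bdd_below_levels] by blast
  then show False using mono[of \<gamma> \<beta>] \<beta> by auto
qed

lemma Sup_eq_of_half_open_subset:
  fixes a b :: real
  assumes "a \<le> b" and lower: "{a..<b} \<subseteq> H" and upper: "H \<subseteq> {a..b}"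
  shows "(if H = {} then a else Sup H) = b"
proof (cases "a = b")
  case True
  then have "H = {} \<or> H = {b}" using upper by auto
  then show ?thesis using True by auto
next
  case False
  then have "a < b" using assms(1) by simp
  then have "a \<in> H" using lower by auto
  then have "Sup H \<le> b" using upper by (intro cSup_least) auto
  moreover have "b \<le> Sup H"
    using cSup_subset_mono[OF _ bdd_above_mono[OF bdd_above_Icc upper] lower] \<open>a < b\<close> by simp
  ultimately show ?thesis using \<open>a \<in> H\<close> by auto
qed

lemma level_curve_level_function:
  assumes nonneg: "0 \<le> G \<alpha> z" and le: "z + 2 * G \<alpha> z \<le> \<Omega> z"
    and mono: "\<And>\<beta> \<gamma>. 0 < \<beta> \<Longrightarrow> \<beta> \<le> \<gamma> \<Longrightarrow> \<gamma> < 1 \<Longrightarrow> G \<beta> z \<le> G \<gamma> z"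
    and right_cont: "\<And>e. e > 0 \<Longrightarrow> \<exists>\<beta>>\<alpha>. \<beta> < 1 \<and> G \<beta> z < G \<alpha> z + e"
    and z: "z \<ge> 0" and \<alpha>: "0 < \<alpha>" "\<alpha> < 1"
  shows "level_curve (limit_region \<Omega>) (level_function G) \<alpha> z = z + 2 * G \<alpha> z"
proof -
  define H where "H = level_heights (limit_region \<Omega>) (level_function G) \<alpha> z"
  have lower: "{z..<z + 2 * G \<alpha> z} \<subseteq> H"
  proof
    fix t assume t: "t \<in> {z..<z + 2 * G \<alpha> z}"
    let ?x = "(t + z) / 2" and ?y = "(t - z) / 2"
    have diff: "?x - ?y = z" and sum: "?x + ?y = t" by (simp_all add: field_simps)
    have "?y < G \<alpha> z" using t by simp
    then have "level_function G (?x, ?y) \<le> \<alpha>" by (intro level_function_le[OF \<alpha>]) (simp only: diff)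
    moreover have "(?x, ?y) \<in> limit_region \<Omega>"
      using t le z unfolding limit_region_def mem_Collect_eq prod.case diff sum by simp
    ultimately show "t \<in> H"
      unfolding H_def level_heights_def
      by (intro CollectI exI[of _ ?x] exI[of _ ?y] conjI sum[symmetric] diff)
  qed
  have upper: "H \<subseteq> {z..z + 2 * G \<alpha> z}"
  proof
    fix t assume "t \<in> H"
    then obtain x y where xy: "t = x + y" "(x, y) \<in> limit_region \<Omega>" "x - y = z" "level_function G (x, y) \<le> \<alpha>"
      by (auto simp: H_def level_heights_def)
    have "y \<le> G \<alpha> (x - y)" by (rule le_of_level_function_le[OF _ _ xy(4)]) (use mono right_cont xy(3) in auto)
    moreover have "0 \<le> y" using xy(2) by (simp add: limit_region_def)
    ultimately show "t \<in> {z..z + 2 * G \<alpha> z}" using xy by auto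
  qed
  have "z \<le> z + 2 * G \<alpha> z" using nonneg by simp
  from Sup_eq_of_half_open_subset[OF this lower upper] show ?thesis
    unfolding level_curve_def H_def[symmetric] abs_of_nonneg[OF z] .
qed

text \<open>Between two grid points monotonicity sandwiches \<open>f\<close>, and \<open>g\<close> varies by at most the mesh.\<close>

lemma abs_diff_le_from_grid:
  fixes f g :: "real \<Rightarrow> real"
  assumes f: "\<And>x y. 0 \<le> x \<Longrightarrow> x \<le> y \<Longrightarrow> f y \<le> f x" "\<And>x. 0 \<le> x \<Longrightarrow> 0 \<le> f x"
    and g: "\<And>x y. 0 \<le> x \<Longrightarrow> x \<le> y \<Longrightarrow> g y \<le> g x" "\<And>x. 0 \<le> x \<Longrightarrow> 0 \<le> g x"
      "\<And>x y. 0 \<le> x \<Longrightarrow> x \<le> y \<Longrightarrow> g x \<le> g y + (y - x)"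
    and g0: "g (real L * \<eta>) = 0" and \<eta>: "\<eta> > 0"
    and grid: "\<And>i. i \<le> L \<Longrightarrow> \<bar>f (real i * \<eta>) - g (real i * \<eta>)\<bar> \<le> \<delta>" and x: "x \<ge> 0"
  shows "\<bar>f x - g x\<bar> \<le> \<delta> + \<eta>"
proof (cases "x < real L * \<eta>")
  case True
  define i where "i = nat \<lfloor>x / \<eta>\<rfloor>"
  let ?a = "real i * \<eta>" and ?b = "real (Suc i) * \<eta>"
  have "0 \<le> x / \<eta>" using x \<eta> by simp
  then have "real i \<le> x / \<eta>" "x / \<eta> < real i + 1" by (auto simp: i_def)
  then have i: "?a \<le> x" "x \<le> ?b" using \<eta> by (auto simp: field_simps)
  have "?a < real L * \<eta>" using i True by linarith
  then have iL: "i \<le> L" "Suc i \<le> L" using \<eta> by auto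
  have a: "0 \<le> ?a" and mesh: "?b - ?a = \<eta>" using \<eta> by (auto simp: algebra_simps)
  show ?thesis
    using grid[OF iL(1)] grid[OF iL(2)] f(1)[OF a i(1)] f(1)[OF x i(2)] g(3)[OF a i(1)] g(3)[OF x i(2)] i mesh
    by linarith
next
  case False
  then have L: "real L * \<eta> \<le> x" and L0: "0 \<le> real L * \<eta>" using \<eta> by auto
  then have "g x = 0" using g(1)[OF L0 L] g(2)[OF x] g0 by linarith
  then show ?thesis using grid[of L] f(1)[OF L0 L] f(2)[OF x] g0 \<eta> by linarith
qed

section \<open>The limit shape of random tableaux\<close>

locale balanced_shape_sequence =
  fixes D :: "nat \<Rightarrow> (nat \<times> nat) set" and C :: real and h\<^sub>1 :: "real \<Rightarrow> real"
  assumes D_nonempty: "D k \<noteq> {}" and card_D_at_top: "filterlim (\<lambda>k. card (D k)) at_top sequentially"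
    and balance_pos: "C > 0" and balanced_D: "balanced C (card (D k)) (D k)"
    and height_D: "z \<ge> 0 \<Longrightarrow> (\<lambda>k. diag_height (sqrt (2 * real (card (D k)))) z (D k)) \<longlonglongrightarrow> h\<^sub>1 z"
begin

abbreviation N :: "nat \<Rightarrow> real" where "N k \<equiv> real (card (D k))"

definition tableau_pmf :: "nat \<Rightarrow> (nat \<times> nat \<Rightarrow> nat) pmf" where
  "tableau_pmf k = pmf_of_set (standard_tableaux (D k))"

lemma shape_D: "shifted_shape (D k)"
  using balanced_D[of k] by (simp add: balanced_def)

lemma set_tableau_pmf: "set_pmf (tableau_pmf k) = standard_tableaux (D k)"
  unfolding tableau_pmf_def using shape_D
  by (intro set_pmf_of_set standard_tableaux_nonempty finite_linear_extensions finite_shifted_shape)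

sublocale scale_sequence N C
proof
  show "N k \<ge> 1" for k
    using D_nonempty[of k] finite_shifted_shape[OF shape_D, of k] by (simp add: Suc_le_eq card_gt_0_iff)
  show "filterlim N at_top sequentially"
    by (rule filterlim_compose[OF filterlim_real_sequentially card_D_at_top])
qed (rule balance_pos)

sublocale full: balanced_random_shapes N C tableau_pmf "\<lambda>k T. D k"
  by unfold_locales
     (auto simp: set_tableau_pmf balanced_D intro: finite_linear_extensions finite_shifted_shape[OF shape_D])

definition sublevel :: "real \<Rightarrow> nat \<Rightarrow> (nat \<times> nat \<Rightarrow> nat) \<Rightarrow> (nat \<times> nat) set" where
  "sublevel \<alpha> k T = {b \<in> D k. real (T b) \<le> \<alpha> * N k}"

lemma sublevel_subset: "sublevel \<alpha> k T \<subseteq> D k"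
  by (auto simp: sublevel_def)

lemma sublevel_mono:
  assumes "\<alpha> \<le> \<beta>" shows "sublevel \<alpha> k T \<subseteq> sublevel \<beta> k T"
  using mult_right_mono[OF assms, of "N k"] by (force simp: sublevel_def)

lemma sublevel_eq_nat:
  assumes "0 \<le> \<alpha>" shows "sublevel \<alpha> k T = {b \<in> D k. T b \<le> nat \<lfloor>N k * \<alpha>\<rfloor>}"
proof -
  have "0 \<le> N k * \<alpha>" using assms by simp
  then show ?thesis by (auto simp: sublevel_def le_nat_floor mult.commute le_nat_iff le_floor_iff)
qed

lemma nat_floor_level_le:
  assumes "0 \<le> \<alpha>" "\<alpha> \<le> 1" shows "nat \<lfloor>N k * \<alpha>\<rfloor> \<le> card (D k)"
proof -
  have "N k * \<alpha> \<le> N k" using assms by (intro mult_left_le) auto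
  then show ?thesis by linarith
qed

lemma card_sublevel_eq:
  assumes "0 \<le> \<alpha>" "\<alpha> \<le> 1" "T \<in> standard_tableaux (D k)"
  shows "card (sublevel \<alpha> k T) = nat \<lfloor>N k * \<alpha>\<rfloor>"
  unfolding sublevel_eq_nat[OF assms(1)] by (rule card_sublevel[OF assms(3) nat_floor_level_le[OF assms(1,2)]])

lemma level_ratio_tendsto: "\<alpha> \<ge> 0 \<Longrightarrow> (\<lambda>k. real (nat \<lfloor>N k * \<alpha>\<rfloor>) / N k) \<longlonglongrightarrow> \<alpha>"
  using n_ge_1 by (intro tendsto_nat_floor_scaled inverse_n_tendsto_0) (force intro: less_le_trans[OF zero_less_one])+

lemma balanced_sublevel:
  assumes "0 \<le> \<alpha>" "T \<in> standard_tableaux (D k)" shows "balanced C (N k) (sublevel \<alpha> k T)"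
  unfolding sublevel_eq_nat[OF assms(1)]
  by (rule sublevel_hereditary[where Q = "balanced C (N k)",
        OF balanced_remove_corner balanced_D finite_shifted_shape[OF shape_D] assms(2)])

lemma shape_sublevel: "0 \<le> \<alpha> \<Longrightarrow> T \<in> standard_tableaux (D k) \<Longrightarrow> shifted_shape (sublevel \<alpha> k T)"
  using balanced_sublevel by (simp add: balanced_def)

lemma balanced_random_shapes_sublevel:
  assumes "0 \<le> \<alpha>" shows "balanced_random_shapes N C tableau_pmf (sublevel \<alpha>)"
  by unfold_locales (simp add: set_tableau_pmf balanced_sublevel[OF assms])

lemma coeffs_convergent_full: "full.coeffs_convergent (\<lambda>k T. shape_series (2 * N k) (D k))"
  unfolding full.coeffs_convergent_iff_moments
  using box_moment_convergent[OF balanced_D height_D[folded r_def]] full.convergent_in_mean_deterministic by blast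

lemma power_coeff_sublevel_convergent:
  assumes \<alpha>: "0 \<le> \<alpha>" "\<alpha> \<le> 1" and j: "j \<ge> 1"
  shows "full.convergent_in_mean (\<lambda>k T. power_coeff (2 * j - 1) j (2 * N k) (sublevel \<alpha> k T))"
proof -
  define a where "a = 2 * j - 1"
  define m where "m k = nat \<lfloor>N k * \<alpha>\<rfloor>" for k
  define \<rho> where "\<rho> k = power_coeff a j (2 * N k) (D k)" for k
  let ?X = "\<lambda>k T. power_coeff a j (2 * N k) (sublevel \<alpha> k T)"
  let ?W = "\<lambda>k T. \<rho> k * (real (m k) / N k) ^ a"
  have \<rho>: "full.convergent_in_mean (\<lambda>k T. \<rho> k)"
    using full.coeffs_convergent_power[OF coeffs_convergent_full full.coeffs_bounded_series, of a]
    by (simp add: full.coeffs_convergent_def \<rho>_def power_coeff_def)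
  have ratio: "convergent (\<lambda>k. (real (m k) / N k) ^ a)"
    unfolding m_def convergent_def using tendsto_power[OF level_ratio_tendsto[OF \<alpha>(1)]] by blast
  have "\<bar>(real (m k) / N k) ^ a\<bar> \<le> 1" for k
    using nat_floor_level_le[OF \<alpha>, of k] by (simp add: m_def power_abs power_le_one divide_le_eq)
  then have W: "full.convergent_in_mean ?W"
    by (intro full.convergent_in_mean_mult[OF \<rho> full.convergent_in_mean_deterministic[OF ratio]]) blast
  have "full.mean k (\<lambda>T. (?X k T - ?W k T)\<^sup>2) \<le> second_moment_error C j * (1 / N k)" for k
    using power_coeff_concentration[OF balanced_D D_nonempty j nat_floor_level_le[OF \<alpha>]]
    by (simp add: sublevel_mean_def tableau_pmf_def sublevel_eq_nat[OF \<alpha>(1)] a_def m_def \<rho>_def mult.commute)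
  then have "(\<lambda>k. full.mean k (\<lambda>T. (?X k T - ?W k T)\<^sup>2)) \<longlonglongrightarrow> 0"
    by (intro Lim_null_comparison[OF _ tendsto_mult_right_zero[OF inverse_n_tendsto_0, of "second_moment_error C j"]])
       simp
  from full.convergent_in_mean_close_square[OF W this] show ?thesis by (simp add: a_def)
qed

lemma height_sublevel_convergent:
  assumes \<alpha>: "0 \<le> \<alpha>" "\<alpha> \<le> 1" and z: "z \<ge> 0"
  shows "full.convergent_in_mean (\<lambda>k T. diag_height (r k) z (sublevel \<alpha> k T))"
proof -
  interpret sub: balanced_random_shapes N C tableau_pmf "sublevel \<alpha>"
    by (rule balanced_random_shapes_sublevel[OF \<alpha>(1)])
  have "full.coeffs_convergent sub.series"
    using power_coeff_sublevel_convergent[OF \<alpha>]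
    by (intro full.coeffs_convergent_of_power_coeffs[where a = "\<lambda>j. 2 * j - 1"] sub.coeffs_bounded_series)
       (simp_all add: shape_series_nth_0 power_coeff_def)
  then show ?thesis
    unfolding sub.coeffs_convergent_iff_moments using sub.diag_height_convergent[OF _ z] by blast
qed

definition limit_height :: "real \<Rightarrow> real \<Rightarrow> real" where
  "limit_height \<alpha> z = lim (\<lambda>k. full.mean k (\<lambda>T. diag_height (r k) z (sublevel \<alpha> k T)))"

lemma height_converges_in_mean:
  assumes "0 < \<alpha>" "\<alpha> < 1" "z \<ge> 0"
  shows "full.converges_in_mean (\<lambda>k T. diag_height (r k) z (sublevel \<alpha> k T)) (limit_height \<alpha> z)"
  unfolding limit_height_def using assms
  by (intro full.converges_in_mean_lim height_sublevel_convergent) auto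

lemma limit_height_nonneg:
  assumes "0 < \<alpha>" "\<alpha> < 1" "z \<ge> 0" shows "0 \<le> limit_height \<alpha> z"
  by (rule full.converges_in_mean_le[OF full.converges_in_mean_deterministic[OF tendsto_const]
        height_converges_in_mean[OF assms]]) (rule diag_height_nonneg[OF r_pos])

lemma limit_height_antimono:
  assumes "0 < \<alpha>" "\<alpha> < 1" "0 \<le> z" "z \<le> z'" shows "limit_height \<alpha> z' \<le> limit_height \<alpha> z"
  using assms
  by (intro full.converges_in_mean_le[OF height_converges_in_mean height_converges_in_mean]
      diag_height_antimono r_pos shape_sublevel) (auto simp: set_tableau_pmf)

lemma limit_height_lipschitz:
  assumes "0 < \<alpha>" "\<alpha> < 1" "0 \<le> z" "z \<le> z'"
  shows "limit_height \<alpha> z \<le> limit_height \<alpha> z' + (z' - z)"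
proof (rule full.converges_in_mean_le[OF height_converges_in_mean])
  have "(\<lambda>k. (z' - z) + 2 * (1 / r k)) \<longlonglongrightarrow> z' - z"
    using tendsto_add[OF tendsto_const tendsto_mult_right_zero[OF inverse_r_tendsto_0]] by force
  then show "full.converges_in_mean
      (\<lambda>k T. diag_height (r k) z' (sublevel \<alpha> k T) + ((z' - z) + 2 * (1 / r k))) (limit_height \<alpha> z' + (z' - z))"
    using assms
    by (intro full.converges_in_mean_add height_converges_in_mean full.converges_in_mean_deterministic) auto
  show "diag_height (r k) z (sublevel \<alpha> k T) \<le>
      diag_height (r k) z' (sublevel \<alpha> k T) + ((z' - z) + 2 * (1 / r k))"
    if "T \<in> set_pmf (tableau_pmf k)" for k T
    using diag_height_lipschitz[OF r_pos[of k] shape_sublevel[of \<alpha> T k], of z z'] that assms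
    by (simp add: set_tableau_pmf)
qed (use assms in auto)

lemma limit_height_eq_0:
  assumes "0 < \<alpha>" "\<alpha> < 1" "z \<ge> C + 1" shows "limit_height \<alpha> z = 0"
proof (rule antisym)
  have z: "z \<ge> 0" using assms C_pos by simp
  then show "0 \<le> limit_height \<alpha> z" using assms by (intro limit_height_nonneg)
  show "limit_height \<alpha> z \<le> 0"
  proof (rule full.converges_in_mean_le[OF height_converges_in_mean[OF assms(1,2) z]
        full.converges_in_mean_deterministic[OF tendsto_const]])
    fix k T assume T: "T \<in> set_pmf (tableau_pmf k)"
    have "r k * (C + 1) \<le> r k * z" using assms r_pos[of k] by (intro mult_left_mono) auto
    then have "C * r k + r k \<le> r k * z" by (simp add: algebra_simps)
    then have "C * r k \<le> real (nat \<lfloor>r k * z\<rfloor>)" using r_ge_1[of k] by linarith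
    then show "diag_height (r k) z (sublevel \<alpha> k T) \<le> 0"
      using diag_count_eq_0_of_ge[OF balanced_sublevel] T assms(1) by (simp add: diag_height_def set_tableau_pmf)
  qed
qed

lemma limit_height_mono:
  assumes "0 < \<alpha>" "\<alpha> \<le> \<beta>" "\<beta> < 1" "z \<ge> 0" shows "limit_height \<alpha> z \<le> limit_height \<beta> z"
  using assms
  by (intro full.converges_in_mean_le[OF height_converges_in_mean height_converges_in_mean]
      diag_height_mono r_pos sublevel_mono finite_subset[OF sublevel_subset finite_shifted_shape[OF shape_D]]) auto

lemma limit_height_le:
  assumes "0 < \<alpha>" "\<alpha> < 1" "z \<ge> 0" shows "limit_height \<alpha> z \<le> h\<^sub>1 z"
  by (rule full.converges_in_mean_le[OF height_converges_in_mean[OF assms]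
        full.converges_in_mean_deterministic[OF height_D[OF assms(3), folded r_def]]])
     (rule diag_height_mono[OF r_pos finite_shifted_shape[OF shape_D] sublevel_subset])

lemma limit_height_le_add_sqrt:
  assumes \<alpha>\<beta>: "0 < \<alpha>" "\<alpha> \<le> \<beta>" "\<beta> < 1" and z: "z \<ge> 0"
  shows "limit_height \<beta> z \<le> limit_height \<alpha> z + sqrt (\<beta> - \<alpha>)"
proof (rule full.converges_in_mean_le[OF height_converges_in_mean])
  define s where "s k = sqrt (real (nat \<lfloor>N k * \<beta>\<rfloor>) / N k - real (nat \<lfloor>N k * \<alpha>\<rfloor>) / N k)" for k
  have "s \<longlonglongrightarrow> sqrt (\<beta> - \<alpha>)"
    unfolding s_def using \<alpha>\<beta> by (intro tendsto_real_sqrt tendsto_diff level_ratio_tendsto) auto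
  then show "full.converges_in_mean (\<lambda>k T. diag_height (r k) z (sublevel \<alpha> k T) + s k)
      (limit_height \<alpha> z + sqrt (\<beta> - \<alpha>))"
    using \<alpha>\<beta> z by (intro full.converges_in_mean_add height_converges_in_mean full.converges_in_mean_deterministic) auto
  fix k T assume "T \<in> set_pmf (tableau_pmf k)"
  then have T: "T \<in> standard_tableaux (D k)" by (simp add: set_tableau_pmf)
  let ?E = "sublevel \<alpha> k T" and ?F = "sublevel \<beta> k T"
  have shapes: "shifted_shape ?E" "shifted_shape ?F" using shape_sublevel[OF _ T] \<alpha>\<beta> by auto
  have sub: "?E \<subseteq> ?F" by (rule sublevel_mono[OF \<alpha>\<beta>(2)])
  then have "real (card (?F - ?E)) = real (card ?F) - real (card ?E)"
    using finite_shifted_shape[OF shapes(2)] finite_shifted_shape[OF shapes(1)]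
    by (simp add: card_Diff_subset card_mono)
  also have "\<dots> = real (nat \<lfloor>N k * \<beta>\<rfloor>) - real (nat \<lfloor>N k * \<alpha>\<rfloor>)"
    using card_sublevel_eq[OF _ _ T] \<alpha>\<beta> by simp
  finally have "sqrt (2 * real (card (?F - ?E)) / (r k)\<^sup>2) = s k"
    by (simp add: s_def power2_eq_square r_mult_r diff_divide_distrib)
  then show "diag_height (r k) z ?F \<le> diag_height (r k) z ?E + s k"
    using diag_height_growth_le[OF shapes(2,1) sub, of "r k" z] by simp
qed (use \<alpha>\<beta> z in auto)

lemma limit_height_right_continuous:
  assumes \<alpha>: "0 < \<alpha>" "\<alpha> < 1" and z: "z \<ge> 0" and e: "e > 0"
  shows "\<exists>\<beta>>\<alpha>. \<beta> < 1 \<and> limit_height \<beta> z < limit_height \<alpha> z + e"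
proof -
  define \<beta> where "\<beta> = \<alpha> + min ((1 - \<alpha>) / 2) (e\<^sup>2 / 4)"
  have \<beta>: "\<alpha> < \<beta>" "\<beta> < 1" "\<beta> - \<alpha> \<le> (e / 2)\<^sup>2" using \<alpha> e by (auto simp: \<beta>_def min_def field_simps)
  then have "sqrt (\<beta> - \<alpha>) \<le> e / 2" using e by (intro real_le_lsqrt) auto
  then have "limit_height \<beta> z < limit_height \<alpha> z + e"
    using limit_height_le_add_sqrt[of \<alpha> \<beta> z] \<alpha> \<beta> z e by simp
  then show ?thesis using \<beta> by blast
qed

lemma heights_converge_uniformly_in_prob:
  assumes \<alpha>: "0 < \<alpha>" "\<alpha> < 1" and \<delta>: "\<delta> > 0"
  shows "(\<lambda>k. measure_pmf.prob (tableau_pmf k)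
    {T. \<exists>x\<ge>0. \<bar>diag_height (r k) x (sublevel \<alpha> k T) - limit_height \<alpha> x\<bar> > \<delta>}) \<longlonglongrightarrow> 0"
proof -
  define \<eta> where "\<eta> = \<delta> / 2"
  have \<eta>: "\<eta> > 0" using \<delta> by (simp add: \<eta>_def)
  obtain L :: nat where L: "real L * \<eta> \<ge> C + 1"
    using real_arch_simple[of "(C + 1) / \<eta>"] \<eta> by (auto simp: divide_le_eq)
  define A where "A i k = {T. \<bar>diag_height (r k) (real i * \<eta>) (sublevel \<alpha> k T) - limit_height \<alpha> (real i * \<eta>)\<bar> > \<eta>}"
    for i k
  have "(\<lambda>k. measure_pmf.prob (tableau_pmf k) (A i k)) \<longlonglongrightarrow> 0" for i
    unfolding A_def using \<eta> by (intro full.converges_in_mean_imp_in_prob height_converges_in_mean \<alpha>) auto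
  then have lim: "(\<lambda>k. \<Sum>i\<le>L. measure_pmf.prob (tableau_pmf k) (A i k)) \<longlonglongrightarrow> 0"
    using tendsto_sum[of "{..L}" "\<lambda>i k. measure_pmf.prob (tableau_pmf k) (A i k)" "\<lambda>_. 0"] by simp
  have near: "\<bar>diag_height (r k) x (sublevel \<alpha> k T) - limit_height \<alpha> x\<bar> \<le> \<delta>"
    if T: "T \<in> standard_tableaux (D k)" "T \<notin> (\<Union>i\<le>L. A i k)" and x: "x \<ge> 0" for k T x
  proof -
    have "\<bar>diag_height (r k) x (sublevel \<alpha> k T) - limit_height \<alpha> x\<bar> \<le> \<eta> + \<eta>"
    proof (rule abs_diff_le_from_grid[where f = "\<lambda>x. diag_height (r k) x (sublevel \<alpha> k T)"
          and g = "limit_height \<alpha>" and L = L])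
      show "\<bar>diag_height (r k) (real i * \<eta>) (sublevel \<alpha> k T) - limit_height \<alpha> (real i * \<eta>)\<bar> \<le> \<eta>" if "i \<le> L" for i
        using T(2) that by (auto simp: A_def not_less)
    qed (use diag_height_antimono[OF r_pos shape_sublevel[OF _ T(1)]] diag_height_nonneg[OF r_pos]
        limit_height_antimono limit_height_nonneg limit_height_lipschitz limit_height_eq_0 L \<eta> \<alpha> x in auto)
    then show ?thesis by (simp add: \<eta>_def)
  qed
  have "measure_pmf.prob (tableau_pmf k)
      {T. \<exists>x\<ge>0. \<bar>diag_height (r k) x (sublevel \<alpha> k T) - limit_height \<alpha> x\<bar> > \<delta>} \<le>
      (\<Sum>i\<le>L. measure_pmf.prob (tableau_pmf k) (A i k))" for k
  proof -
    have "measure_pmf.prob (tableau_pmf k)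
        {T. \<exists>x\<ge>0. \<bar>diag_height (r k) x (sublevel \<alpha> k T) - limit_height \<alpha> x\<bar> > \<delta>} \<le>
        measure_pmf.prob (tableau_pmf k) (\<Union>i\<le>L. A i k)"
      by (rule measure_pmf.finite_measure_mono_AE)
         (use near in \<open>force simp: AE_measure_pmf_iff set_tableau_pmf not_less[symmetric]\<close>)+
    also have "\<dots> \<le> (\<Sum>i\<le>L. measure_pmf.prob (tableau_pmf k) (A i k))"
      by (rule measure_pmf.finite_measure_subadditive_finite) auto
    finally show ?thesis .
  qed
  then show ?thesis by (intro Lim_null_comparison[OF _ lim]) simp
qed

end

locale balanced_partition_sequence =
  fixes \<xi> :: "nat \<Rightarrow> nat list" and n :: "nat \<Rightarrow> nat" and \<Omega>\<^sub>1 :: "real \<Rightarrow> real" and C :: real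
  assumes n_pos: "n k > 0" and n_tendsto: "filterlim n at_top sequentially"
    and partition: "\<xi> k \<in> strict_partitions (n k)"
    and profile_tendsto: "z \<ge> 0 \<Longrightarrow>
      (\<lambda>k. dilated_profile (1 / sqrt (2 * real (n k))) (\<xi> k) z) \<longlonglongrightarrow> \<Omega>\<^sub>1 z"
    and balance_constant_pos: "C > 0" and first_part_less: "real (nth_part (\<xi> k) 1) < C * sqrt (real (n k))"
begin

lemma inverse_sqrt_n_tendsto_0: "(\<lambda>k. 1 / sqrt (2 * real (n k))) \<longlonglongrightarrow> 0"
proof -
  have "filterlim (\<lambda>k. real (n k)) at_top sequentially"
    by (rule filterlim_compose[OF filterlim_real_sequentially n_tendsto])
  then have "filterlim (\<lambda>k. sqrt (2 * real (n k))) at_top sequentially"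
    by (intro filterlim_compose[OF sqrt_at_top] filterlim_tendsto_pos_mult_at_top[OF tendsto_const]) simp
  from tendsto_inverse_0_at_top[OF this] show ?thesis by (simp add: inverse_eq_divide)
qed

lemma height_tendsto:
  assumes z: "z \<ge> 0"
  shows "(\<lambda>k. diag_height (sqrt (2 * real (n k))) z (shifted_diagram (\<xi> k))) \<longlonglongrightarrow> (\<Omega>\<^sub>1 z - z) / 2"
proof -
  let ?p = "\<lambda>k. dilated_profile (1 / sqrt (2 * real (n k))) (\<xi> k) z"
  let ?h = "\<lambda>k. diag_height (sqrt (2 * real (n k))) z (shifted_diagram (\<xi> k))"
  have "\<bar>?p k - (z + 2 * ?h k)\<bar> \<le> 2 * (1 / sqrt (2 * real (n k)))" for k
    using dilated_profile_approx[OF partition z, of "sqrt (2 * real (n k))" k] n_pos[of k] by simp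
  then have "(\<lambda>k. ?p k - (z + 2 * ?h k)) \<longlonglongrightarrow> 0"
    by (intro Lim_null_comparison[OF _ tendsto_mult_right_zero[OF inverse_sqrt_n_tendsto_0, of 2]]) simp
  then have "(\<lambda>k. (?p k - (?p k - (z + 2 * ?h k)) - z) / 2) \<longlonglongrightarrow> (\<Omega>\<^sub>1 z - 0 - z) / 2"
    by (intro tendsto_intros profile_tendsto z) auto
  then show ?thesis by simp
qed

sublocale balanced_shape_sequence "\<lambda>k. shifted_diagram (\<xi> k)" C "\<lambda>z. (\<Omega>\<^sub>1 z - z) / 2"
proof
  note card = card_shifted_diagram[OF partition]
  show "shifted_diagram (\<xi> k) \<noteq> {}" for k using card[of k] n_pos[of k] by auto
  show "filterlim (\<lambda>k. card (shifted_diagram (\<xi> k))) at_top sequentially" unfolding card by (rule n_tendsto)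
  show "balanced C (card (shifted_diagram (\<xi> k))) (shifted_diagram (\<xi> k))" for k
    unfolding balanced_def card
  proof (intro conjI ballI order_refl shifted_shape_shifted_diagram[OF partition])
    fix b assume "b \<in> shifted_diagram (\<xi> k)"
    from box_content_less_first_part[OF partition this]
    show "real (box_content b) + 1 \<le> C * sqrt (real (n k))" using first_part_less[of k] by linarith
  qed
  show "(\<lambda>k. diag_height (sqrt (2 * real (card (shifted_diagram (\<xi> k))))) z (shifted_diagram (\<xi> k)))
      \<longlonglongrightarrow> (\<Omega>\<^sub>1 z - z) / 2" if "z \<ge> 0" for z
    unfolding card by (rule height_tendsto[OF that])
qed (rule balance_constant_pos)

lemma level_curve_limit_height:
  assumes \<alpha>: "0 < \<alpha>" "\<alpha> < 1" and z: "z \<ge> 0"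
  shows "level_curve (limit_region \<Omega>\<^sub>1) (level_function limit_height) \<alpha> z = z + 2 * limit_height \<alpha> z"
  using limit_height_le[OF \<alpha> z] \<alpha> z
  by (intro level_curve_level_function limit_height_nonneg limit_height_mono limit_height_right_continuous)
     auto

lemma profile_deviation_le:
  assumes \<alpha>: "0 < \<alpha>" "\<alpha> < 1" and x: "x \<ge> 0" and T: "T \<in> shifted_tableaux (\<xi> k)"
  shows "\<bar>dilated_profile (1 / sqrt (2 * real (n k))) (tableau_le (\<xi> k) T (\<alpha> * real (n k))) x -
      level_curve (limit_region \<Omega>\<^sub>1) (level_function limit_height) \<alpha> x\<bar> \<le>
    2 * \<bar>diag_height (r k) x (sublevel \<alpha> k T) - limit_height \<alpha> x\<bar> + 2 / r k"
proof -
  let ?ys = "tableau_le (\<xi> k) T (\<alpha> * real (n k))"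
  have r: "r k = sqrt (2 * real (n k))" unfolding r_def by (simp add: card_shifted_diagram[OF partition])
  obtain m where "?ys \<in> strict_partitions m" and "shifted_diagram ?ys = sublevel \<alpha> k T"
    using tableau_le_diagram[OF partition T] by (auto simp: sublevel_def card_shifted_diagram[OF partition])
  then have approx: "\<bar>dilated_profile (1 / r k) ?ys x - (x + 2 * diag_height (r k) x (sublevel \<alpha> k T))\<bar> \<le> 2 / r k"
    using dilated_profile_approx[OF _ x r_pos] by metis
  have "\<bar>p - (x + 2 * g)\<bar> \<le> 2 * \<bar>h - g\<bar> + e" if "\<bar>p - (x + 2 * h)\<bar> \<le> e" for p h g e :: real
    using that by (simp add: abs_if split: if_splits)
  from this[OF approx] show ?thesis by (simp add: r level_curve_limit_height[OF \<alpha> x])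
qed

lemma profile_deviation_prob_tendsto_0:
  assumes \<alpha>: "0 < \<alpha>" "\<alpha> < 1" and \<epsilon>: "\<epsilon> > 0"
  shows "(\<lambda>k. measure_pmf.prob (pmf_of_set (shifted_tableaux (\<xi> k)))
    {T. (SUP x\<in>{0..}. ereal \<bar>dilated_profile (1 / sqrt (2 * real (n k))) (tableau_le (\<xi> k) T (\<alpha> * real (n k))) x -
      level_curve (limit_region \<Omega>\<^sub>1) (level_function limit_height) \<alpha> x\<bar>) > ereal \<epsilon>}) \<longlonglongrightarrow> 0"
    (is "(\<lambda>k. measure_pmf.prob _ (?A k)) \<longlonglongrightarrow> 0")
proof -
  let ?B = "\<lambda>k. {T. \<exists>x\<ge>0. \<bar>diag_height (r k) x (sublevel \<alpha> k T) - limit_height \<alpha> x\<bar> > \<epsilon> / 4}"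
  have pmf: "tableau_pmf k = pmf_of_set (shifted_tableaux (\<xi> k))" for k
    by (simp add: tableau_pmf_def shifted_tableaux_eq_standard_tableaux[OF partition])
  have "\<forall>\<^sub>F k in sequentially. 1 / r k < \<epsilon> / 4"
    using order_tendstoD(2)[OF inverse_r_tendsto_0, of "\<epsilon> / 4"] \<epsilon> by simp
  then have "\<forall>\<^sub>F k in sequentially. measure_pmf.prob (tableau_pmf k) (?A k) \<le> measure_pmf.prob (tableau_pmf k) (?B k)"
  proof eventually_elim
    case (elim k)
    have "T \<notin> ?A k" if T: "T \<in> shifted_tableaux (\<xi> k)" and "T \<notin> ?B k" for T
    proof -
      have "\<bar>dilated_profile (1 / sqrt (2 * real (n k))) (tableau_le (\<xi> k) T (\<alpha> * real (n k))) x -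
          level_curve (limit_region \<Omega>\<^sub>1) (level_function limit_height) \<alpha> x\<bar> \<le> \<epsilon>" if "x \<ge> 0" for x
      proof -
        have "\<bar>diag_height (r k) x (sublevel \<alpha> k T) - limit_height \<alpha> x\<bar> \<le> \<epsilon> / 4"
          using \<open>T \<notin> ?B k\<close> that by (auto simp: not_less)
        moreover have "2 / r k \<le> \<epsilon> / 2" using elim r_pos[of k] by (simp add: field_simps)
        ultimately have "2 * \<bar>diag_height (r k) x (sublevel \<alpha> k T) - limit_height \<alpha> x\<bar> + 2 / r k \<le> \<epsilon>"
          by simp
        with profile_deviation_le[OF \<alpha> that T] show ?thesis by (rule order_trans)
      qed
      then show ?thesis by (auto simp: not_less intro!: SUP_least)
    qed
    then show ?case
      by (intro measure_pmf.finite_measure_mono_AE)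
         (auto simp: AE_measure_pmf_iff set_tableau_pmf shifted_tableaux_eq_standard_tableaux[OF partition])
  qed
  moreover have "(\<lambda>k. measure_pmf.prob (tableau_pmf k) (?B k)) \<longlonglongrightarrow> 0"
    using \<epsilon> by (intro heights_converge_uniformly_in_prob[OF \<alpha>]) simp
  ultimately have "(\<lambda>k. measure_pmf.prob (tableau_pmf k) (?A k)) \<longlonglongrightarrow> 0"
    by (intro Lim_null_comparison[of "\<lambda>k. measure_pmf.prob (tableau_pmf k) (?A k)"]) simp_all
  then show ?thesis unfolding pmf .
qed

end

theorem theorem1p1:
  fixes \<xi> :: "nat \<Rightarrow> nat list" and n :: "nat \<Rightarrow> nat" and \<Omega>\<^sub>1 :: "real \<Rightarrow> real" and C :: real
  assumes "\<And>k. k \<ge> 1 \<Longrightarrow> n k > 0"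
    and "filterlim n at_top sequentially"
    and "\<And>k. k \<ge> 1 \<Longrightarrow> \<xi> k \<in> strict_partitions (n k)"
    and "\<And>z. z \<ge> 0 \<Longrightarrow>
           (\<lambda>k. dilated_profile (1 / sqrt (2 * real (n k))) (\<xi> k) z) \<longlonglongrightarrow> \<Omega>\<^sub>1 z"
    and "C > 0"
    and "\<And>k. k \<ge> 1 \<Longrightarrow> real (nth_part (\<xi> k) 1) < C * sqrt (real (n k))"
  shows "\<exists>F \<in> limit_region \<Omega>\<^sub>1 \<rightarrow> {0..1}.
    \<forall>\<alpha> \<epsilon>. 0 < \<alpha> \<and> \<alpha> < 1 \<and> \<epsilon> > 0 \<longrightarrow>
      (\<lambda>k. measure_pmf.prob (pmf_of_set (shifted_tableaux (\<xi> k)))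
         {T. (SUP x\<in>{0..}. ereal
                \<bar>dilated_profile (1 / sqrt (2 * real (n k))) (tableau_le (\<xi> k) T (\<alpha> * real (n k))) x
                 - level_curve (limit_region \<Omega>\<^sub>1) F \<alpha> x\<bar>) > ereal \<epsilon>})
      \<longlonglongrightarrow> 0"
proof -
  interpret balanced_partition_sequence "\<lambda>k. \<xi> (Suc k)" "\<lambda>k. n (Suc k)" \<Omega>\<^sub>1 C
    by unfold_locales
       (use assms in \<open>auto intro: filterlim_compose[OF _ filterlim_Suc]
          LIMSEQ_Suc[of "\<lambda>k. dilated_profile (1 / sqrt (2 * real (n k))) (\<xi> k) _"]\<close>)
  show ?thesis
  proof (intro bexI[of _ "level_function limit_height"] allI impI; (elim conjE)?)
    show "level_function limit_height \<in> limit_region \<Omega>\<^sub>1 \<rightarrow> {0..1}"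
      using level_function_in_unit_interval by blast
    fix \<alpha> \<epsilon> :: real assume "0 < \<alpha>" "\<alpha> < 1" "\<epsilon> > 0"
    then show "(\<lambda>k. measure_pmf.prob (pmf_of_set (shifted_tableaux (\<xi> k)))
         {T. (SUP x\<in>{0..}. ereal
                \<bar>dilated_profile (1 / sqrt (2 * real (n k))) (tableau_le (\<xi> k) T (\<alpha> * real (n k))) x
                 - level_curve (limit_region \<Omega>\<^sub>1) (level_function limit_height) \<alpha> x\<bar>) > ereal \<epsilon>})
      \<longlonglongrightarrow> 0"
      by (rule LIMSEQ_imp_Suc[OF profile_deviation_prob_tendsto_0])
  qed
qed

end
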